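(* Let $p\in(0,1)$ and let $(X_n)_{n\in\mathbb{Z}}$ be a stationary, strongly mixing sequence of real-valued random variables with distribution function $F$ and strong mixing coefficients $\alpha(n)$. Let $t_p=F^{-1}(p)$. Assume that for some $\rho>0$ with $\rho\neq 1$ and some $M\neq 0$ $$F(t_p+h)-F(t_p)=M|h|^\rho\operatorname{sgn}(h)+o(|h|^\rho)\quad\text{as }h\to 0,$$ that $\sum_{n=1}^\infty\alpha(n)<\infty$, and that $\lim_{n\to\infty}\operatorname{Var}[\sqrt n F_n(t_p)]>0$. Consider the circular block bootstrap with block length $l=l_n$ chosen such that $\frac1l+\frac ln\to 0$ as $n\to\infty$. Then $$\sup_{t\in\mathbb{R}}\left|P^\star\bigl(F_n^{\star-1}(p)-F_n^{-1}(p)\le t\bigr)-P\bigl(F_n^{-1}(p)-t_p\le t\bigr)\right|\longrightarrow Z_\rho$$ in distribution as $n\to\infty$, where $Z_\rho$ is a non-degenerate (i.e. not almost surely constant) random variable.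
   Context: For a distribution function $G$ and $p\in(0,1)$, the $p$-quantile is $G^{-1}(p):=\inf\{t\in\mathbb{R}: G(t)\ge p\}$. The empirical distribution function is $F_n(t):=\frac1n\sum_{i=1}^n \mathbf{1}_{\{X_i\le t\}}$, and $F_n^{-1}(p)$ is its $p$-quantile. The strong mixing coefficients are $$\alpha(k):=\sup\{|P(A\cap B)-P(A)P(B)|: A\in\mathcal{F}_1^n,\ B\in\mathcal{F}_{n+k}^\infty,\ n\in\mathbb{Z}\},$$ where $\mathcal{F}_a^l$ is the $\sigma$-field generated by $X_a,\ldots,X_l$ (trivial if $l<a$); the sequence is strongly mixing if $\alpha(k)\to 0$ as $k\to\infty$. Circular block bootstrap: for each $n$, let $l=l_n\in\{1,\ldots,n\}$ be the block length and $b=\lfloor n/l\rfloor$. Extend the sample $X_1,\ldots,X_n$ periodically, i.e. in the resampling an index $i+n$ is read as $i$ ($X_{i+n}:=X_i$). The bootstrap sample $X_1^\star,\ldots,X_{bl}^\star$ consists of $b$ blocks of length $l$ which, conditionally on $(X_n)_{n\in\mathbb{N}}$, are independent, each one chosen uniformly: the starting index $j$ is uniform on $\{1,\ldots,n\}$, so that for $k=0,\ldots,b-1$ and $j=1,\ldots,n$ $$P^\star\bigl(X^\star_{kl+1}=X_j,\ldots,X^\star_{(k+1)l}=X_{j+l-1}\bigr)=\tfrac1n,$$ where $P^\star$ is the conditional probability given $(X_n)_{n\in\mathbb{N}}$. Set $F_n^\star(t):=\frac{1}{bl}\sum_{i=1}^{bl}\mathbf{1}_{\{X_i^\star\le t\}}$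 and let $F_n^{\star-1}(p)$ be its $p$-quantile. Convention: $\operatorname{sgn}(0)=0$. (Since $F$ is nondecreasing, $M\ne 0$ forces $M>0$.) *)

theory Defs
  imports "HOL-Probability.Probability" "HOL-Library.Landau_Symbols"
begin

section \<open>Quantiles and empirical distribution functions\<close>

definition quantile :: "(real \<Rightarrow> real) \<Rightarrow> real \<Rightarrow> real" where
  "quantile G p = Inf {t. p \<le> G t}"

definition ecdf :: "nat \<Rightarrow> (nat \<Rightarrow> real) \<Rightarrow> real \<Rightarrow> real" where
  "ecdf m x t = (1 / real m) * (\<Sum>i=1..m. indicator {..t} (x i))"


section \<open>Stationary and strongly mixing sequences\<close>

definition strictly_stationary :: "'a measure \<Rightarrow> (int \<Rightarrow> 'a \<Rightarrow> real) \<Rightarrow> bool" where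
  "strictly_stationary M X \<longleftrightarrow>
     (\<forall>k. distr M (\<Pi>\<^sub>M i\<in>UNIV. borel) (\<lambda>\<omega> i. X (i + k) \<omega>) =
          distr M (\<Pi>\<^sub>M i\<in>UNIV. borel) (\<lambda>\<omega> i. X i \<omega>))"

text \<open>The \<open>\<sigma>\<close>-field generated by \<open>X i\<close>, \<open>i \<in> I\<close>, as a measure space carrying the null measure;
  it is trivial for \<open>I = {}\<close>.\<close>

definition gen_sigma :: "'a measure \<Rightarrow> (int \<Rightarrow> 'a \<Rightarrow> real) \<Rightarrow> int set \<Rightarrow> 'a measure" where
  "gen_sigma M X I = sigma (space M) {X i -` S \<inter> space M | i S. i \<in> I \<and> S \<in> sets borel}"

definition mixing_coeff :: "'a measure \<Rightarrow> (int \<Rightarrow> 'a \<Rightarrow> real) \<Rightarrow> nat \<Rightarrow> real" where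
  "mixing_coeff M X k =
     Sup {\<bar>measure M (A \<inter> B) - measure M A * measure M B\<bar> | A B n.
            A \<in> sets (gen_sigma M X {1..n}) \<and> B \<in> sets (gen_sigma M X {n + int k..})}"

definition strongly_mixing :: "'a measure \<Rightarrow> (int \<Rightarrow> 'a \<Rightarrow> real) \<Rightarrow> bool" where
  "strongly_mixing M X \<longleftrightarrow> mixing_coeff M X \<longlonglongrightarrow> 0"


section \<open>The circular block bootstrap\<close>

definition periodic_ext :: "nat \<Rightarrow> (nat \<Rightarrow> real) \<Rightarrow> nat \<Rightarrow> real" where
  "periodic_ext n x i = x ((i - 1) mod n + 1)"

text \<open>Starting indices of the \<open>n div l\<close> blocks: independent, each uniform on \<open>{1..n}\<close>.\<close>

definition cbb_starts :: "nat \<Rightarrow> nat \<Rightarrow> (nat \<Rightarrow> nat) pmf" where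
  "cbb_starts n l = Pi_pmf {..<n div l} 1 (\<lambda>_. pmf_of_set {1..n})"

text \<open>If block \<open>k\<close> starts at index \<open>s k\<close>, the observation at place \<open>k * l + r\<close> with \<open>1 \<le> r \<le> l\<close>
  has index \<open>s k + r - 1\<close> in the periodically extended sample.\<close>

definition cbb_sample :: "nat \<Rightarrow> nat \<Rightarrow> (nat \<Rightarrow> real) \<Rightarrow> (nat \<Rightarrow> nat) \<Rightarrow> nat \<Rightarrow> real" where
  "cbb_sample n l x s i = periodic_ext n x (s ((i - 1) div l) + (i - 1) mod l)"

definition cbb_quantile :: "real \<Rightarrow> nat \<Rightarrow> nat \<Rightarrow> (nat \<Rightarrow> real) \<Rightarrow> (nat \<Rightarrow> nat) \<Rightarrow> real" where
  "cbb_quantile p n l x s = quantile (ecdf ((n div l) * l) (cbb_sample n l x s)) p"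

text \<open>The conditional distribution function, given that the data are \<open>x\<close>, of the centred bootstrap
  quantile. That this is a version of the conditional probability given the whole sequence is
  \<open>cbb_prob_is_cond_prob\<close> below. It is a distribution function in \<open>t\<close>, so that suprema over all
  real \<open>t\<close> are well defined.\<close>

definition cbb_prob :: "real \<Rightarrow> nat \<Rightarrow> nat \<Rightarrow> (nat \<Rightarrow> real) \<Rightarrow> real \<Rightarrow> real" where
  "cbb_prob p n l x t =
     measure_pmf.prob (cbb_starts n l) {s. cbb_quantile p n l x s - quantile (ecdf n x) p \<le> t}"


section \<open>The block law, conditional probability and measurability\<close>

lemma cbb_block_law:
  assumes "1 \<le> n" "k < n div l" "1 \<le> j" "j \<le> n"
  shows "measure_pmf.prob (cbb_starts n l) {s. s k = j} = 1 / real n"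
proof -
  have "measure_pmf.prob (cbb_starts n l) {s. s k = j}
      = measure_pmf.prob (map_pmf (\<lambda>s. s k) (cbb_starts n l)) {j}"
    by (simp add: vimage_def)
  also have "map_pmf (\<lambda>s. s k) (cbb_starts n l) = pmf_of_set {1..n}"
    using assms by (simp add: cbb_starts_def Pi_pmf_component)
  finally show ?thesis using assms by (simp add: measure_pmf_single)
qed

lemma cbb_sample_block:
  assumes "1 \<le> r" "r \<le> l"
  shows "cbb_sample n l x s (k * l + r) = periodic_ext n x (s k + r - 1)"
proof -
  have "k * l + r - 1 = (r - 1) + k * l" "r - 1 < l" using assms by auto
  then have "(k * l + r - 1) div l = k" "(k * l + r - 1) mod l = r - 1" by simp_all
  then show ?thesis using assms by (simp add: cbb_sample_def)
qed

lemma finite_set_cbb_starts: "1 \<le> n \<Longrightarrow> finite (set_pmf (cbb_starts n l))"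
  by (auto simp: cbb_starts_def set_Pi_pmf PiE_dflt_def
      intro!: finite_subset[OF _ finite_PiE_dflt[of "{..<n div l}" "\<lambda>_. {1..n}" 1]])

lemma quantile_ecdf_le_iff:
  assumes "0 < m" "0 < p" "p \<le> 1"
  shows "quantile (ecdf m x) p \<le> t \<longleftrightarrow> p \<le> ecdf m x t"
proof -
  let ?S = "{t. p \<le> ecdf m x t}"
  have mono: "ecdf m x s \<le> ecdf m x u" if "s \<le> u" for s u
    unfolding ecdf_def using that
    by (intro mult_left_mono sum_mono) (auto simp: indicator_def)
  have card: "ecdf m x u = real (card {i\<in>{1..m}. x i \<le> u}) / real m" for u
  proof -
    have "(\<Sum>i=1..m. indicator {..u} (x i)) = (\<Sum>i\<in>{1..m}. if x i \<le> u then 1 else 0 :: real)"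
      by (rule sum.cong) (auto simp: indicator_def)
    also have "\<dots> = (\<Sum>i\<in>{i\<in>{1..m}. x i \<le> u}. 1)"
      by (rule sum.inter_filter[symmetric]) simp
    finally show ?thesis by (simp add: ecdf_def)
  qed
  have S_eq: "?S = (\<Union>J\<in>{J. J \<subseteq> {1..m} \<and> p \<le> real (card J) / real m}. \<Inter>i\<in>J. {x i..})"
    (is "_ = ?U")
  proof (intro equalityI subsetI)
    fix u assume "u \<in> ?S"
    then show "u \<in> ?U"
      by (auto simp: card intro!: exI[of _ "{i\<in>{1..m}. x i \<le> u}"])
  next
    fix u assume "u \<in> ?U"
    then obtain J where J: "J \<subseteq> {1..m}" "p \<le> real (card J) / real m" "\<forall>i\<in>J. x i \<le> u" by auto
    then have "card J \<le> card {i\<in>{1..m}. x i \<le> u}" by (intro card_mono) auto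
    then have "real (card J) / real m \<le> ecdf m x u" by (simp add: card divide_right_mono)
    then show "u \<in> ?S" using J by simp
  qed
  have closed: "closed ?S"
    unfolding S_eq by (intro closed_UN closed_INT) auto
  have bdd: "bdd_below ?S"
  proof (rule bdd_belowI)
    fix u assume "u \<in> ?S"
    then have "0 < real (card {i\<in>{1..m}. x i \<le> u}) / real m" using assms(2) by (simp only: card mem_Collect_eq)
    then have "card {i\<in>{1..m}. x i \<le> u} \<noteq> 0" by (metis div_0 less_irrefl of_nat_0)
    then have "{i\<in>{1..m}. x i \<le> u} \<noteq> {}" by (metis card.empty)
    then obtain i where "i \<in> {1..m}" "x i \<le> u" by blast
    then show "Min (x ` {1..m}) \<le> u" by (meson Min_le finite_atLeastAtMost finite_imageI image_eqI order_trans)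
  qed
  have "{i\<in>{1..m}. x i \<le> Max (x ` {1..m})} = {1..m}" by auto
  then have "ecdf m x (Max (x ` {1..m})) = 1" using assms by (simp add: card)
  then have "Max (x ` {1..m}) \<in> ?S" using assms by simp
  then have ne: "?S \<noteq> {}" by blast
  have "Inf ?S \<in> ?S" by (rule closed_contains_Inf[OF ne bdd closed])
  then show ?thesis
    unfolding quantile_def using mono[of "Inf ?S" t] cInf_lower[of t ?S, OF _ bdd]
    by (auto intro: order_trans)
qed

lemma measurable_quantile_ecdf:
  assumes p: "0 < p" "p \<le> 1" and x [measurable]: "\<And>i. 1 \<le> i \<Longrightarrow> (\<lambda>\<omega>. x \<omega> i) \<in> borel_measurable M"
  shows "(\<lambda>\<omega>. quantile (ecdf m (x \<omega>)) p) \<in> borel_measurable M"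
proof (cases "m = 0")
  case True
  then show ?thesis by (simp add: ecdf_def[abs_def])
next
  case False
  have [measurable]: "(\<lambda>\<omega>. ecdf m (x \<omega>) t) \<in> borel_measurable M" for t
    unfolding ecdf_def
    by (intro borel_measurable_times borel_measurable_const borel_measurable_sum
        borel_measurable_indicator' x) auto
  have "{\<omega>\<in>space M. quantile (ecdf m (x \<omega>)) p \<le> t} = {\<omega>\<in>space M. p \<le> ecdf m (x \<omega>) t}" for t
    using False p by (simp add: quantile_ecdf_le_iff)
  then show ?thesis by (subst borel_measurable_iff_le) auto
qed

lemma measurable_cbb_quantile:
  assumes p: "0 < p" "p \<le> 1" and x [measurable]: "\<And>i. 1 \<le> i \<Longrightarrow> (\<lambda>\<omega>. x \<omega> i) \<in> borel_measurable M"
  shows "(\<lambda>\<omega>. cbb_quantile p n l (x \<omega>) s) \<in> borel_measurable M"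
  unfolding cbb_quantile_def
  by (rule measurable_quantile_ecdf[OF p]) (simp add: cbb_sample_def periodic_ext_def x)

lemma cbb_prob_sum:
  assumes "1 \<le> n"
  shows "cbb_prob p n l x t = (\<Sum>s\<in>set_pmf (cbb_starts n l). pmf (cbb_starts n l) s *
           indicator {s. cbb_quantile p n l x s - quantile (ecdf n x) p \<le> t} s)"
proof -
  have "cbb_prob p n l x t = measure_pmf.expectation (cbb_starts n l)
          (indicator {s. cbb_quantile p n l x s - quantile (ecdf n x) p \<le> t})"
    by (simp add: cbb_prob_def)
  also have "\<dots> = (\<Sum>s\<in>set_pmf (cbb_starts n l). pmf (cbb_starts n l) s *
           indicator {s. cbb_quantile p n l x s - quantile (ecdf n x) p \<le> t} s)"
    by (subst integral_measure_pmf[OF finite_set_cbb_starts[OF assms]]) auto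
  finally show ?thesis .
qed

lemma measurable_cbb_prob:
  assumes p: "0 < p" "p \<le> 1" and "1 \<le> n"
    and x: "\<And>i. 1 \<le> i \<Longrightarrow> (\<lambda>\<omega>. x \<omega> i) \<in> borel_measurable M"
  shows "(\<lambda>\<omega>. cbb_prob p n l (x \<omega>) t) \<in> borel_measurable M"
proof -
  note [measurable] = measurable_cbb_quantile[OF p x] measurable_quantile_ecdf[OF p x]
  have "(\<lambda>\<omega>. indicator {s. cbb_quantile p n l (x \<omega>) s - quantile (ecdf n (x \<omega>)) p \<le> t} s :: real)
      = (\<lambda>\<omega>. indicator {..t} (cbb_quantile p n l (x \<omega>) s - quantile (ecdf n (x \<omega>)) p))" for s
    by (auto simp: indicator_def)
  then show ?thesis
    using \<open>1 \<le> n\<close> by (simp add: cbb_prob_sum)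
qed

lemma cSUP_Rats_eq:
  fixes f :: "real \<Rightarrow> real"
  assumes bdd: "bdd_above (range f)" and rc: "\<And>t. continuous (at_right t) f"
  shows "(SUP t. f t) = (SUP t\<in>\<rat>. f t)"
proof (rule antisym)
  have bdd': "bdd_above (f ` \<rat>)" by (rule bdd_above_mono[OF bdd]) auto
  show "(SUP t. f t) \<le> (SUP t\<in>\<rat>. f t)"
  proof (rule cSUP_least)
    fix t
    show "f t \<le> (SUP t\<in>\<rat>. f t)"
    proof (rule ccontr)
      assume "\<not> ?thesis"
      then have "eventually (\<lambda>u. (SUP t\<in>\<rat>. f t) < f u) (at_right t)"
        using rc[of t] by (auto simp: continuous_within intro: order_tendstoD)
      then obtain b where b: "b > t" "\<And>u. t < u \<Longrightarrow> u < b \<Longrightarrow> (SUP t\<in>\<rat>. f t) < f u"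
        by (auto simp: eventually_at_right_field)
      obtain q where "q \<in> \<rat>" "t < q" "q < b" using Rats_dense_in_real[OF b(1)] by auto
      then show False using b(2)[of q] cSUP_upper[OF _ bdd', of q] by fastforce
    qed
  qed simp
  show "(SUP t\<in>\<rat>. f t) \<le> (SUP t. f t)"
    by (rule cSUP_subset_mono) (use bdd in \<open>auto intro: Rats_0\<close>)
qed

lemma right_continuous_prob_le:
  assumes "prob_space M" and [measurable]: "Y \<in> borel_measurable M"
  shows "continuous (at_right t) (\<lambda>t. measure M {\<omega>\<in>space M. Y \<omega> \<le> (t::real)})"
proof -
  interpret prob_space M by fact
  interpret D: prob_space "distr M borel Y" by (rule prob_space_distr) simp
  interpret D: real_distribution "distr M borel Y" by unfold_locales auto
  have "(\<lambda>t. measure M {\<omega>\<in>space M. Y \<omega> \<le> t}) = cdf (distr M borel Y)"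
    by (auto simp: cdf_def measure_distr fun_eq_iff intro!: arg_cong[where f="measure M"])
  then show ?thesis by (simp add: D.cdf_is_right_cont)
qed

lemma measurable_cbb_distance:
  assumes p: "0 < p" "p \<le> 1" and n: "1 \<le> n" and M: "prob_space M"
    and [measurable]: "\<And>i. X i \<in> borel_measurable M"
  shows "(\<lambda>\<omega>. SUP t. \<bar>cbb_prob p n l (\<lambda>i. X (int i) \<omega>) t -
            measure M {\<omega>\<in>space M. quantile (ecdf n (\<lambda>i. X (int i) \<omega>)) p - c \<le> t}\<bar>)
         \<in> borel_measurable M"
proof -
  interpret prob_space M by fact
  let ?G = "\<lambda>t. measure M {\<omega>\<in>space M. quantile (ecdf n (\<lambda>i. X (int i) \<omega>)) p - c \<le> t}"
  let ?H = "\<lambda>\<omega> t. cbb_prob p n l (\<lambda>i. X (int i) \<omega>) t"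
  note [measurable] = measurable_quantile_ecdf[OF p] measurable_cbb_prob[OF p n]
  have bd: "\<bar>?H \<omega> t - ?G t\<bar> \<le> 1" for \<omega> t
  proof -
    have "0 \<le> ?H \<omega> t" "?H \<omega> t \<le> 1" "0 \<le> ?G t" "?G t \<le> 1" by (auto simp: cbb_prob_def)
    then show ?thesis by linarith
  qed
  have rcG: "continuous (at_right t) ?G" for t
    by (rule right_continuous_prob_le[OF M]) measurable
  have rcH: "continuous (at_right t) (?H \<omega>)" for t \<omega>
    using right_continuous_prob_le[of "measure_pmf (cbb_starts n l)", OF measure_pmf.prob_space_axioms]
    by (simp add: cbb_prob_def[abs_def])
  have bdd: "bdd_above ((\<lambda>t. \<bar>?H \<omega> t - ?G t\<bar>) ` A)" for \<omega> A
    using bd by (auto intro!: bdd_aboveI)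
  have "(\<lambda>\<omega>. SUP t. \<bar>?H \<omega> t - ?G t\<bar>) = (\<lambda>\<omega>. SUP t\<in>\<rat>. \<bar>?H \<omega> t - ?G t\<bar>)"
    by (intro ext cSUP_Rats_eq bdd continuous_intros rcG rcH)
  also have "\<dots> \<in> borel_measurable M"
    by (intro borel_measurable_cSUP countable_rat bdd) measurable
  finally show ?thesis .
qed

lemma space_gen_sigma: "space (gen_sigma M X I) = space M"
  unfolding gen_sigma_def by (rule space_measure_of) auto

lemma sets_gen_sigma:
  "sets (gen_sigma M X I) =
     sigma_sets (space M) {X i -` S \<inter> space M | i S. i \<in> I \<and> S \<in> sets borel}"
  unfolding gen_sigma_def by (rule sets_measure_of) auto

lemma measurable_gen_sigma:
  assumes "i \<in> I"
  shows "X i \<in> borel_measurable (gen_sigma M X I)"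
  using assms by (intro measurableI) (auto simp: space_gen_sigma sets_gen_sigma)

theorem cbb_prob_is_cond_prob:
  fixes X :: "int \<Rightarrow> 'a \<Rightarrow> real" and l :: nat and t :: real
  assumes p: "0 < p" "p < 1" and n: "1 \<le> n" and M: "prob_space M"
    and X [measurable]: "\<And>i. X i \<in> borel_measurable M"
  defines "N \<equiv> M \<Otimes>\<^sub>M measure_pmf (cbb_starts n l)"
  shows "AE z in N.
      real_cond_exp N (gen_sigma N (\<lambda>i z. X i (fst z)) {1..})
        (indicator {z\<in>space N. cbb_quantile p n l (\<lambda>i. X (int i) (fst z)) (snd z)
                         - quantile (ecdf n (\<lambda>i. X (int i) (fst z))) p \<le> t}) z
      = cbb_prob p n l (\<lambda>i. X (int i) (fst z)) t"
proof -
  let ?P = "measure_pmf (cbb_starts n l)"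
  let ?H = "gen_sigma N (\<lambda>i z. X i (fst z)) {1..}"
  let ?x = "\<lambda>\<omega> i. X (int i) \<omega>"
  let ?E = "{z\<in>space N. cbb_quantile p n l (?x (fst z)) (snd z) - quantile (ecdf n (?x (fst z))) p \<le> t}"
  let ?g = "\<lambda>\<omega>. cbb_prob p n l (?x \<omega>) t"
  interpret M: prob_space M by fact
  interpret pair_prob_space M ?P ..
  interpret N: prob_space N unfolding N_def by (rule prob_space_axioms)
  have p1: "p \<le> 1" using p by simp
  have gen: "{(\<lambda>z. X i (fst z)) -` S \<inter> space N | i S. i \<in> {1..} \<and> S \<in> sets borel}
      \<subseteq> {fst -` B \<inter> space N | B. B \<in> sets M}"
  proof (intro subsetI, elim CollectE exE conjE)
    fix A i S assume A: "A = (\<lambda>z. X i (fst z)) -` S \<inter> space N" and [measurable]: "S \<in> sets borel"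
    have "A = fst -` (X i -` S \<inter> space M) \<inter> space N"
      by (auto simp: A N_def space_pair_measure)
    then show "A \<in> {fst -` B \<inter> space N | B. B \<in> sets M}" by (auto intro!: exI[of _ "X i -` S \<inter> space M"])
  qed
  have fst_N: "fst \<in> space N \<rightarrow> space M" by (auto simp: N_def space_pair_measure)
  have H_sub: "sets ?H \<subseteq> {fst -` B \<inter> space N | B. B \<in> sets M}"
  proof -
    have "sets ?H = sigma_sets (space N) {(\<lambda>z. X i (fst z)) -` S \<inter> space N | i S. i \<in> {1..} \<and> S \<in> sets borel}"
      by (rule sets_gen_sigma)
    also have "\<dots> \<subseteq> sets (vimage_algebra (space N) fst M)"
      using gen sets.sigma_sets_subset[of _ "vimage_algebra (space N) fst M"]
      by (simp add: sets_vimage_algebra2[OF fst_N])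
    finally show ?thesis by (simp add: sets_vimage_algebra2[OF fst_N])
  qed
  have [measurable]: "fst \<in> measurable N M" "snd \<in> measurable N (count_space UNIV)"
    by (auto simp: N_def)
  have "subalgebra N ?H"
    unfolding subalgebra_def
  proof
    show "space ?H = space N" by (rule space_gen_sigma)
    show "sets ?H \<subseteq> sets N"
      using H_sub by (auto dest!: subsetD intro: measurable_sets[OF \<open>fst \<in> measurable N M\<close>])
  qed
  then interpret H: finite_measure_subalgebra N ?H by unfold_locales
  have sample: "(\<lambda>z. cbb_sample n l (?x (fst z)) (snd z) i) \<in> borel_measurable N" for i
  proof -
    define h :: "(nat \<Rightarrow> nat) \<Rightarrow> nat"
      where "h s = (s ((i - 1) div l) + (i - 1) mod l - 1) mod n + 1" for s
    have "(\<lambda>z. X (int (h (snd z))) (fst z)) \<in> borel_measurable N"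
    proof (rule measurable_compose_countable[where f="\<lambda>j z. X (int j) (fst z)"])
      show "(\<lambda>z. X (int j) (fst z)) \<in> borel_measurable N" for j
        by (rule measurable_compose[OF \<open>fst \<in> measurable N M\<close> X])
      show "(\<lambda>z. h (snd z)) \<in> measurable N (count_space UNIV)"
        by (rule measurable_compose[OF \<open>snd \<in> measurable N (count_space UNIV)\<close>]) simp
    qed
    then show ?thesis by (simp add: cbb_sample_def periodic_ext_def h_def)
  qed
  have [measurable]: "(\<lambda>z. cbb_quantile p n l (?x (fst z)) (snd z)) \<in> borel_measurable N"
    unfolding cbb_quantile_def by (rule measurable_quantile_ecdf[OF p(1) p1 sample])
  have [measurable]: "(\<lambda>z. quantile (ecdf n (?x (fst z))) p) \<in> borel_measurable N"
    by (rule measurable_quantile_ecdf[OF p(1) p1]) measurable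
  have E [measurable]: "?E \<in> sets N" by measurable
  have [measurable]: "?g \<in> borel_measurable M"
    by (rule measurable_cbb_prob[OF p(1) p1 n]) measurable
  have gH: "(\<lambda>z. ?g (fst z)) \<in> borel_measurable ?H"
  proof (rule measurable_cbb_prob[OF p(1) p1 n])
    fix i :: nat assume "1 \<le> i"
    then show "(\<lambda>z. X (int i) (fst z)) \<in> borel_measurable ?H"
      by (intro measurable_gen_sigma[where X="\<lambda>i z. X i (fst z)"]) simp
  qed
  have g01: "0 \<le> ?g \<omega>" "?g \<omega> \<le> 1" for \<omega> by (auto simp: cbb_prob_def)
  have int_g: "integrable N (\<lambda>z. ?g (fst z))"
    by (rule N.integrable_const_bound[where B=1]) (use g01 in auto)
  have int_E: "integrable N (indicator ?E :: _ \<Rightarrow> real)"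
    by (rule N.integrable_const_bound[where B=1]) (auto simp: indicator_def)
  show ?thesis
  proof (rule H.real_cond_exp_charact[OF _ int_E int_g gH])
    fix A assume "A \<in> sets ?H"
    then obtain B where B [measurable]: "B \<in> sets M" and A: "A = fst -` B \<inter> space N"
      using H_sub by auto
    have [measurable]: "A \<in> sets N" unfolding A by measurable
    have int1: "integrable N (\<lambda>z. indicator A z * indicator ?E z :: real)"
      by (rule N.integrable_const_bound[where B=1]) (auto simp: indicator_def)
    have int2: "integrable N (\<lambda>z. indicator A z * ?g (fst z))"
      by (rule N.integrable_const_bound[where B=1]) (use g01 in \<open>auto simp: indicator_def\<close>)
    have "(\<integral>z\<in>A. (indicator ?E z :: real) \<partial>N) = (\<integral>\<omega>. (\<integral>s. indicator A (\<omega>, s) * indicator ?E (\<omega>, s) \<partial>?P) \<partial>M)"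
      using integral_fst'[OF int1[unfolded N_def]]
      by (simp add: set_lebesgue_integral_def N_def)
    also have "\<dots> = (\<integral>\<omega>. (\<integral>s. indicator A (\<omega>, s) * ?g \<omega> \<partial>?P) \<partial>M)"
    proof (rule Bochner_Integration.integral_cong[OF refl])
      fix \<omega> assume \<omega>: "\<omega> \<in> space M"
      have A\<omega>: "indicator A (\<omega>, s) = (indicator B \<omega> :: real)" for s
        using \<omega> by (auto simp: A N_def space_pair_measure indicator_def)
      have E\<omega>: "indicator ?E (\<omega>, s)
          = (indicator {s. cbb_quantile p n l (?x \<omega>) s - quantile (ecdf n (?x \<omega>)) p \<le> t} s :: real)" for s
        using \<omega> by (auto simp: N_def space_pair_measure indicator_def)
      show "(\<integral>s. indicator A (\<omega>, s) * indicator ?E (\<omega>, s) \<partial>?P) = (\<integral>s. indicator A (\<omega>, s) * ?g \<omega> \<partial>?P)"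
        unfolding A\<omega> E\<omega> by (simp add: cbb_prob_def)
    qed
    also have "\<dots> = (\<integral>z\<in>A. ?g (fst z) \<partial>N)"
      using integral_fst'[OF int2[unfolded N_def]]
      by (simp add: set_lebesgue_integral_def N_def)
    finally show "(\<integral>z\<in>A. (indicator ?E z :: real) \<partial>N) = (\<integral>z\<in>A. ?g (fst z) \<partial>N)" .
  qed
qed

end

theory Submission
  imports Defs
begin

text \<open>
  Let \<open>g y = \<bar>y\<bar>\<^sup>\<rho> sgn y\<close>, let \<open>v\<close> be the limiting variance and choose \<open>r\<^sub>n\<close> such that
  \<open>\<surd>n (F (t\<^sub>p + r\<^sub>n y) - p) / \<surd>v \<longlonglongrightarrow> g y\<close>. On this scale the normalised empirical distribution
  function \<open>R\<^sub>n y = \<surd>n (F\<^sub>n (t\<^sub>p + r\<^sub>n y) - p) / \<surd>v\<close> is close to \<open>R\<^sub>n 0 + g y\<close>, where \<open>R\<^sub>n 0\<close> is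
  asymptotically standard normal. Hence the rescaled sample quantile \<open>q\<^sub>n\<close> satisfies
  \<open>g q\<^sub>n \<approx> - R\<^sub>n 0\<close> and has limiting distribution function \<open>\<Phi> \<circ> g\<close>.
  The bootstrap reproduces the normal fluctuations, but around the empirical drift: conditionally, the
  bootstrap quantile is at most \<open>t\<^sub>p + r\<^sub>n y\<close> with probability about
  \<open>\<Phi> (R\<^sub>n y) \<approx> \<Phi> (g y - g q\<^sub>n)\<close>. The distance is therefore approximately
  \<open>sup\<^sub>s \<bar>\<Phi> (g (q\<^sub>n + s) - g q\<^sub>n) - \<Phi> (g s)\<bar>\<close>, a continuous function of \<open>q\<^sub>n\<close> that vanishes
  only at \<open>0\<close> unless \<open>g\<close> is linear.

  The central limit theorem for \<open>R\<^sub>n 0\<close> is proved with Bernstein blocks of length of order \<open>\<surd>n\<close>, for which the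
  Lindeberg condition is trivial because indicators are bounded; the decoupling error tends to \<open>0\<close> because
  \<open>k \<alpha>(k) \<longlonglongrightarrow> 0\<close>. It also yields the uniform integrability of squared block sums, hence the
  Lindeberg condition for the independent bootstrap blocks.
\<close>

section \<open>The normal distribution function\<close>

text \<open>The limit variable is fixed before the probability space, the process, \<open>p\<close>,
  \<open>C\<close> and \<open>l\<close>, so its law may depend on \<rho> alone. The choice of
  \<open>r\<close> absorbs both \<open>C\<close> and the limiting variance; the limit is then
  \<open>gap (k z)\<close> under the standard normal law, with \<open>k\<close> the inverse of
  \<open>g\<close>. No rate of mixing beyond summability is available, and the law of a bootstrap
  block changes with the data and with \<open>n\<close>. Hence no almost sure conditional limit is
  sought: the conditional central limit theorem is made uniform over all finite laws that satisfy a
  Lindeberg condition up to \<open>\<delta>\<close>, and the data are shown to satisfy it up to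
  errors that vanish in mean. Only finitely many scale points are treated at a time; monotonicity
  supplies the supremum over \<open>t\<close>. The scale points move with \<open>n\<close>. Their
  block sums are compared in mean square with those at \<open>tp\<close>; the error is controlled by
  the covariance bound \<open>min B (4 * \<alpha> k)\<close>, which is dominated by a summable
  sequence and vanishes with \<open>B\<close>.\<close>

definition Phi :: "real \<Rightarrow> real" where
  "Phi = cdf std_normal_distribution"

interpretation std_normal: real_distribution std_normal_distribution
  by (rule real_dist_normal_dist)

lemma Phi_nonneg: "0 \<le> Phi x"
  by (simp add: Phi_def std_normal.cdf_nonneg)

lemma Phi_le_1: "Phi x \<le> 1"
  by (simp add: Phi_def std_normal.cdf_bounded_prob)

lemma Phi_mono: "x \<le> y \<Longrightarrow> Phi x \<le> Phi y"
  by (simp add: Phi_def std_normal.cdf_nondecreasing)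

lemma Phi_at_top: "(Phi \<longlongrightarrow> 1) at_top"
  unfolding Phi_def by (rule std_normal.cdf_lim_at_top_prob)

lemma Phi_at_bot: "(Phi \<longlongrightarrow> 0) at_bot"
  unfolding Phi_def by (rule std_normal.cdf_lim_at_bot)

text \<open>The density bound 1 makes \<open>Phi\<close> Lipschitz with constant 1, so errors in the
  argument of \<open>Phi\<close> carry over without a factor.\<close>

lemma std_normal_density_le_1: "std_normal_density x \<le> 1"
proof -
  have "1 / sqrt (2 * pi) \<le> 1" using pi_ge_two by (simp add: divide_le_eq real_le_rsqrt)
  moreover have "exp (- x\<^sup>2 / 2) \<le> 1" by simp
  ultimately show ?thesis unfolding std_normal_density_def
    by (intro mult_le_one) auto
qed

lemma Phi_diff_le: "x \<le> y \<Longrightarrow> Phi y - Phi x \<le> y - x"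
proof (cases "x = y")
  case False
  assume "x \<le> y" with False have xy: "x < y" by simp
  have "Phi y - Phi x = measure std_normal_distribution {x<..y}"
    unfolding Phi_def by (rule std_normal.cdf_diff_eq[OF xy])
  moreover have "emeasure std_normal_distribution {x<..y} \<le> ennreal (y - x)"
  proof -
    have "emeasure std_normal_distribution {x<..y}
        = (\<integral>\<^sup>+z. ennreal (std_normal_density z) * indicator {x<..y} z \<partial>lborel)"
      by (simp add: emeasure_density)
    also have "\<dots> \<le> (\<integral>\<^sup>+z. indicator {x<..y} z \<partial>lborel)"
      by (intro nn_integral_mono) (auto simp: indicator_def std_normal_density_le_1)
    also have "\<dots> = ennreal (y - x)" using xy by simp
    finally show ?thesis .
  qed
  ultimately show ?thesis
    using xy by (simp add: std_normal.emeasure_eq_measure)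
qed simp

lemma Phi_lipschitz: "\<bar>Phi x - Phi y\<bar> \<le> \<bar>x - y\<bar>"
  using Phi_diff_le[of x y] Phi_diff_le[of y x] Phi_mono[of x y] Phi_mono[of y x] by linarith

text \<open>Strictness is used for \<open>gap_pos\<close> and gives every interval positive normal
  mass.\<close>

lemma Phi_strict_mono: "x < y \<Longrightarrow> Phi x < Phi y"
proof (rule ccontr)
  assume xy: "x < y" and "\<not> Phi x < Phi y"
  then have "measure std_normal_distribution {x<..y} = 0"
    using Phi_mono[of x y] std_normal.cdf_diff_eq[OF xy] by (simp add: Phi_def)
  then have "{x<..y} \<in> null_sets std_normal_distribution"
    by (simp add: null_sets_def std_normal.emeasure_eq_measure)
  then have "AE z in lborel. z \<in> {x<..y} \<longrightarrow> ennreal (std_normal_density z) = 0"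
    by (subst (asm) null_sets_density_iff) auto
  then have "AE z in lborel. z \<notin> {x<..y}"
    by eventually_elim (use normal_density_pos[of 1 0] in \<open>auto simp: ennreal_eq_0_iff not_le[symmetric]\<close>)
  then have "emeasure lborel {x<..y} = 0"
    by (subst (asm) AE_iff_measurable[where N="{x<..y}"]) auto
  with xy show False by simp
qed

lemma isCont_Phi: "isCont Phi x"
  unfolding continuous_at_eps_delta
  by (metis Phi_lipschitz dist_real_def order_le_less_trans)

lemma tendsto_Phi [tendsto_intros]: "(f \<longlongrightarrow> a) F \<Longrightarrow> ((\<lambda>x. Phi (f x)) \<longlongrightarrow> Phi a) F"
  by (rule isCont_tendsto_compose[OF isCont_Phi])

lemma Phi_measurable [measurable]: "Phi \<in> borel_measurable borel"
  unfolding Phi_def by (rule borel_measurable_mono) (auto intro: monoI std_normal.cdf_nondecreasing)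


section \<open>Uniform convergence of monotone functions\<close>

text \<open>Agreement up to \<open>\<eta>\<close> on \<open>S\<close> forces agreement up to \<open>\<eta> + \<epsilon>\<close> everywhere,
  for monotone functions with values in \<open>[0, 1]\<close>.\<close>

definition grid :: "real set \<Rightarrow> real \<Rightarrow> (real \<Rightarrow> real) \<Rightarrow> bool" where
  "grid S \<epsilon> h \<longleftrightarrow> finite S \<and>
     (\<forall>s. (1 - \<epsilon> \<le> h s \<or> (\<exists>b\<in>S. s \<le> b \<and> h b \<le> h s + \<epsilon>)) \<and>
          (h s \<le> \<epsilon> \<or> (\<exists>a\<in>S. a \<le> s \<and> h s - \<epsilon> \<le> h a)))"

text \<open>The chain is \<open>f s \<le> f b \<le> h b + \<eta> \<le> h s + \<epsilon> +
  \<eta>\<close>, with its mirror image from the left. In the tails, where no grid point has to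
  exist, the bounds 0 and 1 for \<open>f\<close> take over.\<close>

lemma grid_bound:
  assumes S: "grid S \<epsilon> h" and "mono f" and f01: "\<And>s. 0 \<le> f s" "\<And>s. f s \<le> 1"
    and close: "\<And>a. a \<in> S \<Longrightarrow> \<bar>f a - h a\<bar> \<le> \<eta>" and "0 \<le> \<eta>"
  shows "\<bar>f s - h s\<bar> \<le> \<eta> + \<epsilon>"
proof -
  have "f s \<le> h s + (\<eta> + \<epsilon>)"
  proof (cases "1 - \<epsilon> \<le> h s")
    case True with f01(2)[of s] \<open>0 \<le> \<eta>\<close> show ?thesis by linarith
  next
    case False
    then obtain b where "b \<in> S" "s \<le> b" "h b \<le> h s + \<epsilon>" using S by (auto simp: grid_def)
    with close[of b] monoD[OF \<open>mono f\<close>, of s b] show ?thesis by linarith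
  qed
  moreover have "h s - (\<eta> + \<epsilon>) \<le> f s"
  proof (cases "h s \<le> \<epsilon>")
    case True with f01(1)[of s] \<open>0 \<le> \<eta>\<close> show ?thesis by linarith
  next
    case False
    then obtain a where "a \<in> S" "a \<le> s" "h s - \<epsilon> \<le> h a" using S by (auto simp: grid_def)
    with close[of a] monoD[OF \<open>mono f\<close>, of a s] show ?thesis by linarith
  qed
  ultimately show ?thesis by linarith
qed

text \<open>\<open>gap x\<close> views the limit from the point \<open>x\<close>, so a grid for the
  unshifted function has to move along.\<close>

lemma grid_shift:
  assumes "grid S \<epsilon> h" shows "grid ((\<lambda>a. a - x) ` S) \<epsilon> (\<lambda>s. h (x + s))"
  unfolding grid_def
proof (intro conjI allI)
  show "finite ((\<lambda>a. a - x) ` S)" using assms by (simp add: grid_def)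
  fix s
  have "1 - \<epsilon> \<le> h (x + s) \<or> (\<exists>b\<in>S. x + s \<le> b \<and> h b \<le> h (x + s) + \<epsilon>)"
    "h (x + s) \<le> \<epsilon> \<or> (\<exists>a\<in>S. a \<le> x + s \<and> h (x + s) - \<epsilon> \<le> h a)"
    using assms unfolding grid_def by blast+
  then show "1 - \<epsilon> \<le> h (x + s) \<or> (\<exists>b\<in>(\<lambda>a. a - x) ` S. s \<le> b \<and> h (x + b) \<le> h (x + s) + \<epsilon>)"
    "h (x + s) \<le> \<epsilon> \<or> (\<exists>a\<in>(\<lambda>a. a - x) ` S. a \<le> s \<and> h (x + s) - \<epsilon> \<le> h (x + a))"
    by (auto simp: algebra_simps)
qed

text \<open>Polya's theorem on uniform convergence of monotone functions, with finite grids for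
  every \<open>\<epsilon>\<close> in the role of continuity and limits of \<open>h\<close>.\<close>

lemma grid_uniform_conv:
  fixes f :: "nat \<Rightarrow> real \<Rightarrow> real"
  assumes S: "\<And>\<epsilon>. 0 < \<epsilon> \<Longrightarrow> \<exists>S. grid S \<epsilon> h"
    and f: "\<And>n. mono (f n)" "\<And>n s. 0 \<le> f n s" "\<And>n s. f n s \<le> 1"
    and lim: "\<And>s. (\<lambda>n. f n s) \<longlonglongrightarrow> h s" and "0 < e"
  shows "eventually (\<lambda>n. \<forall>s. \<bar>f n s - h s\<bar> \<le> e) sequentially"
proof -
  obtain S where S: "grid S (e / 2) h" using S[of "e / 2"] \<open>0 < e\<close> by auto
  then have "finite S" by (simp add: grid_def)
  have "eventually (\<lambda>n. \<bar>f n a - h a\<bar> < e / 2) sequentially" for a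
    using tendstoD[OF lim[of a], of "e / 2"] \<open>0 < e\<close> by (simp add: dist_real_def)
  then have "eventually (\<lambda>n. \<forall>a\<in>S. \<bar>f n a - h a\<bar> < e / 2) sequentially"
    using \<open>finite S\<close> by (simp add: eventually_ball_finite)
  then show ?thesis
  proof eventually_elim
    case (elim n)
    then have "\<And>a. a \<in> S \<Longrightarrow> \<bar>f n a - h a\<bar> \<le> e / 2" by force
    from grid_bound[OF S f(1)[of n] f(2)[of n] f(3)[of n] this] \<open>0 < e\<close> show ?case by simp
  qed
qed

text \<open>On the scale \<open>t\<^sub>p + r\<^sub>n x\<close> of the quantile, the distribution function looks like \<open>g\<close>.\<close>

locale scale =
  fixes g k :: "real \<Rightarrow> real"
  assumes g_mono: "mono g" and g_cont: "\<And>x. isCont g x"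
    and gk: "\<And>y. g (k y) = y" and kg: "\<And>x. k (g x) = x" and g0: "g 0 = 0"
begin

text \<open>This adjunction and the next turn comparisons of quantiles with scale points into
  comparisons of values of \<open>g\<close>.\<close>

lemma k_le_iff: "k y \<le> x \<longleftrightarrow> y \<le> g x"
  using g_mono gk kg by (metis linorder_le_cases monoD order_antisym)

lemma le_k_iff: "x \<le> k y \<longleftrightarrow> g x \<le> y"
  using g_mono gk kg by (metis linorder_le_cases monoD order_antisym)

lemma k_mono: "mono k"
  by (rule monoI) (simp add: k_le_iff gk)

lemma k_measurable [measurable]: "k \<in> borel_measurable borel"
  by (rule borel_measurable_mono[OF k_mono])

lemma g_measurable [measurable]: "g \<in> borel_measurable borel"
  by (rule borel_measurable_mono[OF g_mono])

text \<open>The points are equally spaced in the values of \<open>g\<close>, not in the argument.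
  Since \<open>Phi\<close> has Lipschitz constant 1, neighbouring points change
  \<open>Phi (g s + w)\<close> by at most \<open>\<epsilon>\<close>, whatever \<open>w\<close>
  is.\<close>

definition pts :: "real \<Rightarrow> nat \<Rightarrow> real set" where
  "pts \<epsilon> N = (\<lambda>i. k (\<epsilon> * real_of_int i)) ` {- int N..int N}"

lemma finite_pts: "finite (pts \<epsilon> N)"
  by (simp add: pts_def)

text \<open>One grid serves all shifts with \<open>\<bar>w\<bar> \<le> K\<close>, because later
  \<open>w\<close> is the random value \<open>R n 0 \<omega>\<close>. The condition on
  \<open>N\<close> lets the grid reach both tails of every such shifted function.\<close>

lemma grid_pts:
  assumes \<epsilon>: "0 < \<epsilon>" and L: "Phi (- L) \<le> \<epsilon>" "1 - \<epsilon> \<le> Phi L" and N: "L + K \<le> \<epsilon> * N" and w: "\<bar>w\<bar> \<le> K"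
  shows "grid (pts \<epsilon> N) \<epsilon> (\<lambda>s. Phi (g s + w))"
  unfolding grid_def
proof (intro conjI allI)
  show "finite (pts \<epsilon> N)" by (rule finite_pts)
  have pt: "k (\<epsilon> * real_of_int i) \<in> pts \<epsilon> N" if "\<bar>i\<bar> \<le> int N" for i
    using that unfolding pts_def by (intro imageI) auto
  fix s
  show "1 - \<epsilon> \<le> Phi (g s + w) \<or> (\<exists>b\<in>pts \<epsilon> N. s \<le> b \<and> Phi (g b + w) \<le> Phi (g s + w) + \<epsilon>)"
  proof (cases "L \<le> g s + w")
    case True
    then have "1 - \<epsilon> \<le> Phi (g s + w)" using L(2) Phi_mono[OF True] by linarith
    then show ?thesis by simp
  next
    case False
    then have up: "g s < \<epsilon> * N" using N w by linarith
    \<comment> \<open>Index of the next point to the right. The maximum applies when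
      \<open>s\<close> lies left of the grid: the leftmost point is then already in the lower tail,
      so its value is at most \<open>\<epsilon>\<close>.\<close>
    define i where "i = max (- int N) \<lceil>g s / \<epsilon>\<rceil>"
    have "g s / \<epsilon> \<le> real_of_int (int N)" using up \<epsilon> by (simp add: divide_le_eq mult.commute)
    then have "\<lceil>g s / \<epsilon>\<rceil> \<le> int N" by (simp add: ceiling_le_iff)
    then have i: "\<bar>i\<bar> \<le> int N" by (simp add: i_def)
    have "g s / \<epsilon> \<le> real_of_int i" unfolding i_def by linarith
    then have le: "g s \<le> \<epsilon> * real_of_int i" using \<epsilon> by (simp add: divide_le_eq mult.commute)
    have "Phi (\<epsilon> * real_of_int i + w) \<le> Phi (g s + w) + \<epsilon>"
    proof (cases "i = - int N")
      case True
      then have "\<epsilon> * real_of_int i + w \<le> - L" using N w by simp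
      from Phi_mono[OF this] L(1) Phi_nonneg[of "g s + w"] show ?thesis by linarith
    next
      case False
      then have "real_of_int i \<le> g s / \<epsilon> + 1" unfolding i_def by linarith
      then have "\<epsilon> * real_of_int i \<le> \<epsilon> * (g s / \<epsilon> + 1)" using \<epsilon> by (intro mult_left_mono) auto
      then have "\<epsilon> * real_of_int i \<le> g s + \<epsilon>" using \<epsilon> by (simp add: distrib_left)
      with Phi_lipschitz[of "\<epsilon> * real_of_int i + w" "g s + w"] le show ?thesis by linarith
    qed
    with pt[OF i] le show ?thesis by (intro disjI2 bexI[of _ "k (\<epsilon> * real_of_int i)"]) (auto simp: gk le_k_iff)
  qed
  show "Phi (g s + w) \<le> \<epsilon> \<or> (\<exists>a\<in>pts \<epsilon> N. a \<le> s \<and> Phi (g s + w) - \<epsilon> \<le> Phi (g a + w))"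
  proof (cases "g s + w \<le> - L")
    case True
    then have "Phi (g s + w) \<le> \<epsilon>" using L(1) Phi_mono[OF True] by linarith
    then show ?thesis by simp
  next
    case False
    then have lo: "- (\<epsilon> * N) < g s" using N w by linarith
    define i where "i = min (int N) \<lfloor>g s / \<epsilon>\<rfloor>"
    have "real_of_int (- int N) \<le> g s / \<epsilon>" using lo \<epsilon> by (simp add: le_divide_eq mult.commute)
    then have "- int N \<le> \<lfloor>g s / \<epsilon>\<rfloor>" by (simp add: le_floor_iff)
    then have i: "\<bar>i\<bar> \<le> int N" by (simp add: i_def)
    have "real_of_int i \<le> g s / \<epsilon>" unfolding i_def by linarith
    then have le: "\<epsilon> * real_of_int i \<le> g s" using \<epsilon> by (simp add: le_divide_eq mult.commute)
    have "Phi (g s + w) - \<epsilon> \<le> Phi (\<epsilon> * real_of_int i + w)"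
    proof (cases "i = int N")
      case True
      then have "L \<le> \<epsilon> * real_of_int i + w" using N w by simp
      from Phi_mono[OF this] L(2) Phi_le_1[of "g s + w"] show ?thesis by linarith
    next
      case False
      then have "g s / \<epsilon> - 1 \<le> real_of_int i" unfolding i_def by linarith
      then have "\<epsilon> * (g s / \<epsilon> - 1) \<le> \<epsilon> * real_of_int i" using \<epsilon> by (intro mult_left_mono) auto
      then have "g s - \<epsilon> \<le> \<epsilon> * real_of_int i" using \<epsilon> by (simp add: right_diff_distrib)
      with Phi_lipschitz[of "\<epsilon> * real_of_int i + w" "g s + w"] le show ?thesis by linarith
    qed
    with pt[OF i] le show ?thesis by (intro disjI2 bexI[of _ "k (\<epsilon> * real_of_int i)"]) (auto simp: gk k_le_iff)
  qed
qed

end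

lemma Phi_tails: "0 < \<epsilon> \<Longrightarrow> \<exists>L\<ge>0. Phi (- L) \<le> \<epsilon> \<and> 1 - \<epsilon> \<le> Phi L"
proof -
  assume "0 < \<epsilon>"
  have "eventually (\<lambda>L. 1 - \<epsilon> < Phi L) at_top"
    using order_tendstoD(1)[OF Phi_at_top, of "1 - \<epsilon>"] \<open>0 < \<epsilon>\<close> by simp
  moreover have "eventually (\<lambda>L. Phi (- L) < \<epsilon>) at_top"
    using order_tendstoD(2)[OF Phi_at_bot \<open>0 < \<epsilon>\<close>] by (simp add: at_bot_mirror eventually_filtermap)
  moreover have "eventually (\<lambda>L::real. 0 \<le> L) at_top" by (rule eventually_ge_at_top)
  ultimately have "eventually (\<lambda>L. 0 \<le> L \<and> Phi (- L) \<le> \<epsilon> \<and> 1 - \<epsilon> \<le> Phi L) at_top"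
    by eventually_elim auto
  then show ?thesis by (auto dest: eventually_happens)
qed

lemma abs_diff_le_1: "0 \<le> a \<Longrightarrow> a \<le> 1 \<Longrightarrow> 0 \<le> b \<Longrightarrow> b \<le> 1 \<Longrightarrow> \<bar>a - b\<bar> \<le> (1::real)"
  by linarith

lemma bdd_above_abs_diff:
  fixes f h :: "real \<Rightarrow> real"
  assumes "\<And>s. 0 \<le> f s" "\<And>s. f s \<le> 1" "\<And>s. 0 \<le> h s" "\<And>s. h s \<le> 1"
  shows "bdd_above (range (\<lambda>s. \<bar>f s - h s\<bar>))"
  using assms by (intro bdd_aboveI[of _ 1]) (auto intro: abs_diff_le_1)

text \<open>In the uniform norm the distance is Lipschitz in both functions. Boundedness is assumed
  because the supremum of an unbounded set of reals carries no information.\<close>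

lemma SUP_abs_diff_close:
  fixes f1 f2 h1 h2 :: "real \<Rightarrow> real"
  assumes "bdd_above (range (\<lambda>s. \<bar>f1 s - f2 s\<bar>))" "bdd_above (range (\<lambda>s. \<bar>h1 s - h2 s\<bar>))"
    and "\<And>s. \<bar>f1 s - h1 s\<bar> \<le> a" "\<And>s. \<bar>f2 s - h2 s\<bar> \<le> b"
  shows "\<bar>(SUP s. \<bar>f1 s - f2 s\<bar>) - (SUP s. \<bar>h1 s - h2 s\<bar>)\<bar> \<le> a + b"
proof -
  have "(SUP s. \<bar>f1 s - f2 s\<bar>) \<le> (SUP s. \<bar>h1 s - h2 s\<bar>) + (a + b)"
  proof (rule cSUP_least)
    fix s
    have "\<bar>h1 s - h2 s\<bar> \<le> (SUP s. \<bar>h1 s - h2 s\<bar>)" by (rule cSUP_upper[OF _ assms(2)]) simp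
    then show "\<bar>f1 s - f2 s\<bar> \<le> (SUP s. \<bar>h1 s - h2 s\<bar>) + (a + b)"
      using assms(3)[of s] assms(4)[of s] by linarith
  qed simp
  moreover have "(SUP s. \<bar>h1 s - h2 s\<bar>) \<le> (SUP s. \<bar>f1 s - f2 s\<bar>) + (a + b)"
  proof (rule cSUP_least)
    fix s
    have "\<bar>f1 s - f2 s\<bar> \<le> (SUP s. \<bar>f1 s - f2 s\<bar>)" by (rule cSUP_upper[OF _ assms(1)]) simp
    then show "\<bar>h1 s - h2 s\<bar> \<le> (SUP s. \<bar>f1 s - f2 s\<bar>) + (a + b)"
      using assms(3)[of s] assms(4)[of s] by linarith
  qed simp
  ultimately show ?thesis by linarith
qed

section \<open>The limiting distance as a function of the quantile\<close>

context scale
begin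

lemma grid_exists: "0 < \<epsilon> \<Longrightarrow> \<exists>S. grid S \<epsilon> (\<lambda>s. Phi (g s + w))"
proof -
  assume \<epsilon>: "0 < \<epsilon>"
  obtain L where L: "Phi (- L) \<le> \<epsilon>" "1 - \<epsilon> \<le> Phi L" using Phi_tails[OF \<epsilon>] by auto
  obtain N :: nat where "L + \<bar>w\<bar> \<le> \<epsilon> * N"
    using real_arch_simple[of "(L + \<bar>w\<bar>) / \<epsilon>"] \<epsilon> by (auto simp: divide_le_eq mult.commute)
  from grid_pts[OF \<epsilon> L this] show ?thesis by auto
qed

text \<open>If the centred quantile, on the scale of \<open>g\<close>, is near \<open>x\<close>, this is the limiting
  uniform distance between its distribution function and that of its bootstrap version.\<close>

definition gap :: "real \<Rightarrow> real" where
  "gap x = (SUP s. \<bar>Phi (g (x + s) - g x) - Phi (g s)\<bar>)"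

lemma gap_bdd: "bdd_above (range (\<lambda>s. \<bar>Phi (g (x + s) - g x) - Phi (g s)\<bar>))"
  by (rule bdd_above_abs_diff) (auto simp: Phi_nonneg Phi_le_1)

lemma gap_upper: "\<bar>Phi (g (x + s) - g x) - Phi (g s)\<bar> \<le> gap x"
  unfolding gap_def by (rule cSUP_upper[OF _ gap_bdd]) simp

text \<open>Continuity carries the limit law of the quantile through \<open>gap\<close>. Moving
  \<open>x\<close> changes the first function pointwise little by continuity, hence uniformly little
  by monotonicity, and the supremum follows.\<close>

lemma isCont_gap: "isCont gap x"
  unfolding continuous_at_sequentially comp_def
proof (intro allI impI)
  fix X assume X: "X \<longlonglongrightarrow> x"
  let ?f = "\<lambda>n s. Phi (g (X n + s) - g (X n))" and ?h = "\<lambda>s. Phi (g (x + s) - g x)"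
  show "(\<lambda>n. gap (X n)) \<longlonglongrightarrow> gap x"
  proof (rule metric_LIMSEQ_I)
    fix e :: real assume e: "0 < e"
    have "eventually (\<lambda>n. \<forall>s. \<bar>?f n s - ?h s\<bar> \<le> e / 2) sequentially"
    proof (rule grid_uniform_conv)
      show "\<exists>S. grid S \<epsilon> ?h" if "0 < \<epsilon>" for \<epsilon>
        using grid_exists[OF that, of "- g x"] grid_shift[of _ \<epsilon> "\<lambda>s. Phi (g s - g x)" x] by auto
      show "mono (?f n)" for n by (auto intro!: monoI Phi_mono diff_right_mono monoD[OF g_mono])
      show "(\<lambda>n. ?f n s) \<longlonglongrightarrow> ?h s" for s
        by (intro tendsto_intros isCont_tendsto_compose[OF g_cont] X)
    qed (auto simp: Phi_nonneg Phi_le_1 e)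
    then obtain N where N: "\<And>n s. n \<ge> N \<Longrightarrow> \<bar>?f n s - ?h s\<bar> \<le> e / 2"
      by (auto simp: eventually_sequentially)
    have "dist (gap (X n)) (gap x) < e" if "n \<ge> N" for n
    proof -
      have "\<bar>gap (X n) - gap x\<bar> \<le> e / 2 + 0"
        unfolding gap_def by (rule SUP_abs_diff_close[OF gap_bdd gap_bdd N[OF that]]) simp
      then show ?thesis using e by (simp add: dist_real_def)
    qed
    then show "\<exists>N. \<forall>n\<ge>N. dist (gap (X n)) (gap x) < e" by blast
  qed
qed

lemma gap_measurable [measurable]: "gap \<in> borel_measurable borel"
  by (intro borel_measurable_continuous_onI continuous_at_imp_continuous_on ballI isCont_gap)

lemma gap_0: "gap 0 = 0"
  by (simp add: gap_def g0)

text \<open>The supremum is tested at \<open>s = x\<close>, where it compares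
  \<open>g (2 * x) - g x\<close> with \<open>g x\<close>.\<close>

lemma gap_pos:
  assumes "g (2 * x) \<noteq> 2 * g x" shows "0 < gap x"
proof -
  have "Phi (g (x + x) - g x) \<noteq> Phi (g x)"
    using assms Phi_strict_mono[of "g (x + x) - g x" "g x"] Phi_strict_mono[of "g x" "g (x + x) - g x"]
    by (metis add_diff_cancel_right' diff_add_cancel linorder_cases mult_2 order_less_irrefl)
  then show ?thesis using gap_upper[of x x] by linarith
qed

text \<open>Here the exclusion of \<open>\<rho> = 1\<close> enters: for additive \<open>g\<close> the gap vanishes identically.\<close>

lemma gap_nondegenerate:
  assumes ne: "\<And>x. x \<noteq> 0 \<Longrightarrow> g (2 * x) \<noteq> 2 * g x"
  shows "\<not> (\<exists>c. AE z in std_normal_distribution. gap (k z) = c)"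
proof
  assume "\<exists>c. AE z in std_normal_distribution. gap (k z) = c"
  then obtain c where ae: "AE z in std_normal_distribution. gap (k z) = c" by auto
  have pos: "std_normal.prob {a<..b} > 0" if "a < b" for a b
    using std_normal.cdf_diff_eq[OF that] Phi_strict_mono[OF that] by (simp add: Phi_def)
  \<comment> \<open>Every interval has positive mass, so an almost sure value is attained in each of
    them.\<close>
  have ex: "\<exists>z\<in>{a<..b}. gap (k z) = c" if "a < b" for a b
  proof (rule ccontr)
    assume "\<not> ?thesis"
    then have "\<And>z. gap (k z) = c \<Longrightarrow> z \<notin> {a<..b}" by blast
    then have "AE z in std_normal_distribution. z \<notin> {a<..b}" by (rule eventually_mono[OF ae])
    then have "std_normal.prob {a<..b} = 0"
      by (subst std_normal.prob_eq_0) auto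
    with pos[OF that] show False by simp
  qed
  obtain z where z: "0 < z" "gap (k z) = c" using ex[of 0 1] by auto
  have "k z \<noteq> 0" using z(1) g0 gk by (metis less_irrefl)
  then have c: "0 < c" using gap_pos[OF ne] z by blast
  have k0: "k 0 = 0" using kg[of 0] g0 by simp
  \<comment> \<open>Near 0 the gap stays below \<open>c\<close> by continuity, yet \<open>c\<close>
    is attained on \<open>{0<..g (d / 2)}\<close>, which \<open>k\<close> maps into
    \<open>{0<..d / 2}\<close>.\<close>
  have "eventually (\<lambda>x. gap x < c) (at 0)"
    using order_tendstoD(2)[OF isCont_gap[of 0, unfolded isCont_def]] c by (simp add: gap_0)
  then obtain d where d: "0 < d" "\<And>x. x \<noteq> 0 \<Longrightarrow> \<bar>x\<bar> < d \<Longrightarrow> gap x < c"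
    by (auto simp: eventually_at dist_real_def)
  have "g 0 < g (d / 2)" using d(1) k_le_iff[of "g (d/2)" 0] kg[of "d / 2"] by (simp add: not_le[symmetric])
  then have "0 < g (d / 2)" by (simp add: g0)
  from ex[OF this] obtain y where y: "0 < y" "y \<le> g (d / 2)" "gap (k y) = c" by auto
  have "k y \<le> d / 2" "0 < k y" using y(2) k_le_iff[of y "d / 2"] y(1) k_le_iff[of y 0] g0 by linarith+
  then show False using d(2)[of "k y"] d(1) y(3) by simp
qed

end


section \<open>Weak convergence of the distance\<close>

text \<open>Tested on the functions \<open>cts_step\<close>, which suffice for weak convergence and
  are uniformly continuous: a small change of the argument costs at most \<open>r / 4\<close>, and a
  large one costs at most 1 but has small probability.\<close>

lemma (in prob_space) slutsky:
  fixes X Y :: "nat \<Rightarrow> 'a \<Rightarrow> real"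
  assumes X [measurable]: "\<And>n. X n \<in> borel_measurable M" and Y [measurable]: "\<And>n. Y n \<in> borel_measurable M"
    and D: "real_distribution D" and XD: "weak_conv_m (\<lambda>n. distr M borel (X n)) D"
    and close: "\<And>\<epsilon>. 0 < \<epsilon> \<Longrightarrow> (\<lambda>n. prob {\<omega>\<in>space M. \<epsilon> < \<bar>Y n \<omega> - X n \<omega>\<bar>}) \<longlonglongrightarrow> 0"
  shows "weak_conv_m (\<lambda>n. distr M borel (Y n)) D"
proof -
  have rX: "real_distribution (distr M borel (X n))" for n by (rule real_distribution_distr) simp
  have rY: "real_distribution (distr M borel (Y n))" for n by (rule real_distribution_distr) simp
  show ?thesis
  proof (rule integral_cts_step_conv_imp_weak_conv[OF rY D])
    fix a b :: real assume ab: "a < b"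
    let ?f = "cts_step a b"
    have uc: "uniformly_continuous_on UNIV ?f" by (rule cts_step_uniformly_continuous[OF ab])
    have cont: "isCont ?f x" for x
      using uniformly_continuous_imp_continuous[OF uc] by (simp add: continuous_on_eq_continuous_at)
    have [measurable]: "?f \<in> borel_measurable borel"
      by (intro borel_measurable_continuous_onI uniformly_continuous_imp_continuous uc)
    have f01: "0 \<le> ?f x" "?f x \<le> 1" for x using ab by (auto simp: cts_step_def divide_simps)
    have int: "integrable M (\<lambda>\<omega>. ?f (Z \<omega>))" if [measurable]: "Z \<in> borel_measurable M" for Z
      by (rule integrable_const_bound[where B=1]) (use f01 in auto)
    have "(\<lambda>n. integral\<^sup>L (distr M borel (X n)) ?f) \<longlonglongrightarrow> integral\<^sup>L D ?f"
      using weak_conv_imp_integral_bdd_continuous_conv[OF rX D XD, of ?f 1] cont f01 by simp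
    then have 1: "(\<lambda>n. expectation (\<lambda>\<omega>. ?f (X n \<omega>))) \<longlonglongrightarrow> integral\<^sup>L D ?f"
      by (simp add: integral_distr)
    have 2: "(\<lambda>n. expectation (\<lambda>\<omega>. ?f (Y n \<omega>)) - expectation (\<lambda>\<omega>. ?f (X n \<omega>))) \<longlonglongrightarrow> 0"
    proof (rule LIMSEQ_I)
      fix r :: real assume r: "0 < r"
      then obtain d where d: "0 < d" "\<And>x y. \<bar>y - x\<bar> < d \<Longrightarrow> \<bar>?f y - ?f x\<bar> < r / 4"
        using uc unfolding uniformly_continuous_on_def dist_real_def
        by (metis UNIV_I zero_less_divide_iff zero_less_numeral)
      have "eventually (\<lambda>n. prob {\<omega>\<in>space M. d / 2 < \<bar>Y n \<omega> - X n \<omega>\<bar>} < r / 4) sequentially"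
        by (rule order_tendstoD(2)[OF close]) (use d(1) r in auto)
      then obtain N where N: "\<And>n. n \<ge> N \<Longrightarrow> prob {\<omega>\<in>space M. d / 2 < \<bar>Y n \<omega> - X n \<omega>\<bar>} < r / 4"
        by (auto simp: eventually_sequentially)
      have "norm (expectation (\<lambda>\<omega>. ?f (Y n \<omega>)) - expectation (\<lambda>\<omega>. ?f (X n \<omega>)) - 0) < r" if "n \<ge> N" for n
      proof -
        let ?A = "{\<omega>\<in>space M. d / 2 < \<bar>Y n \<omega> - X n \<omega>\<bar>}"
        have "\<bar>expectation (\<lambda>\<omega>. ?f (Y n \<omega>)) - expectation (\<lambda>\<omega>. ?f (X n \<omega>))\<bar>
            = \<bar>expectation (\<lambda>\<omega>. ?f (Y n \<omega>) - ?f (X n \<omega>))\<bar>"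
          by (simp add: int)
        also have "\<dots> \<le> expectation (\<lambda>\<omega>. \<bar>?f (Y n \<omega>) - ?f (X n \<omega>)\<bar>)"
          by (rule integral_abs_bound)
        also have "\<dots> \<le> expectation (\<lambda>\<omega>. r / 4 + indicator ?A \<omega>)"
        proof (rule integral_mono)
          show "integrable M (\<lambda>\<omega>. \<bar>?f (Y n \<omega>) - ?f (X n \<omega>)\<bar>)" by (intro integrable_abs Bochner_Integration.integrable_diff int) auto
          show "integrable M (\<lambda>\<omega>. r / 4 + indicator ?A \<omega>)"
            by (rule integrable_const_bound[where B="r + 1"]) (use r in \<open>auto simp: indicator_def\<close>)
          fix \<omega> assume "\<omega> \<in> space M"
          then show "\<bar>?f (Y n \<omega>) - ?f (X n \<omega>)\<bar> \<le> r / 4 + indicator ?A \<omega>"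
            using d(2)[of "Y n \<omega>" "X n \<omega>"] d(1) f01[of "Y n \<omega>"] f01[of "X n \<omega>"] r
            by (cases "\<omega> \<in> ?A") (auto simp: indicator_def)
        qed
        also have "\<dots> = r / 4 + prob ?A"
          by (subst Bochner_Integration.integral_add) (auto simp: prob_space intro!: integrable_const_bound[where B=1])
        finally show ?thesis using N[OF that] r by simp
      qed
      then show "\<exists>N. \<forall>n\<ge>N. norm (expectation (\<lambda>\<omega>. ?f (Y n \<omega>)) - expectation (\<lambda>\<omega>. ?f (X n \<omega>)) - 0) < r"
        by blast
    qed
    from tendsto_add[OF 1 2] show "(\<lambda>n. integral\<^sup>L (distr M borel (Y n)) ?f) \<longlonglongrightarrow> integral\<^sup>L D ?f"
      by (simp add: integral_distr)
  qed
qed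

lemma (in prob_space) L1_imp_in_prob:
  fixes Y :: "nat \<Rightarrow> 'a \<Rightarrow> real"
  assumes int: "\<And>n. integrable M (Y n)" and lim: "(\<lambda>n. expectation (\<lambda>\<omega>. \<bar>Y n \<omega>\<bar>)) \<longlonglongrightarrow> 0" and "0 < \<epsilon>"
  shows "(\<lambda>n. prob {\<omega>\<in>space M. \<epsilon> < \<bar>Y n \<omega>\<bar>}) \<longlonglongrightarrow> 0"
proof (rule tendsto_sandwich[OF _ _ tendsto_const])
  have [measurable]: "Y n \<in> borel_measurable M" for n using int by auto
  show "(\<lambda>n. expectation (\<lambda>\<omega>. \<bar>Y n \<omega>\<bar>) / \<epsilon>) \<longlonglongrightarrow> 0" using tendsto_divide[OF lim tendsto_const[of \<epsilon>]] \<open>0 < \<epsilon>\<close> by simp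
  have "prob {\<omega>\<in>space M. \<epsilon> < \<bar>Y n \<omega>\<bar>} \<le> expectation (\<lambda>\<omega>. \<bar>Y n \<omega>\<bar>) / \<epsilon>" for n
  proof -
    have "prob {\<omega>\<in>space M. \<epsilon> < \<bar>Y n \<omega>\<bar>} \<le> prob {\<omega>\<in>space M. \<epsilon> \<le> \<bar>Y n \<omega>\<bar>}"
      by (rule finite_measure_mono) auto
    also have "\<dots> \<le> expectation (\<lambda>\<omega>. \<bar>Y n \<omega>\<bar>) / \<epsilon>"
      by (rule integral_Markov_inequality_measure[where A="space M"]) (use int \<open>0 < \<epsilon>\<close> in auto)
    finally show ?thesis .
  qed
  then show "\<forall>\<^sub>F n in sequentially. prob {\<omega>\<in>space M. \<epsilon> < \<bar>Y n \<omega>\<bar>} \<le> expectation (\<lambda>\<omega>. \<bar>Y n \<omega>\<bar>) / \<epsilon>" by simp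
qed simp

text \<open>\<open>R n x\<close> is the normalised empirical distribution function at the scale point \<open>x\<close>, \<open>q n\<close> the
  rescaled quantile, \<open>H n x\<close> the conditional distribution function of the rescaled bootstrap quantile.\<close>

locale gap_limit = prob_space M + scale g k for M :: "'a measure" and g k +
  fixes R H :: "nat \<Rightarrow> real \<Rightarrow> 'a \<Rightarrow> real" and q T :: "nat \<Rightarrow> 'a \<Rightarrow> real"
  assumes q_measurable [measurable]: "\<And>n. q n \<in> borel_measurable M"
    and T_measurable [measurable]: "\<And>n. T n \<in> borel_measurable M"
    and R_int: "\<And>n x. integrable M (R n x)"
    and H_measurable [measurable]: "\<And>n x. H n x \<in> borel_measurable M"
    and q_iff: "\<And>n x \<omega>. \<omega> \<in> space M \<Longrightarrow> q n \<omega> \<le> x \<longleftrightarrow> 0 \<le> R n x \<omega>"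
    and H_mono: "\<And>n \<omega>. mono (\<lambda>x. H n x \<omega>)"
    and H01: "\<And>n x \<omega>. 0 \<le> H n x \<omega>" "\<And>n x \<omega>. H n x \<omega> \<le> 1"
    and T_eq: "\<And>n \<omega>. \<omega> \<in> space M \<Longrightarrow>
      T n \<omega> = (SUP t. \<bar>H n (q n \<omega> + t) \<omega> - prob {\<omega>'\<in>space M. q n \<omega>' \<le> t}\<bar>)"
    and R_incr: "\<And>x. (\<lambda>n. expectation (\<lambda>\<omega>. \<bar>R n x \<omega> - R n 0 \<omega> - g x\<bar>)) \<longlonglongrightarrow> 0"
    and R_clt: "weak_conv_m (\<lambda>n. distr M borel (\<lambda>\<omega>. - R n 0 \<omega>)) std_normal_distribution"
    and H_lim: "\<And>x. (\<lambda>n. expectation (\<lambda>\<omega>. \<bar>H n x \<omega> - Phi (R n x \<omega>)\<bar>)) \<longlonglongrightarrow> 0"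
begin

lemma R_measurable [measurable]: "R n x \<in> borel_measurable M"
  using R_int by auto

definition G :: "nat \<Rightarrow> real \<Rightarrow> real" where
  "G n x = prob {\<omega>\<in>space M. q n \<omega> \<le> x}"

lemma prob_neg_R0_le: "(\<lambda>n. prob {\<omega>\<in>space M. - R n 0 \<omega> \<le> y}) \<longlonglongrightarrow> Phi y"
proof -
  have "(\<lambda>n. cdf (distr M borel (\<lambda>\<omega>. - R n 0 \<omega>)) y) \<longlonglongrightarrow> Phi y"
    using R_clt isCont_Phi by (simp add: weak_conv_m_def weak_conv_def Phi_def)
  moreover have "(\<lambda>\<omega>. - R n 0 \<omega>) -` {..y} \<inter> space M = {\<omega>\<in>space M. - R n 0 \<omega> \<le> y}" for n by auto
  ultimately show ?thesis by (simp add: cdf_def measure_distr)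
qed

text \<open>By \<open>q_iff\<close>, the event \<open>q n \<omega> \<le> x\<close> says that
  \<open>g x - R n x \<omega> \<le> g x\<close>, and \<open>g x - R n x\<close> differs from
  \<open>- R n 0\<close> by an error that vanishes in mean.\<close>

lemma G_lim: "(\<lambda>n. G n x) \<longlonglongrightarrow> Phi (g x)"
proof -
  let ?Y = "\<lambda>n \<omega>. g x - R n x \<omega>"
  have "weak_conv_m (\<lambda>n. distr M borel (?Y n)) std_normal_distribution"
  proof (rule slutsky[OF _ _ real_dist_normal_dist R_clt])
    fix \<epsilon> :: real assume "0 < \<epsilon>"
    from L1_imp_in_prob[OF _ R_incr[of x] this]
    have "(\<lambda>n. prob {\<omega>\<in>space M. \<epsilon> < \<bar>R n x \<omega> - R n 0 \<omega> - g x\<bar>}) \<longlonglongrightarrow> 0"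
      by (simp add: R_int)
    moreover have "\<bar>R n x \<omega> - R n 0 \<omega> - g x\<bar> = \<bar>g x - R n x \<omega> - - R n 0 \<omega>\<bar>" for n \<omega> by linarith
    ultimately show "(\<lambda>n. prob {\<omega>\<in>space M. \<epsilon> < \<bar>g x - R n x \<omega> - - R n 0 \<omega>\<bar>}) \<longlonglongrightarrow> 0" by simp
  qed auto
  then have "(\<lambda>n. cdf (distr M borel (?Y n)) (g x)) \<longlonglongrightarrow> Phi (g x)"
    using isCont_Phi by (simp add: weak_conv_m_def weak_conv_def Phi_def)
  moreover have "cdf (distr M borel (?Y n)) (g x) = G n x" for n
  proof -
    have "?Y n -` {..g x} \<inter> space M = {\<omega>\<in>space M. q n \<omega> \<le> x}" by (auto simp: q_iff)
    then show ?thesis by (simp add: cdf_def measure_distr G_def)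
  qed
  ultimately show ?thesis by simp
qed

lemma q_lim: "weak_conv_m (\<lambda>n. distr M borel (q n)) (distr std_normal_distribution borel k)"
  unfolding weak_conv_m_def weak_conv_def
proof (intro allI impI)
  fix x
  have "q n -` {..x} \<inter> space M = {\<omega>\<in>space M. q n \<omega> \<le> x}" for n by auto
  then have "cdf (distr M borel (q n)) x = G n x" for n
    by (simp add: cdf_def measure_distr G_def)
  moreover have "k -` {..x} = {..g x}" by (auto simp: k_le_iff)
  then have "cdf (distr std_normal_distribution borel k) x = Phi (g x)"
    by (simp add: cdf_def measure_distr Phi_def)
  ultimately show "(\<lambda>n. cdf (distr M borel (q n)) x) \<longlonglongrightarrow> cdf (distr std_normal_distribution borel k) x"
    using G_lim by simp
qed

text \<open>On the grid everything is close to its limit; monotonicity carries this over to the random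
  point \<open>q n \<omega>\<close>, where it yields \<open>g (q n \<omega>) \<approx> - R n 0 \<omega>\<close>.\<close>

lemma T_near_gap:
  assumes \<epsilon>: "0 < \<epsilon>" and L: "0 \<le> L" "Phi (- L) \<le> \<epsilon>" "1 - \<epsilon> \<le> Phi L" and N: "L + K + 3 * \<epsilon> \<le> \<epsilon> * N" and "0 \<le> K"
    and \<omega>: "\<omega> \<in> space M" and R0: "\<bar>R n 0 \<omega>\<bar> \<le> K"
    and Ra: "\<And>a. a \<in> pts \<epsilon> N \<Longrightarrow> \<bar>R n a \<omega> - R n 0 \<omega> - g a\<bar> \<le> \<epsilon>"
    and Ha: "\<And>a. a \<in> pts \<epsilon> N \<Longrightarrow> \<bar>H n a \<omega> - Phi (R n a \<omega>)\<bar> \<le> \<epsilon>"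
    and Ga: "\<And>a. a \<in> pts \<epsilon> N \<Longrightarrow> \<bar>G n a - Phi (g a)\<bar> \<le> \<epsilon>"
  shows "\<bar>T n \<omega> - gap (q n \<omega>)\<bar> \<le> 7 * \<epsilon>"
proof -
  let ?q = "q n \<omega>" and ?w = "R n 0 \<omega>"
  have pt: "k (\<epsilon> * real_of_int i) \<in> pts \<epsilon> N" if "\<bar>i\<bar> \<le> int N" for i
    using that unfolding pts_def by (intro imageI) auto
  have N': "L + K \<le> \<epsilon> * N" "L + 0 \<le> \<epsilon> * N" using N \<epsilon> \<open>0 \<le> K\<close> by linarith+
  \<comment> \<open>On the grid one \<open>\<epsilon>\<close> comes from \<open>Ha\<close> and one
    from \<open>Ra\<close> through the Lipschitz bound; passing to all \<open>s\<close> costs a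
    third.\<close>
  have H: "\<bar>H n s \<omega> - Phi (g s + ?w)\<bar> \<le> 2 * \<epsilon> + \<epsilon>" for s
  proof (rule grid_bound[OF grid_pts[OF \<epsilon> L(2,3) N'(1) R0] H_mono H01])
    fix a assume a: "a \<in> pts \<epsilon> N"
    show "\<bar>H n a \<omega> - Phi (g a + ?w)\<bar> \<le> 2 * \<epsilon>"
      using Ha[OF a] Ra[OF a] Phi_lipschitz[of "R n a \<omega>" "g a + ?w"] by linarith
  qed (use \<epsilon> in simp)
  have G: "\<bar>G n s - Phi (g s + 0)\<bar> \<le> \<epsilon> + \<epsilon>" for s
  proof (rule grid_bound[OF grid_pts[OF \<epsilon> L(2,3) N'(2)]])
    show "mono (G n)" unfolding G_def by (auto intro!: monoI finite_measure_mono)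
  qed (use \<epsilon> Ga in \<open>auto simp: G_def\<close>)
  \<comment> \<open>A grid point whose \<open>g\<close>-value lies between
    \<open>- ?w + \<epsilon>\<close> and \<open>- ?w + 2 * \<epsilon>\<close> has a nonnegative
    \<open>R n\<close> in spite of the error \<open>\<epsilon>\<close>, so the quantile is not to
    its right. The slack \<open>3 * \<epsilon>\<close> in the choice of \<open>N\<close> keeps this
    point on the grid; \<open>lo\<close> mirrors the argument.\<close>
  have up: "g ?q \<le> - ?w + 2 * \<epsilon>"
  proof -
    define i where "i = \<lfloor>(- ?w + 2 * \<epsilon>) / \<epsilon>\<rfloor>"
    have "real_of_int i \<le> (- ?w + 2 * \<epsilon>) / \<epsilon>" "(- ?w + 2 * \<epsilon>) / \<epsilon> < real_of_int i + 1" unfolding i_def by linarith+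
    then have i: "\<epsilon> * real_of_int i \<le> - ?w + 2 * \<epsilon>" "- ?w + \<epsilon> < \<epsilon> * real_of_int i"
      using \<epsilon> by (auto simp: divide_simps algebra_simps)
    have "\<epsilon> * real_of_int i \<le> \<epsilon> * real N" "\<epsilon> * (- real N) \<le> \<epsilon> * real_of_int i"
      using i R0 N L(1) \<epsilon> unfolding mult_minus_right by linarith+
    then have "real_of_int i \<le> real N" "- real N \<le> real_of_int i"
      using \<epsilon> by (simp_all only: mult_le_cancel_left_pos)
    then have "\<bar>i\<bar> \<le> int N" by linarith
    from Ra[OF pt[OF this]] i have "0 \<le> R n (k (\<epsilon> * real_of_int i)) \<omega>" unfolding gk by linarith
    then have "?q \<le> k (\<epsilon> * real_of_int i)" by (simp add: q_iff[OF \<omega>])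
    then have "g ?q \<le> \<epsilon> * real_of_int i" by (simp add: le_k_iff)
    with i show ?thesis by linarith
  qed
  have lo: "- ?w - 2 * \<epsilon> \<le> g ?q"
  proof -
    define i where "i = \<lceil>(- ?w - 2 * \<epsilon>) / \<epsilon>\<rceil>"
    have "(- ?w - 2 * \<epsilon>) / \<epsilon> \<le> real_of_int i" "real_of_int i - 1 < (- ?w - 2 * \<epsilon>) / \<epsilon>" unfolding i_def by linarith+
    then have i: "- ?w - 2 * \<epsilon> \<le> \<epsilon> * real_of_int i" "\<epsilon> * real_of_int i < - ?w - \<epsilon>"
      using \<epsilon> by (auto simp: divide_simps algebra_simps)
    have "\<epsilon> * real_of_int i \<le> \<epsilon> * real N" "\<epsilon> * (- real N) \<le> \<epsilon> * real_of_int i"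
      using i R0 N L(1) \<epsilon> unfolding mult_minus_right by linarith+
    then have "real_of_int i \<le> real N" "- real N \<le> real_of_int i"
      using \<epsilon> by (simp_all only: mult_le_cancel_left_pos)
    then have "\<bar>i\<bar> \<le> int N" by linarith
    from Ra[OF pt[OF this]] i have "\<not> 0 \<le> R n (k (\<epsilon> * real_of_int i)) \<omega>" unfolding gk by linarith
    then have "k (\<epsilon> * real_of_int i) \<le> ?q" by (simp add: q_iff[OF \<omega>, symmetric])
    then have "\<epsilon> * real_of_int i \<le> g ?q" by (simp add: k_le_iff)
    with i show ?thesis by linarith
  qed
  \<comment> \<open>Of the \<open>5 * \<epsilon>\<close>, three come from \<open>H\<close> and two
    from replacing \<open>?w\<close> by \<open>- g ?q\<close>; the other
    \<open>2 * \<epsilon>\<close> come from \<open>G\<close>.\<close>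
  have "\<bar>(SUP t. \<bar>H n (?q + t) \<omega> - G n t\<bar>) - (SUP t. \<bar>Phi (g (?q + t) - g ?q) - Phi (g t)\<bar>)\<bar> \<le> 5 * \<epsilon> + 2 * \<epsilon>"
  proof (rule SUP_abs_diff_close)
    show "bdd_above (range (\<lambda>t. \<bar>H n (?q + t) \<omega> - G n t\<bar>))"
      by (rule bdd_above_abs_diff) (auto simp: H01 G_def)
    show "bdd_above (range (\<lambda>t. \<bar>Phi (g (?q + t) - g ?q) - Phi (g t)\<bar>))" by (rule gap_bdd)
    show "\<bar>H n (?q + s) \<omega> - Phi (g (?q + s) - g ?q)\<bar> \<le> 5 * \<epsilon>" for s
      using H[of "?q + s"] up lo Phi_lipschitz[of "g (?q + s) + ?w" "g (?q + s) - g ?q"] by linarith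
    show "\<bar>G n s - Phi (g s)\<bar> \<le> 2 * \<epsilon>" for s using G[of s] by simp
  qed
  then show ?thesis by (simp add: T_eq[OF \<omega>] G_def gap_def)
qed

text \<open>\<open>gap (q n)\<close> converges by continuous mapping, and \<open>T n\<close> is near
  it outside an event whose probability is bounded by finitely many terms that tend to 0 and the
  tails of \<open>R n 0\<close>.\<close>

theorem T_lim: "weak_conv_m (\<lambda>n. distr M borel (T n)) (distr std_normal_distribution borel (\<lambda>z. gap (k z)))"
proof (rule slutsky[where X="\<lambda>n \<omega>. gap (q n \<omega>)"])
  have rq: "real_distribution (distr M borel (q n))" for n by (rule real_distribution_distr) simp
  have rk: "real_distribution (distr std_normal_distribution borel k)"
    by (rule std_normal.real_distribution_distr) simp
  show rgk: "real_distribution (distr std_normal_distribution borel (\<lambda>z. gap (k z)))"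
    by (rule std_normal.real_distribution_distr) simp
  show "weak_conv_m (\<lambda>n. distr M borel (\<lambda>\<omega>. gap (q n \<omega>))) (distr std_normal_distribution borel (\<lambda>z. gap (k z)))"
  proof (rule integral_bdd_continuous_conv_imp_weak_conv[OF _ rgk])
    fix f :: "real \<Rightarrow> real" assume f: "\<And>x. isCont f x" "\<And>x. \<bar>f x\<bar> \<le> 1"
    have [measurable]: "f \<in> borel_measurable borel"
      by (intro borel_measurable_continuous_onI continuous_at_imp_continuous_on ballI f)
    have "(\<lambda>n. integral\<^sup>L (distr M borel (q n)) (\<lambda>x. f (gap x)))
        \<longlonglongrightarrow> integral\<^sup>L (distr std_normal_distribution borel k) (\<lambda>x. f (gap x))"
      by (rule weak_conv_imp_integral_bdd_continuous_conv[OF rq rk q_lim, of _ 1])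
        (auto intro!: isCont_o2[OF isCont_gap] f simp: f)
    then show "(\<lambda>n. integral\<^sup>L (distr M borel (\<lambda>\<omega>. gap (q n \<omega>))) f)
        \<longlonglongrightarrow> integral\<^sup>L (distr std_normal_distribution borel (\<lambda>z. gap (k z))) f"
      by (simp add: integral_distr)
  qed (auto intro!: real_distribution_distr)
  fix \<epsilon>' :: real assume "0 < \<epsilon>'"
  define \<epsilon> where "\<epsilon> = \<epsilon>' / 7"
  have \<epsilon>: "0 < \<epsilon>" using \<open>0 < \<epsilon>'\<close> by (simp add: \<epsilon>_def)
  obtain L where L: "0 \<le> L" "Phi (- L) \<le> \<epsilon>" "1 - \<epsilon> \<le> Phi L" using Phi_tails[OF \<epsilon>] by auto
  show "(\<lambda>n. prob {\<omega>\<in>space M. \<epsilon>' < \<bar>T n \<omega> - gap (q n \<omega>)\<bar>}) \<longlonglongrightarrow> 0"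
  proof (rule LIMSEQ_I)
    fix r :: real assume r: "0 < r"
    obtain K where K: "0 \<le> K" "Phi (- K) \<le> r / 4" "1 - r / 4 \<le> Phi K" using Phi_tails[of "r / 4"] r by auto
    obtain N :: nat where N: "L + K + 3 * \<epsilon> \<le> \<epsilon> * N"
      using real_arch_simple[of "(L + K + 3 * \<epsilon>) / \<epsilon>"] \<epsilon> by (auto simp: divide_le_eq mult.commute)
    let ?S = "pts \<epsilon> N"
    let ?A = "\<lambda>n a. {\<omega>\<in>space M. \<epsilon> < \<bar>R n a \<omega> - R n 0 \<omega> - g a\<bar>}"
    let ?B = "\<lambda>n a. {\<omega>\<in>space M. \<epsilon> < \<bar>H n a \<omega> - Phi (R n a \<omega>)\<bar>}"
    \<comment> \<open>Outside this event \<open>\<bar>R n 0 \<omega>\<bar> \<le> K\<close>. It is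
      expressed through the distribution function of \<open>- R n 0\<close>, whose limit is known;
      by the choice of \<open>K\<close> the tails contribute at most \<open>r / 2\<close> in the
      limit.\<close>
    let ?C = "\<lambda>n. {\<omega>\<in>space M. - R n 0 \<omega> \<le> - K} \<union> (space M - {\<omega>\<in>space M. - R n 0 \<omega> \<le> K})"
    define u where "u n = (\<Sum>a\<in>?S. prob (?A n a) + prob (?B n a)) + (prob {\<omega>\<in>space M. - R n 0 \<omega> \<le> - K}
        + (1 - prob {\<omega>\<in>space M. - R n 0 \<omega> \<le> K}))" for n
    have "u \<longlonglongrightarrow> (\<Sum>a\<in>?S. 0 + 0) + (Phi (- K) + (1 - Phi K))"
      unfolding u_def
    proof (intro tendsto_intros prob_neg_R0_le)
      fix a
      show "(\<lambda>n. prob (?A n a)) \<longlonglongrightarrow> 0"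
        by (rule L1_imp_in_prob[OF _ R_incr \<epsilon>]) (intro Bochner_Integration.integrable_diff R_int, simp)
      show "(\<lambda>n. prob (?B n a)) \<longlonglongrightarrow> 0"
      proof (rule L1_imp_in_prob[OF _ H_lim \<epsilon>])
        show "integrable M (\<lambda>\<omega>. H n a \<omega> - Phi (R n a \<omega>))" for n
          by (rule integrable_const_bound[where B=1])
            (auto intro!: abs_diff_le_1 H01 Phi_nonneg Phi_le_1)
      qed
    qed
    moreover have "(\<Sum>a\<in>?S. 0 + 0) + (Phi (- K) + (1 - Phi K)) < r" using K r by simp
    ultimately have "eventually (\<lambda>n. u n < r) sequentially" by (rule order_tendstoD(2))
    moreover have "eventually (\<lambda>n. \<forall>a\<in>?S. \<bar>G n a - Phi (g a)\<bar> < \<epsilon>) sequentially"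
      using tendstoD[OF G_lim \<epsilon>] by (simp add: eventually_ball_finite finite_pts dist_real_def)
    ultimately have "eventually (\<lambda>n. prob {\<omega>\<in>space M. \<epsilon>' < \<bar>T n \<omega> - gap (q n \<omega>)\<bar>} < r) sequentially"
    proof eventually_elim
      case (elim n)
      have "{\<omega>\<in>space M. \<epsilon>' < \<bar>T n \<omega> - gap (q n \<omega>)\<bar>} \<subseteq> (\<Union>a\<in>?S. ?A n a \<union> ?B n a) \<union> ?C n"
      proof (rule subsetI, rule ccontr)
        fix \<omega> assume *: "\<omega> \<in> {\<omega>\<in>space M. \<epsilon>' < \<bar>T n \<omega> - gap (q n \<omega>)\<bar>}" "\<omega> \<notin> (\<Union>a\<in>?S. ?A n a \<union> ?B n a) \<union> ?C n"
        then have \<omega>: "\<omega> \<in> space M" by simp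
        have "\<bar>T n \<omega> - gap (q n \<omega>)\<bar> \<le> 7 * \<epsilon>"
        proof (rule T_near_gap[OF \<epsilon> L N K(1) \<omega>])
          show "\<bar>R n 0 \<omega>\<bar> \<le> K" using *(2) \<omega> by auto
          show "\<bar>R n a \<omega> - R n 0 \<omega> - g a\<bar> \<le> \<epsilon>" "\<bar>H n a \<omega> - Phi (R n a \<omega>)\<bar> \<le> \<epsilon>" if "a \<in> ?S" for a
            using *(2) \<omega> that by (auto simp: not_less)
          show "\<bar>G n a - Phi (g a)\<bar> \<le> \<epsilon>" if "a \<in> ?S" for a using elim(2) that by force
        qed
        with *(1) show False by (simp add: \<epsilon>_def)
      qed
      then have "prob {\<omega>\<in>space M. \<epsilon>' < \<bar>T n \<omega> - gap (q n \<omega>)\<bar>} \<le> prob ((\<Union>a\<in>?S. ?A n a \<union> ?B n a) \<union> ?C n)"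
        by (rule finite_measure_mono) (intro sets.Un sets.finite_UN finite_pts sets.Diff; measurable)
      also have "\<dots> \<le> prob (\<Union>a\<in>?S. ?A n a \<union> ?B n a) + prob (?C n)"
        by (rule measure_Un_le) (auto simp: finite_pts)
      also have "prob (\<Union>a\<in>?S. ?A n a \<union> ?B n a) \<le> (\<Sum>a\<in>?S. prob (?A n a \<union> ?B n a))"
        by (rule measure_UNION_le) (auto simp: finite_pts)
      also have "(\<Sum>a\<in>?S. prob (?A n a \<union> ?B n a)) \<le> (\<Sum>a\<in>?S. prob (?A n a) + prob (?B n a))"
        by (intro sum_mono measure_Un_le) auto
      also have "prob (?C n) \<le> prob {\<omega>\<in>space M. - R n 0 \<omega> \<le> - K} + prob (space M - {\<omega>\<in>space M. - R n 0 \<omega> \<le> K})"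
        by (rule measure_Un_le) auto
      also have "prob (space M - {\<omega>\<in>space M. - R n 0 \<omega> \<le> K}) = 1 - prob {\<omega>\<in>space M. - R n 0 \<omega> \<le> K}"
        by (rule prob_compl) simp
      finally show ?case using elim(1) by (simp add: u_def)
    qed
    then show "\<exists>no. \<forall>n\<ge>no. norm (prob {\<omega>\<in>space M. \<epsilon>' < \<bar>T n \<omega> - gap (q n \<omega>)\<bar>} - 0) < r"
      by (auto simp: eventually_sequentially)
  qed
qed auto

end

section \<open>Sums of independent copies\<close>

lemma exp_minus_approx:
  fixes y :: real assumes "0 \<le> y" shows "\<bar>1 - y - exp (- y)\<bar> \<le> y\<^sup>2 / 2"
proof -
  have "1 - y \<le> exp (- y)" using exp_ge_add_one_self[of "- y"] by simp
  moreover have "exp (- y) \<le> 1 - y + y\<^sup>2 / 2"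
  proof -
    have "1 + y + y\<^sup>2 / 2 \<le> exp y" using exp_lower_Taylor_quadratic[OF assms] .
    \<comment> \<open>The product equals \<open>1 + y^4 / 4\<close>, so the lower bound for
      \<open>exp y\<close> becomes an upper bound for \<open>exp (- y)\<close>.\<close>
    moreover have "1 \<le> (1 - y + y\<^sup>2 / 2) * (1 + y + y\<^sup>2 / 2)"
    proof -
      have "(1 - y + y\<^sup>2 / 2) * (1 + y + y\<^sup>2 / 2) = 1 + y^4 / 4"
        by (simp add: field_simps power2_eq_square power4_eq_xxxx)
      then show ?thesis by simp
    qed
    moreover have "0 < 1 - y + y\<^sup>2 / 2"
    proof -
      have "1 - y + y\<^sup>2 / 2 = ((y - 1)\<^sup>2 + 1) / 2" by (simp add: power2_eq_square field_simps)
      also have "\<dots> > 0" by (simp add: add_nonneg_pos)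
      finally show ?thesis .
    qed
    ultimately have "1 \<le> (1 - y + y\<^sup>2 / 2) * exp y"
      using mult_left_mono[of "1 + y + y\<^sup>2 / 2" "exp y" "1 - y + y\<^sup>2 / 2"] by linarith
    then show ?thesis by (simp add: exp_minus divide_simps)
  qed
  ultimately show ?thesis by linarith
qed

lemma abs_exp_minus_diff_le:
  fixes a b :: real
  assumes "0 \<le> a" "0 \<le> b" shows "\<bar>exp (- a) - exp (- b)\<bar> \<le> \<bar>a - b\<bar>"
proof -
  have *: "\<bar>exp (- a) - exp (- b)\<bar> \<le> \<bar>a - b\<bar>" if "0 \<le> a" "a \<le> b" for a b :: real
  proof -
    have "exp (- a) - exp (- b) = exp (- a) * (1 - exp (- (b - a)))"
      by (simp add: right_diff_distrib mult_exp_exp)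
    also have "\<dots> \<le> 1 * (1 - exp (- (b - a)))" using that by (intro mult_right_mono) auto
    also have "\<dots> \<le> b - a" using exp_ge_add_one_self[of "- (b - a)"] unfolding mult_1 by linarith
    finally show ?thesis using that by simp
  qed
  show ?thesis using *[of a b] *[of b a] assms by (cases "a \<le> b") (auto simp: abs_minus_commute)
qed

text \<open>A Lindeberg estimate with explicit constants. The Taylor remainder
  \<open>min (6 * X\<^sup>2) (\<bar>t\<bar> * \<bar>X\<bar> ^ 3)\<close> is split at level
  \<open>c\<close>: large values give \<open>L\<close>, for the others one factor of the cube is at
  most \<open>c\<close>. Comparing powers of two numbers in the unit disc costs the factor
  \<open>m\<close>. Both the Bernstein blocks and the bootstrap blocks use it.\<close>

lemma (in prob_space) char_power_bound:
  fixes X :: "'a \<Rightarrow> real"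
  assumes X [measurable]: "X \<in> borel_measurable M" and X2: "integrable M (\<lambda>\<omega>. (X \<omega>)\<^sup>2)" and X0: "expectation X = 0"
    and "0 \<le> c"
  defines "s2 \<equiv> expectation (\<lambda>\<omega>. (X \<omega>)\<^sup>2)"
    and "L \<equiv> expectation (\<lambda>\<omega>. (X \<omega>)\<^sup>2 * indicator {x. c < \<bar>x\<bar>} (X \<omega>))"
  shows "cmod (char (distr M borel X) t ^ m - exp (- (real m * t\<^sup>2 * s2 / 2)))
    \<le> real m * t\<^sup>2 * (L + \<bar>t\<bar> * c * s2 / 6) + real m * t ^ 4 * s2\<^sup>2 / 8"
proof -
  have X1: "integrable M X" by (rule square_integrable_imp_integrable[OF X X2])
  interpret D: real_distribution "distr M borel X" by (rule real_distribution_distr) simp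
  let ?\<phi> = "char (distr M borel X) t" and ?y = "t\<^sup>2 * s2 / 2"
  have s2: "0 \<le> s2" by (simp add: s2_def)
  have intL: "integrable M (\<lambda>\<omega>. (X \<omega>)\<^sup>2 * indicator {x. c < \<bar>x\<bar>} (X \<omega>))"
    by (rule Bochner_Integration.integrable_bound[OF X2]) (auto simp: indicator_def)
  have "cmod (?\<phi> - (1 - t\<^sup>2 * s2 / 2)) \<le> t\<^sup>2 / 6 * expectation (\<lambda>x. min (6 * (X x)\<^sup>2) (\<bar>t\<bar> * \<bar>X x\<bar> ^ 3))"
    by (rule char_approx3'[OF X X1 X2 X0 _ refl]) (simp add: X0 s2_def)
  also have "\<dots> \<le> t\<^sup>2 / 6 * expectation (\<lambda>x. 6 * ((X x)\<^sup>2 * indicator {x. c < \<bar>x\<bar>} (X x)) + \<bar>t\<bar> * c * (X x)\<^sup>2)"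
  proof (intro mult_left_mono integral_mono)
    show "integrable M (\<lambda>x. min (6 * (X x)\<^sup>2) (\<bar>t\<bar> * \<bar>X x\<bar> ^ 3))"
      by (rule Bochner_Integration.integrable_bound[where f="\<lambda>x. 6 * (X x)\<^sup>2"]) (use X2 in auto)
    show "integrable M (\<lambda>x. 6 * ((X x)\<^sup>2 * indicator {x. c < \<bar>x\<bar>} (X x)) + \<bar>t\<bar> * c * (X x)\<^sup>2)"
      using intL X2 by simp
    fix x
    show "min (6 * (X x)\<^sup>2) (\<bar>t\<bar> * \<bar>X x\<bar> ^ 3) \<le> 6 * ((X x)\<^sup>2 * indicator {x. c < \<bar>x\<bar>} (X x)) + \<bar>t\<bar> * c * (X x)\<^sup>2"
    proof (cases "c < \<bar>X x\<bar>")
      case True then show ?thesis using \<open>0 \<le> c\<close> by (auto intro!: min.coboundedI1)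
    next
      case False
      then have "\<bar>X x\<bar> * (X x)\<^sup>2 \<le> c * (X x)\<^sup>2" by (intro mult_right_mono) auto
      moreover have "\<bar>X x\<bar> ^ 3 = \<bar>X x\<bar> * (X x)\<^sup>2" by (simp add: power3_eq_cube power2_eq_square)
      ultimately have "\<bar>t\<bar> * \<bar>X x\<bar> ^ 3 \<le> \<bar>t\<bar> * (c * (X x)\<^sup>2)" by (intro mult_left_mono) auto
      then show ?thesis using False by (auto intro!: min.coboundedI2 simp: mult.assoc)
    qed
  qed simp
  also have "\<dots> = t\<^sup>2 / 6 * (6 * L + \<bar>t\<bar> * c * s2)"
    using intL X2 by (simp add: L_def s2_def)
  also have "\<dots> = t\<^sup>2 * (L + \<bar>t\<bar> * c * s2 / 6)" by (simp add: field_simps)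
  finally have 1: "cmod (?\<phi> - of_real (1 - ?y)) \<le> t\<^sup>2 * (L + \<bar>t\<bar> * c * s2 / 6)" by simp
  have "cmod (of_real (1 - ?y) - of_real (exp (- ?y))) = \<bar>1 - ?y - exp (- ?y)\<bar>"
    by (simp only: of_real_diff[symmetric] norm_of_real real_norm_def)
  also have "\<dots> \<le> ?y\<^sup>2 / 2" by (rule exp_minus_approx) (use s2 in simp)
  also have "\<dots> = t ^ 4 * s2\<^sup>2 / 8" by (simp add: power2_eq_square power4_eq_xxxx)
  finally have 2: "cmod (?\<phi> - of_real (exp (- ?y))) \<le> t\<^sup>2 * (L + \<bar>t\<bar> * c * s2 / 6) + t ^ 4 * s2\<^sup>2 / 8"
    using 1 norm_triangle_ineq[of "?\<phi> - of_real (1 - ?y)" "of_real (1 - ?y) - of_real (exp (- ?y))"] by simp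
  have "exp (- (real m * t\<^sup>2 * s2 / 2)) = exp (- ?y) ^ m"
    by (simp add: exp_of_nat_mult[symmetric] field_simps)
  then have "cmod (?\<phi> ^ m - of_real (exp (- (real m * t\<^sup>2 * s2 / 2)))) = cmod (?\<phi> ^ m - of_real (exp (- ?y)) ^ m)"
    by (simp only: of_real_power)
  also have "\<dots> \<le> real m * cmod (?\<phi> - of_real (exp (- ?y)))"
    by (rule norm_power_diff[OF D.cmod_char_le_1]) (use s2 in \<open>simp only: norm_of_real, simp\<close>)
  also have "\<dots> \<le> real m * (t\<^sup>2 * (L + \<bar>t\<bar> * c * s2 / 6) + t ^ 4 * s2\<^sup>2 / 8)"
    by (rule mult_left_mono[OF 2]) simp
  also have "\<dots> = real m * t\<^sup>2 * (L + \<bar>t\<bar> * c * s2 / 6) + real m * t ^ 4 * s2\<^sup>2 / 8"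
    by (simp add: algebra_simps)
  finally show ?thesis by simp
qed

text \<open>With the identity as scale the grids serve for \<open>Phi\<close> itself.\<close>

lemma scale_id: "scale (\<lambda>x. x) (\<lambda>x. x)"
  by unfold_locales (auto intro: monoI)

lemma weak_conv_std_normal_uniform:
  assumes "\<And>n. real_distribution (D n)" "weak_conv_m D std_normal_distribution" "0 < e"
  shows "eventually (\<lambda>n. \<forall>z. \<bar>cdf (D n) z - Phi z\<bar> \<le> e) sequentially"
proof (rule grid_uniform_conv)
  interpret D: real_distribution "D n" for n by fact
  show "\<exists>S. grid S \<epsilon> Phi" if "0 < \<epsilon>" for \<epsilon> using scale.grid_exists[OF scale_id that, of 0] by simp
  show "mono (cdf (D n))" for n by (intro monoI D.cdf_nondecreasing)
  show "(\<lambda>n. cdf (D n) s) \<longlonglongrightarrow> Phi s" for s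
    using assms(2) isCont_Phi by (simp add: weak_conv_m_def weak_conv_def Phi_def)
  show "0 \<le> cdf (D n) s" for n s by (rule D.cdf_nonneg)
  show "cdf (D n) s \<le> 1" for n s by (rule D.cdf_bounded_prob)
qed fact

section \<open>A central limit theorem for resampling, uniform in the law\<close>

lemma char_resample_sum:
  fixes y :: "'i \<Rightarrow> real"
  shows "char (distr (measure_pmf (Pi_pmf {..<b} d (\<lambda>_. Q))) borel (\<lambda>s. (\<Sum>k<b. y (s k)) / sqrt (real b))) u
    = char (distr (measure_pmf Q) borel y) (u / sqrt (real b)) ^ b"
proof -
  let ?P = "Pi_pmf {..<b} d (\<lambda>_. Q)"
  have ind: "prob_space.indep_vars (measure_pmf ?P) (\<lambda>_. borel) (\<lambda>k s. y (s k) / sqrt (real b)) {..<b}"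
    using prob_space.indep_vars_compose2[OF measure_pmf.prob_space_axioms indep_vars_Pi_pmf[of "{..<b}" d "\<lambda>_. Q"], of "\<lambda>_ v. y v / sqrt (real b)" "\<lambda>_. borel"] by simp
  have "char (distr (measure_pmf ?P) borel (\<lambda>s. (\<Sum>k<b. y (s k)) / sqrt (real b))) u
    = (\<Prod>k<b. char (distr (measure_pmf ?P) borel (\<lambda>s. y (s k) / sqrt (real b))) u)"
    unfolding sum_divide_distrib by (rule prob_space.char_distr_sum[OF measure_pmf.prob_space_axioms ind])
  also have "\<dots> = (\<Prod>k<b. char (distr (measure_pmf Q) borel y) (u / sqrt (real b)))"
  proof (rule prod.cong[OF refl])
    fix k assume k: "k \<in> {..<b}"
    have "char (distr (measure_pmf ?P) borel (\<lambda>s. y (s k) / sqrt (real b))) u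
      = measure_pmf.expectation ?P (\<lambda>s. iexp (u / sqrt (real b) * y (s k)))"
      by (simp add: char_def integral_distr)
    also have "\<dots> = measure_pmf.expectation (map_pmf (\<lambda>s. s k) ?P) (\<lambda>v. iexp (u / sqrt (real b) * y v))"
      by simp
    also have "map_pmf (\<lambda>s. s k) ?P = Q" using k by (simp add: Pi_pmf_component)
    finally show "char (distr (measure_pmf ?P) borel (\<lambda>s. y (s k) / sqrt (real b))) u
        = char (distr (measure_pmf Q) borel y) (u / sqrt (real b))"
      by (simp add: char_def integral_distr)
  qed
  finally show ?thesis by simp
qed

lemma char_resample_bound:
  fixes y :: "'i \<Rightarrow> real"
  assumes fin: "finite (set_pmf Q)" and b: "1 \<le> b" and \<delta>: "0 < \<delta>" "\<delta> \<le> 1"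
    and y0: "measure_pmf.expectation Q y = 0"
    and y2: "\<bar>measure_pmf.expectation Q (\<lambda>i. (y i)\<^sup>2) - 1\<bar> \<le> \<delta>"
    and L: "measure_pmf.expectation Q (\<lambda>i. (y i)\<^sup>2 * indicator {x. \<delta> * sqrt (real b) < \<bar>x\<bar>} (y i)) \<le> \<delta>"
  shows "cmod (char (distr (measure_pmf (Pi_pmf {..<b} d (\<lambda>_. Q))) borel (\<lambda>s. (\<Sum>k<b. y (s k)) / sqrt (real b))) u
      - exp (- u\<^sup>2 / 2)) \<le> \<delta> * (u\<^sup>2 * (2 + \<bar>u\<bar>) + u ^ 4)"
proof -
  define s2 where "s2 = measure_pmf.expectation Q (\<lambda>i. (y i)\<^sup>2)"
  define c where "c = \<delta> * sqrt (real b)"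
  define Ln where "Ln = measure_pmf.expectation Q (\<lambda>i. (y i)\<^sup>2 * indicator {x. c < \<bar>x\<bar>} (y i))"
  let ?t = "u / sqrt (real b)"
  have int: "integrable (measure_pmf Q) f" for f :: "'i \<Rightarrow> real"
    by (rule integrable_measure_pmf_finite[OF fin])
  have c0: "0 \<le> c" using \<delta> by (simp add: c_def)
  have Ln: "Ln \<le> \<delta>" using L by (simp add: Ln_def c_def)
  have s2: "0 \<le> s2" "s2 \<le> 1 + \<delta>" "\<bar>s2 - 1\<bar> \<le> \<delta>" using y2 by (auto simp: s2_def[symmetric]) (simp add: s2_def)
  \<comment> \<open>Feller's consequence of the Lindeberg condition: a single summand has variance
    at most \<open>c\<^sup>2 + Ln\<close>, hence at most \<open>2 * \<delta>\<close> relative to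
    \<open>b\<close>. This controls the term with \<open>s2\<^sup>2\<close>.\<close>
  have "s2 \<le> measure_pmf.expectation Q (\<lambda>i. c\<^sup>2 + (y i)\<^sup>2 * indicator {x. c < \<bar>x\<bar>} (y i))"
    unfolding s2_def
  proof (rule integral_mono[OF int int])
    fix i
    show "(y i)\<^sup>2 \<le> c\<^sup>2 + (y i)\<^sup>2 * indicator {x. c < \<bar>x\<bar>} (y i)"
      using power_mono[of "\<bar>y i\<bar>" c 2] by (cases "c < \<bar>y i\<bar>") auto
  qed
  also have "\<dots> = c\<^sup>2 + Ln" by (simp add: int Ln_def measure_pmf.prob_space[of Q])
  also have "\<dots> \<le> \<delta> * real b + \<delta> * real b"
  proof (rule add_mono)
    have "c\<^sup>2 = \<delta> * (\<delta> * real b)" by (simp add: c_def power_mult_distrib power2_eq_square)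
    also have "\<dots> \<le> \<delta> * (1 * real b)" using \<delta> by (intro mult_left_mono mult_right_mono) auto
    finally show "c\<^sup>2 \<le> \<delta> * real b" by simp
    have "\<delta> * 1 \<le> \<delta> * real b" using \<delta> b by (intro mult_left_mono) auto
    then show "Ln \<le> \<delta> * real b" using Ln by simp
  qed
  finally have s2b: "s2 / real b \<le> 2 * \<delta>" using b by (simp add: divide_le_eq)
  have t2: "real b * ?t\<^sup>2 = u\<^sup>2" using b by (simp add: power_divide)
  have b0: "real b \<noteq> 0" "sqrt (real b) \<noteq> 0" using b by auto
  have t4: "real b * ?t ^ 4 * s2\<^sup>2 / 8 = u ^ 4 * s2 * (s2 / real b) / 8"
  proof -
    have "?t ^ 4 = (?t\<^sup>2)\<^sup>2" by simp
    also have "?t\<^sup>2 = u\<^sup>2 / real b" by (simp add: power_divide)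
    also have "(u\<^sup>2 / real b)\<^sup>2 = u ^ 4 / (real b)\<^sup>2" by (simp add: power_divide)
    finally show ?thesis using b0 by (simp add: power2_eq_square)
  qed
  have tc: "\<bar>?t\<bar> * c = \<bar>u\<bar> * \<delta>" using b0 by (simp add: c_def)
  have "cmod (char (distr (measure_pmf Q) borel y) ?t ^ b - exp (- (real b * ?t\<^sup>2 * s2 / 2)))
      \<le> real b * ?t\<^sup>2 * (Ln + \<bar>?t\<bar> * c * s2 / 6) + real b * ?t ^ 4 * s2\<^sup>2 / 8"
    unfolding s2_def Ln_def by (rule prob_space.char_power_bound[OF measure_pmf.prob_space_axioms _ int y0 c0]) simp
  also have "\<dots> = u\<^sup>2 * (Ln + \<bar>u\<bar> * \<delta> * s2 / 6) + u ^ 4 * s2 * (s2 / real b) / 8"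
    unfolding t2 t4 tc by simp
  also have "\<dots> \<le> u\<^sup>2 * (\<delta> + \<bar>u\<bar> * \<delta> * 2 / 6) + u ^ 4 * 2 * (2 * \<delta>) / 8"
    using \<delta> s2 s2b Ln by (intro add_mono mult_left_mono divide_right_mono mult_mono) auto
  finally have A: "cmod (char (distr (measure_pmf Q) borel y) ?t ^ b - exp (- (u\<^sup>2 * s2 / 2)))
      \<le> u\<^sup>2 * (\<delta> + \<bar>u\<bar> * \<delta> * 2 / 6) + u ^ 4 * 2 * (2 * \<delta>) / 8" unfolding t2 .
  have "\<bar>exp (- (u\<^sup>2 * s2 / 2)) - exp (- (u\<^sup>2 / 2))\<bar> \<le> \<bar>u\<^sup>2 * s2 / 2 - u\<^sup>2 / 2\<bar>"
    by (rule abs_exp_minus_diff_le) (use s2(1) in auto)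
  also have "\<dots> = u\<^sup>2 / 2 * \<bar>s2 - 1\<bar>"
  proof -
    have eq: "u\<^sup>2 * s2 / 2 - u\<^sup>2 / 2 = u\<^sup>2 / 2 * (s2 - 1)" by (simp add: field_simps)
    show ?thesis unfolding eq abs_mult by simp
  qed
  also have "\<dots> \<le> u\<^sup>2 / 2 * \<delta>" using s2 by (intro mult_left_mono) auto
  finally have "cmod (of_real (exp (- (u\<^sup>2 * s2 / 2))) - of_real (exp (- (u\<^sup>2 / 2)))) \<le> u\<^sup>2 / 2 * \<delta>"
    by (simp only: of_real_diff[symmetric] norm_of_real real_norm_def)
  with A have "cmod (char (distr (measure_pmf Q) borel y) ?t ^ b - of_real (exp (- (u\<^sup>2 / 2))))
      \<le> u\<^sup>2 * (\<delta> + \<bar>u\<bar> * \<delta> * 2 / 6) + u ^ 4 * 2 * (2 * \<delta>) / 8 + u\<^sup>2 / 2 * \<delta>"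
    using norm_triangle_ineq[of "char (distr (measure_pmf Q) borel y) ?t ^ b - of_real (exp (- (u\<^sup>2 * s2 / 2)))"
       "of_real (exp (- (u\<^sup>2 * s2 / 2))) - of_real (exp (- (u\<^sup>2 / 2)))"] by simp
  also have "\<dots> = \<delta> * (u\<^sup>2 * (3 / 2 + \<bar>u\<bar> / 3) + u ^ 4 / 2)" by (simp add: field_simps)
  also have "\<dots> \<le> \<delta> * (u\<^sup>2 * (2 + \<bar>u\<bar>) + u ^ 4)"
    using \<delta> by (intro mult_left_mono add_mono) auto
  finally show ?thesis unfolding char_resample_sum by simp
qed

text \<open>As \<open>\<delta>\<close> does not depend on \<open>Q\<close>, \<open>y\<close> and \<open>b\<close>, this applies to every realisation of the data.\<close>

theorem resample_clt:
  assumes "0 < \<epsilon>"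
  shows "\<exists>\<delta>>0. \<forall>(Q :: nat pmf) y b z d. finite (set_pmf Q) \<longrightarrow> 1 \<le> b \<longrightarrow>
    measure_pmf.expectation Q y = 0 \<longrightarrow>
    \<bar>measure_pmf.expectation Q (\<lambda>i. (y i)\<^sup>2) - 1\<bar> \<le> \<delta> \<longrightarrow>
    measure_pmf.expectation Q (\<lambda>i. (y i)\<^sup>2 * indicator {x. \<delta> * sqrt (real b) < \<bar>x\<bar>} (y i)) \<le> \<delta> \<longrightarrow>
    \<bar>measure_pmf.prob (Pi_pmf {..<b} d (\<lambda>_. Q)) {s. (\<Sum>k<b. y (s k)) / sqrt (real b) \<le> z} - Phi z\<bar> \<le> \<epsilon>"
proof (rule ccontr)
  let ?hyp = "\<lambda>\<delta> (Q :: nat pmf) y b. finite (set_pmf Q) \<and> 1 \<le> b \<and>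
    measure_pmf.expectation Q y = 0 \<and>
    \<bar>measure_pmf.expectation Q (\<lambda>i. (y i)\<^sup>2) - 1\<bar> \<le> \<delta> \<and>
    measure_pmf.expectation Q (\<lambda>i. (y i)\<^sup>2 * indicator {x. \<delta> * sqrt (real b) < \<bar>x\<bar>} (y i)) \<le> \<delta>"
  let ?bad = "\<lambda>Q y b z d. \<not> \<bar>measure_pmf.prob (Pi_pmf {..<b} d (\<lambda>_. Q)) {s. (\<Sum>k<b. y (s k)) / sqrt (real b) \<le> z} - Phi z\<bar> \<le> \<epsilon>"
  \<comment> \<open>If no \<open>\<delta>\<close> works, counterexamples for
    \<open>1 / (m + 1)\<close> form a triangular array. Its normalised sums are asymptotically
    normal by Levy's theorem, uniformly in \<open>z\<close>, which contradicts the fixed error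
    \<open>\<epsilon>\<close>.\<close>
  define \<delta> where "\<delta> m = 1 / real (Suc m)" for m :: nat
  have \<delta>: "0 < \<delta> m" "\<delta> m \<le> 1" for m by (auto simp: \<delta>_def)
  assume "\<not> ?thesis"
  then have ex: "\<exists>Q y b z d. ?hyp (\<delta> m) Q y b \<and> ?bad Q y b z d" for m using \<delta>(1)[of m] by blast
  define P where "P m = (\<lambda>(Q, y, b, z, d). ?hyp (\<delta> m) Q y b \<and> ?bad Q y b z d)" for m
  have "\<exists>w. P m w" for m using ex[of m] unfolding P_def by (simp only: split_paired_Ex prod.case)
  then obtain W where W: "\<And>m. P m (W m)" by metis
  define Q y b z d where "Q m = fst (W m)" and "y m = fst (snd (W m))" and "b m = fst (snd (snd (W m)))"
    and "z m = fst (snd (snd (snd (W m))))" and "d m = snd (snd (snd (snd (W m))))" for m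
  have *: "?hyp (\<delta> m) (Q m) (y m) (b m)" "?bad (Q m) (y m) (b m) (z m) (d m)" for m
    using W[of m] unfolding P_def Q_def y_def b_def z_def d_def split_beta by blast+
  let ?D = "\<lambda>m. distr (measure_pmf (Pi_pmf {..<b m} (d m) (\<lambda>_. Q m))) borel (\<lambda>s. (\<Sum>k<b m. y m (s k)) / sqrt (real (b m)))"
  have rD: "real_distribution (?D m)" for m
    by (rule prob_space.real_distribution_distr[OF measure_pmf.prob_space_axioms]) simp
  have "weak_conv_m ?D std_normal_distribution"
  proof (rule levy_continuity[OF rD real_dist_normal_dist])
    fix u
    have "(\<lambda>m. char (?D m) u - exp (- u\<^sup>2 / 2)) \<longlonglongrightarrow> 0"
    proof (rule Lim_null_comparison)
      show "\<forall>\<^sub>F m in sequentially. norm (char (?D m) u - exp (- u\<^sup>2 / 2)) \<le> \<delta> m * (u\<^sup>2 * (2 + \<bar>u\<bar>) + u ^ 4)"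
        using *(1) \<delta> by (intro always_eventually allI char_resample_bound) auto
      show "(\<lambda>m. \<delta> m * (u\<^sup>2 * (2 + \<bar>u\<bar>) + u ^ 4)) \<longlonglongrightarrow> 0"
        unfolding \<delta>_def by (intro tendsto_mult_left_zero LIMSEQ_Suc[OF lim_1_over_n])
    qed
    then show "(\<lambda>m. char (?D m) u) \<longlonglongrightarrow> char std_normal_distribution u"
      unfolding char_std_normal_distribution by (simp add: LIM_zero_iff)
  qed
  from eventually_happens[OF weak_conv_std_normal_uniform[OF rD this assms]]
  obtain m where "\<bar>cdf (?D m) (z m) - Phi (z m)\<bar> \<le> \<epsilon>" by auto
  moreover have "cdf (?D m) (z m) = measure_pmf.prob (Pi_pmf {..<b m} (d m) (\<lambda>_. Q m))
      {s. (\<Sum>k<b m. y m (s k)) / sqrt (real (b m)) \<le> z m}"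
    by (simp add: cdf_def measure_distr vimage_def)
  ultimately show False using *(2)[of m] by simp
qed

section \<open>Covariance inequalities under strong mixing\<close>

lemma sets_gen_sigma_mono: "I \<subseteq> J \<Longrightarrow> sets (gen_sigma M X I) \<subseteq> sets (gen_sigma M X J)"
  unfolding sets_gen_sigma by (rule sigma_sets_mono') blast

text \<open>Rounding down to a multiple of \<open>1 / m\<close> writes a function with values in \<open>[0, 1]\<close> as an average
  of indicator functions.\<close>

lemma indicator_average_approx:
  fixes u :: real
  assumes "0 \<le> u" "u \<le> 1" "0 < m"
  shows "\<bar>u - (\<Sum>k=1..m. indicator {x. real k / real m \<le> x} u) / real m\<bar> \<le> 1 / real m"
proof -
  let ?N = "nat \<lfloor>real m * u\<rfloor>"
  have "real m * u \<le> real m" using assms by (simp add: mult_left_le)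
  then have N: "?N \<le> m" by linarith
  have "(real k / real m \<le> u) = (k \<le> ?N)" for k :: nat
  proof -
    have "(real k / real m \<le> u) = (real k \<le> real m * u)" using assms by (simp add: divide_le_eq mult.commute)
    also have "\<dots> = (int k \<le> \<lfloor>real m * u\<rfloor>)" by (simp add: le_floor_iff)
    also have "\<dots> = (k \<le> ?N)" using assms by (simp add: le_nat_iff)
    finally show ?thesis .
  qed
  then have "(\<Sum>k=1..m. indicator {x. real k / real m \<le> x} u) = (\<Sum>k=1..m. if k \<le> ?N then 1 else 0 :: real)"
    by (intro sum.cong) (auto simp: indicator_def)
  also have "\<dots> = (\<Sum>k\<in>{k\<in>{1..m}. k \<le> ?N}. 1)" by (rule sum.inter_filter[symmetric]) simp
  also have "{k\<in>{1..m}. k \<le> ?N} = {1..?N}" using N by auto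
  finally have eq: "(\<Sum>k=1..m. indicator {x. real k / real m \<le> x} u) = real ?N" by simp
  have "real ?N \<le> real m * u" "real m * u < real ?N + 1" using assms by (auto simp: of_nat_floor)
  then have "real ?N / real m \<le> u" "u < (real ?N + 1) / real m"
    using assms by (simp_all add: divide_le_eq less_divide_eq mult.commute)
  then show ?thesis unfolding eq by (simp add: add_divide_distrib)
qed

locale mixing_process = prob_space M for M :: "'a measure" +
  fixes X :: "int \<Rightarrow> 'a \<Rightarrow> real"
  assumes X_measurable [measurable]: "\<And>i. X i \<in> borel_measurable M"
    and stationary: "strictly_stationary M X"
    and summable_mixing: "summable (\<lambda>k. mixing_coeff M X (Suc k))"
begin

abbreviation \<alpha> :: "nat \<Rightarrow> real" where "\<alpha> k \<equiv> mixing_coeff M X k"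

abbreviation \<F> :: "int set \<Rightarrow> 'a measure" where "\<F> I \<equiv> gen_sigma M X I"

lemma sets_gen_sigma_subset: "sets (\<F> I) \<subseteq> events"
  unfolding sets_gen_sigma by (rule sets.sigma_sets_subset) (use measurable_sets[OF X_measurable] in blast)

lemma measurable_of_gen_sigma: "f \<in> measurable (\<F> I) N \<Longrightarrow> f \<in> measurable M N"
  by (rule subsetD[OF measurable_mono[OF order_refl refl sets_gen_sigma_subset space_gen_sigma]])

lemma cov_events_le_1: "\<bar>prob (A \<inter> B) - prob A * prob B\<bar> \<le> 1"
  using prob_le_1[of "A \<inter> B"] measure_nonneg[of M "A \<inter> B"] mult_le_one[OF prob_le_1[of A] measure_nonneg prob_le_1[of B]]
    mult_nonneg_nonneg[OF measure_nonneg[of M A] measure_nonneg[of M B]] by linarith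

lemma mixing_coeff_ge:
  assumes "A \<in> sets (\<F> {1..n})" "B \<in> sets (\<F> {n + int k..})"
  shows "\<bar>prob (A \<inter> B) - prob A * prob B\<bar> \<le> \<alpha> k"
  unfolding mixing_coeff_def
proof (rule cSup_upper)
  show "bdd_above {\<bar>prob (A \<inter> B) - prob A * prob B\<bar> |A B n. A \<in> sets (\<F> {1..n}) \<and> B \<in> sets (\<F> {n + int k..})}"
    using cov_events_le_1 by (intro bdd_aboveI[of _ 1]) auto
qed (use assms in blast)

lemma mixing_coeff_nonneg: "0 \<le> \<alpha> k"
  using mixing_coeff_ge[of "{}" 0 "{}" k] by simp

lemma mixing_coeff_antimono: "k \<le> k' \<Longrightarrow> \<alpha> k' \<le> \<alpha> k"
  unfolding mixing_coeff_def[of M X k']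
proof (rule cSup_least)
  assume "k \<le> k'"
  have "{} \<in> sets (\<F> I)" for I by simp
  then show "{\<bar>prob (A \<inter> B) - prob A * prob B\<bar> |A B n. A \<in> sets (\<F> {1..n}) \<and> B \<in> sets (\<F> {n + int k'..})} \<noteq> {}"
    by blast
  fix x assume "x \<in> {\<bar>prob (A \<inter> B) - prob A * prob B\<bar> |A B n. A \<in> sets (\<F> {1..n}) \<and> B \<in> sets (\<F> {n + int k'..})}"
  then obtain A B n where x: "x = \<bar>prob (A \<inter> B) - prob A * prob B\<bar>" and A: "A \<in> sets (\<F> {1..n})"
    and B: "B \<in> sets (\<F> {n + int k'..})" by blast
  have "B \<in> sets (\<F> {n + int k..})"
    using B sets_gen_sigma_mono[of "{n + int k'..}" "{n + int k..}" M X] \<open>k \<le> k'\<close> by auto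
  then show "x \<le> \<alpha> k" unfolding x by (rule mixing_coeff_ge[OF A])
qed

lemma summable_alpha: "summable \<alpha>"
  using summable_mixing by (subst summable_Suc_iff[symmetric])

lemma integrable_bounded:
  fixes f :: "'a \<Rightarrow> 'b::{banach, second_countable_topology}"
  shows "f \<in> borel_measurable M \<Longrightarrow> (\<And>\<omega>. norm (f \<omega>) \<le> B) \<Longrightarrow> integrable M f"
  by (rule integrable_const_bound[where B=B]) auto

text \<open>A layer cake argument: up to rounding, both functions are averages of indicators of
  their level sets, so their covariance is an average of covariances of events, each at most
  \<open>\<alpha> k\<close>.\<close>

lemma cov_unit_interval:
  assumes U: "U \<in> borel_measurable (\<F> {1..n})" and V: "V \<in> borel_measurable (\<F> {n + int k..})"
    and U01: "\<And>\<omega>. 0 \<le> U \<omega>" "\<And>\<omega>. U \<omega> \<le> (1::real)" and V01: "\<And>\<omega>. 0 \<le> V \<omega>" "\<And>\<omega>. V \<omega> \<le> (1::real)"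
  shows "\<bar>expectation (\<lambda>\<omega>. U \<omega> * V \<omega>) - expectation U * expectation V\<bar> \<le> \<alpha> k"
proof -
  have [measurable]: "U \<in> borel_measurable M" "V \<in> borel_measurable M"
    by (rule measurable_of_gen_sigma[OF U] measurable_of_gen_sigma[OF V])+
  \<comment> \<open>Rounding changes the expectation of the product and the product of the
    expectations by at most \<open>2 / m\<close> each; \<open>m\<close> tends to infinity at the
    end.\<close>
  have main: "\<bar>expectation (\<lambda>\<omega>. U \<omega> * V \<omega>) - expectation U * expectation V\<bar> \<le> \<alpha> k + 4 / real m" if m: "0 < m" for m :: nat
  proof -
    define A B where "A i = {\<omega>\<in>space M. real i / real m \<le> U \<omega>}" and "B i = {\<omega>\<in>space M. real i / real m \<le> V \<omega>}" for i :: nat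
    have AF: "A i \<in> sets (\<F> {1..n})" for i
    proof -
      have "{\<omega>\<in>space (\<F> {1..n}). real i / real m \<le> U \<omega>} \<in> sets (\<F> {1..n})" using U by measurable
      then show ?thesis by (simp add: A_def space_gen_sigma)
    qed
    have BF: "B i \<in> sets (\<F> {n + int k..})" for i
    proof -
      have "{\<omega>\<in>space (\<F> {n + int k..}). real i / real m \<le> V \<omega>} \<in> sets (\<F> {n + int k..})" using V by measurable
      then show ?thesis by (simp add: B_def space_gen_sigma)
    qed
    have [measurable]: "A i \<in> events" "B i \<in> events" for i by (auto simp: A_def B_def)
    define U' V' where "U' \<omega> = (\<Sum>i=1..m. indicator {x. real i / real m \<le> x} (U \<omega>)) / real m"
      and "V' \<omega> = (\<Sum>i=1..m. indicator {x. real i / real m \<le> x} (V \<omega>)) / real m" for \<omega>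
    have [measurable]: "U' \<in> borel_measurable M" "V' \<in> borel_measurable M" unfolding U'_def[abs_def] V'_def[abs_def] by measurable
    have near: "\<bar>U \<omega> - U' \<omega>\<bar> \<le> 1 / real m" "\<bar>V \<omega> - V' \<omega>\<bar> \<le> 1 / real m" for \<omega>
      unfolding U'_def V'_def by (intro indicator_average_approx U01 V01 m)+
    have U'01: "0 \<le> U' \<omega>" "U' \<omega> \<le> 1" "0 \<le> V' \<omega>" "V' \<omega> \<le> 1" for \<omega>
    proof -
      have "(\<Sum>i=1..m. indicator {x. real i / real m \<le> x} (W \<omega>)) \<le> (\<Sum>i=1..m. 1 :: real)" for W :: "'a \<Rightarrow> real"
        by (intro sum_mono) (auto simp: indicator_def)
      then show "U' \<omega> \<le> 1" "V' \<omega> \<le> 1" using m by (auto simp: U'_def V'_def divide_le_eq)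
    qed (auto simp: U'_def V'_def intro!: divide_nonneg_nonneg sum_nonneg)
    have int: "integrable M U" "integrable M V" "integrable M U'" "integrable M V'"
      by (rule integrable_bounded[where B=1]; use U01 V01 U'01 in auto)+
    have int2: "integrable M (\<lambda>\<omega>. U \<omega> * V \<omega>)" "integrable M (\<lambda>\<omega>. U' \<omega> * V' \<omega>)"
      by (rule integrable_bounded[where B=1]; simp add: abs_mult mult_le_one U01 V01 U'01)+
    have diff_mult: "\<bar>u * v - u' * v'\<bar> \<le> 2 / real m" if "\<bar>u - u'\<bar> \<le> 1 / real m" "\<bar>v - v'\<bar> \<le> 1 / real m"
      "0 \<le> v" "v \<le> 1" "0 \<le> u'" "u' \<le> 1" for u v u' v' :: real
    proof -
      have "u * v - u' * v' = (u - u') * v + u' * (v - v')" by (simp add: algebra_simps)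
      moreover have "\<bar>(u - u') * v\<bar> \<le> 1 / real m * 1" unfolding abs_mult using that by (intro mult_mono) auto
      moreover have "\<bar>u' * (v - v')\<bar> \<le> 1 * (1 / real m)" unfolding abs_mult using that by (intro mult_mono) auto
      ultimately show ?thesis by simp
    qed
    have e01: "0 \<le> expectation W" "expectation W \<le> 1" if "integrable M W" "\<And>\<omega>. 0 \<le> W \<omega>" "\<And>\<omega>. W \<omega> \<le> 1" for W :: "'a \<Rightarrow> real"
      using that integral_le_const[OF that(1), of 1] by auto
    have near_E: "\<bar>expectation W - expectation W'\<bar> \<le> c" if "integrable M W" "integrable M W'" "\<And>\<omega>. \<bar>W \<omega> - W' \<omega>\<bar> \<le> c" for W W' :: "'a \<Rightarrow> real" and c
    proof -
      have "\<bar>expectation W - expectation W'\<bar> = \<bar>expectation (\<lambda>\<omega>. W \<omega> - W' \<omega>)\<bar>" using that by simp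
      also have "\<dots> \<le> expectation (\<lambda>\<omega>. \<bar>W \<omega> - W' \<omega>\<bar>)" by (rule integral_abs_bound)
      also have "\<dots> \<le> c" by (rule integral_le_const) (use that in auto)
      finally show ?thesis .
    qed
    have 1: "\<bar>expectation (\<lambda>\<omega>. U \<omega> * V \<omega>) - expectation (\<lambda>\<omega>. U' \<omega> * V' \<omega>)\<bar> \<le> 2 / real m"
      by (rule near_E[OF int2]) (use diff_mult near V01 U'01 in auto)
    have 2: "\<bar>expectation U * expectation V - expectation U' * expectation V'\<bar> \<le> 2 / real m"
      by (rule diff_mult) (use near_E near int e01 V01 U'01 in auto)
    have EU': "expectation U' = (\<Sum>i=1..m. prob (A i)) / real m"
    proof -
      have "expectation U' = expectation (\<lambda>\<omega>. (\<Sum>i=1..m. indicator (A i) \<omega>) / real m)"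
        by (rule Bochner_Integration.integral_cong) (auto simp: U'_def A_def indicator_def)
      also have "\<dots> = (\<Sum>i=1..m. prob (A i)) / real m"
        by (simp add: integrable_bounded[where B=1])
      finally show ?thesis .
    qed
    have EV': "expectation V' = (\<Sum>i=1..m. prob (B i)) / real m"
    proof -
      have "expectation V' = expectation (\<lambda>\<omega>. (\<Sum>i=1..m. indicator (B i) \<omega>) / real m)"
        by (rule Bochner_Integration.integral_cong) (auto simp: V'_def B_def indicator_def)
      also have "\<dots> = (\<Sum>i=1..m. prob (B i)) / real m"
        by (simp add: integrable_bounded[where B=1])
      finally show ?thesis .
    qed
    have EUV': "expectation (\<lambda>\<omega>. U' \<omega> * V' \<omega>) = (\<Sum>i=1..m. \<Sum>j=1..m. prob (A i \<inter> B j)) / (real m * real m)"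
    proof -
      have "expectation (\<lambda>\<omega>. U' \<omega> * V' \<omega>) = expectation (\<lambda>\<omega>. (\<Sum>i=1..m. \<Sum>j=1..m. indicator (A i \<inter> B j) \<omega>) / (real m * real m))"
      proof (rule Bochner_Integration.integral_cong[OF refl])
        fix \<omega> assume "\<omega> \<in> space M"
        then have "indicator {x. real i / real m \<le> x} (U \<omega>) * indicator {x. real j / real m \<le> x} (V \<omega>) = (indicator (A i \<inter> B j) \<omega> :: real)" for i j :: nat
          by (auto simp: A_def B_def indicator_def)
        then show "U' \<omega> * V' \<omega> = (\<Sum>i=1..m. \<Sum>j=1..m. indicator (A i \<inter> B j) \<omega>) / (real m * real m)"
          unfolding U'_def V'_def times_divide_times_eq sum_product by simp
      qed
      also have "\<dots> = (\<Sum>i=1..m. \<Sum>j=1..m. prob (A i \<inter> B j)) / (real m * real m)"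
        by (simp add: integrable_bounded[where B=1])
      finally show ?thesis .
    qed
    have "\<bar>expectation (\<lambda>\<omega>. U' \<omega> * V' \<omega>) - expectation U' * expectation V'\<bar>
        = \<bar>\<Sum>i=1..m. \<Sum>j=1..m. prob (A i \<inter> B j) - prob (A i) * prob (B j)\<bar> / (real m * real m)"
      unfolding EU' EV' EUV' times_divide_times_eq sum_product diff_divide_distrib[symmetric] sum_subtractf[symmetric]
      using m by simp
    also have "\<dots> \<le> (\<Sum>i=1..m. \<Sum>j=1..m. \<alpha> k) / (real m * real m)"
      by (intro divide_right_mono order_trans[OF sum_abs] sum_mono mixing_coeff_ge[OF AF BF]) auto
    also have "\<dots> = \<alpha> k" using m by simp
    finally show ?thesis using 1 2 by linarith
  qed
  show ?thesis
  proof (rule LIMSEQ_le_const)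
    show "(\<lambda>m. \<alpha> k + 4 / real m) \<longlonglongrightarrow> \<alpha> k"
      using tendsto_add[OF tendsto_const[of "\<alpha> k"] lim_const_over_n[of "4::real"]] by simp
    show "\<exists>N. \<forall>m\<ge>N. \<bar>expectation (\<lambda>\<omega>. U \<omega> * V \<omega>) - expectation U * expectation V\<bar> \<le> \<alpha> k + 4 / real m"
      using main by (intro exI[of _ 1]) auto
  qed
qed

text \<open>The affine map \<open>(u + 1) / 2\<close> sends \<open>[-1, 1]\<close> to
  \<open>[0, 1]\<close> and divides covariances by 4.\<close>

lemma cov_bounded:
  assumes U: "U \<in> borel_measurable (\<F> {1..n})" and V: "V \<in> borel_measurable (\<F> {n + int k..})"
    and U1: "\<And>\<omega>. \<bar>U \<omega>\<bar> \<le> (1::real)" and V1: "\<And>\<omega>. \<bar>V \<omega>\<bar> \<le> (1::real)"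
  shows "\<bar>expectation (\<lambda>\<omega>. U \<omega> * V \<omega>) - expectation U * expectation V\<bar> \<le> 4 * \<alpha> k"
proof -
  have [measurable]: "U \<in> borel_measurable M" "V \<in> borel_measurable M"
    by (rule measurable_of_gen_sigma[OF U] measurable_of_gen_sigma[OF V])+
  have int: "integrable M U" "integrable M V" "integrable M (\<lambda>\<omega>. U \<omega> * V \<omega>)"
    by (rule integrable_bounded[where B=1]; simp add: abs_mult mult_le_one U1 V1)+
  have "\<bar>expectation (\<lambda>\<omega>. ((U \<omega> + 1) / 2) * ((V \<omega> + 1) / 2)) - expectation (\<lambda>\<omega>. (U \<omega> + 1) / 2) * expectation (\<lambda>\<omega>. (V \<omega> + 1) / 2)\<bar> \<le> \<alpha> k"
  proof (rule cov_unit_interval)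
    show "(\<lambda>\<omega>. (U \<omega> + 1) / 2) \<in> borel_measurable (\<F> {1..n})" "(\<lambda>\<omega>. (V \<omega> + 1) / 2) \<in> borel_measurable (\<F> {n + int k..})"
      using U V by measurable
    show "0 \<le> (U \<omega> + 1) / 2" "(U \<omega> + 1) / 2 \<le> 1" for \<omega> using U1[of \<omega>] by (auto simp: abs_le_iff)
    show "0 \<le> (V \<omega> + 1) / 2" "(V \<omega> + 1) / 2 \<le> 1" for \<omega> using V1[of \<omega>] by (auto simp: abs_le_iff)
  qed
  also have "expectation (\<lambda>\<omega>. ((U \<omega> + 1) / 2) * ((V \<omega> + 1) / 2)) = (expectation (\<lambda>\<omega>. U \<omega> * V \<omega>) + expectation U + expectation V + 1) / 4"
  proof -
    have "(\<lambda>\<omega>. ((U \<omega> + 1) / 2) * ((V \<omega> + 1) / 2)) = (\<lambda>\<omega>. (U \<omega> * V \<omega> + U \<omega> + V \<omega> + 1) / 4)"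
      by (auto simp: field_simps)
    then show ?thesis using int by (simp add: prob_space)
  qed
  also have "expectation (\<lambda>\<omega>. (U \<omega> + 1) / 2) = (expectation U + 1) / 2" using int by (simp add: prob_space)
  also have "expectation (\<lambda>\<omega>. (V \<omega> + 1) / 2) = (expectation V + 1) / 2" using int by (simp add: prob_space)
  also have "(expectation (\<lambda>\<omega>. U \<omega> * V \<omega>) + expectation U + expectation V + 1) / 4 - (expectation U + 1) / 2 * ((expectation V + 1) / 2)
      = (expectation (\<lambda>\<omega>. U \<omega> * V \<omega>) - expectation U * expectation V) / 4" by (simp add: field_simps)
  finally show ?thesis by simp
qed

text \<open>The real and the imaginary part of the complex covariance each combine two real
  covariances, so each is at most \<open>8 * \<alpha> k\<close> in modulus.\<close>

lemma cov_complex: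
  assumes U: "U \<in> borel_measurable (\<F> {1..n})" and V: "V \<in> borel_measurable (\<F> {n + int k..})"
    and U1: "\<And>\<omega>. cmod (U \<omega>) \<le> 1" and V1: "\<And>\<omega>. cmod (V \<omega>) \<le> 1"
  shows "cmod (expectation (\<lambda>\<omega>. U \<omega> * V \<omega>) - expectation U * expectation V) \<le> 16 * \<alpha> k"
proof -
  have [measurable]: "U \<in> borel_measurable M" "V \<in> borel_measurable M"
    by (rule measurable_of_gen_sigma[OF U] measurable_of_gen_sigma[OF V])+
  have int: "integrable M U" "integrable M V" "integrable M (\<lambda>\<omega>. U \<omega> * V \<omega>)"
    by (rule integrable_bounded[where B=1]; simp add: norm_mult mult_le_one U1 V1)+
  have b: "\<bar>Re (U \<omega>)\<bar> \<le> 1" "\<bar>Im (U \<omega>)\<bar> \<le> 1" "\<bar>Re (V \<omega>)\<bar> \<le> 1" "\<bar>Im (V \<omega>)\<bar> \<le> 1" for \<omega>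
    using U1[of \<omega>] V1[of \<omega>] abs_Re_le_cmod[of "U \<omega>"] abs_Im_le_cmod[of "U \<omega>"] abs_Re_le_cmod[of "V \<omega>"] abs_Im_le_cmod[of "V \<omega>"] by linarith+
  have m: "(\<lambda>\<omega>. Re (U \<omega>)) \<in> borel_measurable (\<F> {1..n})" "(\<lambda>\<omega>. Im (U \<omega>)) \<in> borel_measurable (\<F> {1..n})"
    "(\<lambda>\<omega>. Re (V \<omega>)) \<in> borel_measurable (\<F> {n + int k..})" "(\<lambda>\<omega>. Im (V \<omega>)) \<in> borel_measurable (\<F> {n + int k..})"
    using U V by measurable
  have intp: "integrable M (\<lambda>\<omega>. f (U \<omega>) * h (V \<omega>))" if "f = Re \<or> f = Im" "h = Re \<or> h = Im" for f h
    by (rule integrable_bounded[where B=1]) (use that b in \<open>auto simp: abs_mult mult_le_one\<close>)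
  let ?C = "\<lambda>f h. expectation (\<lambda>\<omega>. f (U \<omega>) * h (V \<omega>)) - expectation (\<lambda>\<omega>. f (U \<omega>)) * expectation (\<lambda>\<omega>. h (V \<omega>))"
  have C: "\<bar>?C Re Re\<bar> \<le> 4 * \<alpha> k" "\<bar>?C Re Im\<bar> \<le> 4 * \<alpha> k" "\<bar>?C Im Re\<bar> \<le> 4 * \<alpha> k" "\<bar>?C Im Im\<bar> \<le> 4 * \<alpha> k"
    by (rule cov_bounded; use m b in simp)+
  let ?d = "expectation (\<lambda>\<omega>. U \<omega> * V \<omega>) - expectation U * expectation V"
  have E: "Re (expectation U) = expectation (\<lambda>\<omega>. Re (U \<omega>))" "Im (expectation U) = expectation (\<lambda>\<omega>. Im (U \<omega>))"
    "Re (expectation V) = expectation (\<lambda>\<omega>. Re (V \<omega>))" "Im (expectation V) = expectation (\<lambda>\<omega>. Im (V \<omega>))"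
    using int(1,2) by (simp_all only: integral_Re integral_Im)
  have "Re (expectation (\<lambda>\<omega>. U \<omega> * V \<omega>)) = expectation (\<lambda>\<omega>. Re (U \<omega> * V \<omega>))"
    by (rule integral_Re[OF int(3), symmetric])
  also have "\<dots> = expectation (\<lambda>\<omega>. Re (U \<omega>) * Re (V \<omega>)) - expectation (\<lambda>\<omega>. Im (U \<omega>) * Im (V \<omega>))"
    unfolding times_complex.sel by (rule Bochner_Integration.integral_diff; rule intp; simp)
  finally have re: "Re ?d = ?C Re Re - ?C Im Im"
    unfolding minus_complex.sel times_complex.sel E by linarith
  have "Im (expectation (\<lambda>\<omega>. U \<omega> * V \<omega>)) = expectation (\<lambda>\<omega>. Im (U \<omega> * V \<omega>))"
    by (rule integral_Im[OF int(3), symmetric])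
  also have "\<dots> = expectation (\<lambda>\<omega>. Re (U \<omega>) * Im (V \<omega>)) + expectation (\<lambda>\<omega>. Im (U \<omega>) * Re (V \<omega>))"
    unfolding times_complex.sel by (rule Bochner_Integration.integral_add; rule intp; simp)
  finally have im: "Im ?d = ?C Re Im + ?C Im Re"
    unfolding minus_complex.sel times_complex.sel E by linarith
  show ?thesis using re im C cmod_le[of ?d] by linarith
qed

section \<open>Consequences of stationarity\<close>

lemma expectation_shift:
  fixes \<Psi> :: "(int \<Rightarrow> real) \<Rightarrow> 'b::{banach, second_countable_topology}"
  assumes [measurable]: "\<Psi> \<in> borel_measurable (\<Pi>\<^sub>M i\<in>UNIV. borel)"
  shows "expectation (\<lambda>\<omega>. \<Psi> (\<lambda>i. X (i + k) \<omega>)) = expectation (\<lambda>\<omega>. \<Psi> (\<lambda>i. X i \<omega>))"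
proof -
  have m: "(\<lambda>\<omega> i. X (i + k) \<omega>) \<in> measurable M (\<Pi>\<^sub>M i\<in>UNIV. borel)" for k
    by (rule measurable_PiM_single') auto
  have m0: "(\<lambda>\<omega> i. X i \<omega>) \<in> measurable M (\<Pi>\<^sub>M i\<in>UNIV. borel)" using m[of 0] by simp
  have "expectation (\<lambda>\<omega>. \<Psi> (\<lambda>i. X (i + k) \<omega>)) = integral\<^sup>L (distr M (\<Pi>\<^sub>M i\<in>UNIV. borel) (\<lambda>\<omega> i. X (i + k) \<omega>)) \<Psi>"
    by (rule integral_distr[OF m, symmetric]) simp
  also have "\<dots> = integral\<^sup>L (distr M (\<Pi>\<^sub>M i\<in>UNIV. borel) (\<lambda>\<omega> i. X i \<omega>)) \<Psi>"
    using stationary by (simp add: strictly_stationary_def)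
  also have "\<dots> = expectation (\<lambda>\<omega>. \<Psi> (\<lambda>i. X i \<omega>))"
    by (rule integral_distr[OF m0]) simp
  finally show ?thesis .
qed

lemma expectation_block:
  fixes f :: "real \<Rightarrow> 'b::{banach, second_countable_topology}"
  assumes [measurable]: "f \<in> borel_measurable borel" "h \<in> borel_measurable borel"
  shows "expectation (\<lambda>\<omega>. f (\<Sum>r<l. h (X (int (j + r)) \<omega>))) = expectation (\<lambda>\<omega>. f (\<Sum>r<l. h (X (int (1 + r)) \<omega>)))"
proof -
  have "expectation (\<lambda>\<omega>. f (\<Sum>r<l. h (X (int (1 + r) + (int j - 1)) \<omega>))) = expectation (\<lambda>\<omega>. f (\<Sum>r<l. h (X (int (1 + r)) \<omega>)))"
    by (rule expectation_shift[of "\<lambda>z. f (\<Sum>r<l. h (z (int (1 + r))))"]) measurable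
  moreover have "int (1 + r) + (int j - 1) = int (j + r)" for r by simp
  ultimately show ?thesis by (simp only:)
qed

lemma expectation_single:
  fixes h :: "real \<Rightarrow> real"
  assumes [measurable]: "h \<in> borel_measurable borel"
  shows "expectation (\<lambda>\<omega>. h (X (int j) \<omega>)) = expectation (\<lambda>\<omega>. h (X 1 \<omega>))"
proof -
  have "expectation (\<lambda>\<omega>. h (X (1 + (int j - 1)) \<omega>)) = expectation (\<lambda>\<omega>. h (X 1 \<omega>))"
    by (rule expectation_shift[of "\<lambda>z. h (z 1)"]) measurable
  then show ?thesis by (simp only: add.commute[of 1] diff_add_cancel)
qed

text \<open>For fixed \<open>i\<close> the lags to the indices above \<open>i\<close> are distinct,
  and so are those below; each half is bounded by the whole series. This gives linear growth in
  \<open>card I\<close> for index sets of any shape. The sequence \<open>c\<close> is left open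
  because overlapping blocks need another bound than single observations.\<close>

lemma second_moment_sum_le:
  fixes Y :: "nat \<Rightarrow> 'a \<Rightarrow> real"
  assumes "finite I" and int: "\<And>i j. i \<in> I \<Longrightarrow> j \<in> I \<Longrightarrow> integrable M (\<lambda>\<omega>. Y i \<omega> * Y j \<omega>)"
    and c: "\<And>i j. i \<in> I \<Longrightarrow> j \<in> I \<Longrightarrow> i \<le> j \<Longrightarrow> \<bar>expectation (\<lambda>\<omega>. Y i \<omega> * Y j \<omega>)\<bar> \<le> c (j - i)"
    and c0: "\<And>k. 0 \<le> c k" and "summable c"
  shows "expectation (\<lambda>\<omega>. (\<Sum>i\<in>I. Y i \<omega>)\<^sup>2) \<le> real (card I) * (2 * suminf c)"
proof -
  have half: "(\<Sum>j\<in>J. c (d j)) \<le> suminf c" if "finite J" "inj_on d J" for d J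
  proof -
    have "(\<Sum>j\<in>J. c (d j)) = (\<Sum>k\<in>d ` J. c k)" by (rule sum.reindex_cong[OF that(2) refl refl, symmetric])
    also have "\<dots> \<le> suminf c" by (rule sum_le_suminf) (use \<open>summable c\<close> c0 that in auto)
    finally show ?thesis .
  qed
  have "expectation (\<lambda>\<omega>. (\<Sum>i\<in>I. Y i \<omega>)\<^sup>2) = (\<Sum>i\<in>I. \<Sum>j\<in>I. expectation (\<lambda>\<omega>. Y i \<omega> * Y j \<omega>))"
    unfolding power2_eq_square sum_product by (simp add: int)
  also have "\<dots> \<le> (\<Sum>i\<in>I. 2 * suminf c)"
  proof (rule sum_mono)
    fix i assume i: "i \<in> I"
    have "(\<Sum>j\<in>I. expectation (\<lambda>\<omega>. Y i \<omega> * Y j \<omega>)) = (\<Sum>j\<in>{j\<in>I. i \<le> j}. expectation (\<lambda>\<omega>. Y i \<omega> * Y j \<omega>)) + (\<Sum>j\<in>{j\<in>I. j < i}. expectation (\<lambda>\<omega>. Y i \<omega> * Y j \<omega>))"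
      using \<open>finite I\<close> by (subst sum.union_disjoint[symmetric]) (auto intro!: sum.cong)
    also have "\<dots> \<le> (\<Sum>j\<in>{j\<in>I. i \<le> j}. c (j - i)) + (\<Sum>j\<in>{j\<in>I. j < i}. c (i - j))"
    proof (intro add_mono sum_mono)
      fix j assume "j \<in> {j\<in>I. i \<le> j}"
      then show "expectation (\<lambda>\<omega>. Y i \<omega> * Y j \<omega>) \<le> c (j - i)" using c[of i j] i by auto
    next
      fix j assume "j \<in> {j\<in>I. j < i}"
      then show "expectation (\<lambda>\<omega>. Y i \<omega> * Y j \<omega>) \<le> c (i - j)" using c[of j i] i by (auto simp: mult.commute)
    qed
    also have "\<dots> \<le> suminf c + suminf c"
      by (intro add_mono half) (use \<open>finite I\<close> in \<open>auto simp: inj_on_def\<close>)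
    finally show "(\<Sum>j\<in>I. expectation (\<lambda>\<omega>. Y i \<omega> * Y j \<omega>)) \<le> 2 * suminf c" by simp
  qed
  finally show ?thesis by simp
qed

text \<open>Variance constant for centred functions bounded by 1 whose first absolute moment is at
  most \<open>B\<close>: the covariance at lag \<open>k\<close> is bounded by \<open>B\<close> and
  by \<open>4 * \<alpha> k\<close>. As the second bound is summable, \<open>\<gamma> B\<close>
  vanishes with \<open>B\<close>; this gives stochastic equicontinuity of the empirical
  process.\<close>

definition \<gamma> :: "real \<Rightarrow> real" where
  "\<gamma> B = 2 * (\<Sum>k. min B (4 * \<alpha> k))"

lemma summable_min: "0 \<le> B \<Longrightarrow> summable (\<lambda>k. min B (4 * \<alpha> k))"
  by (rule summable_comparison_test'[OF summable_mult[OF summable_alpha, of 4]])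
    (auto simp: mixing_coeff_nonneg)

lemma \<gamma>_nonneg: "0 \<le> B \<Longrightarrow> 0 \<le> \<gamma> B"
  unfolding \<gamma>_def by (intro mult_nonneg_nonneg suminf_nonneg summable_min) (auto simp: mixing_coeff_nonneg)

lemma \<gamma>_tendsto_0:
  assumes "B \<longlonglongrightarrow> 0" "\<And>n. 0 \<le> B n" shows "(\<lambda>n. \<gamma> (B n)) \<longlonglongrightarrow> 0"
proof -
  have "(\<lambda>n. \<Sum>k. min (B n) (4 * \<alpha> k)) \<longlonglongrightarrow> (\<Sum>k. min 0 (4 * \<alpha> k))"
  proof (rule tannerys_theorem[THEN conjunct2, THEN conjunct2])
    show "(\<lambda>n. min (B n) (4 * \<alpha> k)) \<longlonglongrightarrow> min 0 (4 * \<alpha> k)" for k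
      by (intro tendsto_min assms(1) tendsto_const)
    show "\<forall>\<^sub>F (k, n) in at_top \<times>\<^sub>F sequentially. norm (min (B n) (4 * \<alpha> k)) \<le> 4 * \<alpha> k"
      using assms(2) by (intro always_eventually) (auto simp: mixing_coeff_nonneg)
  qed (auto intro: summable_mult summable_alpha)
  then show ?thesis unfolding \<gamma>_def using mixing_coeff_nonneg by (simp add: min_def tendsto_mult_right_zero)
qed

text \<open>Indices start at 1 because the mixing coefficients see the past only back to
  \<open>X 1\<close>. The bound by \<open>B\<close> comes from
  \<open>\<bar>h x\<bar> \<le> 1\<close>, which reduces a product to one of its factors.\<close>

lemma second_moment_le:
  assumes h [measurable]: "h \<in> borel_measurable borel" and h1: "\<And>x. \<bar>h x\<bar> \<le> 1"
    and h0: "expectation (\<lambda>\<omega>. h (X 1 \<omega>)) = 0" and hB: "expectation (\<lambda>\<omega>. \<bar>h (X 1 \<omega>)\<bar>) \<le> B"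
    and I: "finite I" "\<And>i. i \<in> I \<Longrightarrow> 1 \<le> i"
  shows "expectation (\<lambda>\<omega>. (\<Sum>i\<in>I. h (X (int i) \<omega>))\<^sup>2) \<le> real (card I) * \<gamma> B"
  unfolding \<gamma>_def
proof (rule second_moment_sum_le[OF I(1)])
  have "0 \<le> expectation (\<lambda>\<omega>. \<bar>h (X 1 \<omega>)\<bar>)" by simp
  then have B: "0 \<le> B" using hB by linarith
  show "0 \<le> min B (4 * \<alpha> k)" for k using B by (simp add: mixing_coeff_nonneg)
  show "summable (\<lambda>k. min B (4 * \<alpha> k))" by (rule summable_min[OF B])
  fix i j assume ij: "i \<in> I" "j \<in> I"
  show "integrable M (\<lambda>\<omega>. h (X (int i) \<omega>) * h (X (int j) \<omega>))"
    by (rule integrable_bounded[where B=1]) (auto simp: abs_mult mult_le_one h1)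
  assume le: "i \<le> j"
  have "\<bar>expectation (\<lambda>\<omega>. h (X (int i) \<omega>) * h (X (int j) \<omega>)) - expectation (\<lambda>\<omega>. h (X (int i) \<omega>)) * expectation (\<lambda>\<omega>. h (X (int j) \<omega>))\<bar> \<le> 4 * \<alpha> (j - i)"
  proof (rule cov_bounded[where n="int i"])
    have "X (int i) \<in> borel_measurable (\<F> {1..int i})" using I(2)[OF ij(1)] by (intro measurable_gen_sigma) auto
    then show "(\<lambda>\<omega>. h (X (int i) \<omega>)) \<in> borel_measurable (\<F> {1..int i})" by measurable
    have "X (int j) \<in> borel_measurable (\<F> {int i + int (j - i)..})" using le by (intro measurable_gen_sigma) auto
    then show "(\<lambda>\<omega>. h (X (int j) \<omega>)) \<in> borel_measurable (\<F> {int i + int (j - i)..})" by measurable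
  qed (auto simp: h1)
  then have 1: "\<bar>expectation (\<lambda>\<omega>. h (X (int i) \<omega>) * h (X (int j) \<omega>))\<bar> \<le> 4 * \<alpha> (j - i)"
    by (simp add: expectation_single h0)
  have "\<bar>expectation (\<lambda>\<omega>. h (X (int i) \<omega>) * h (X (int j) \<omega>))\<bar> \<le> expectation (\<lambda>\<omega>. \<bar>h (X (int i) \<omega>) * h (X (int j) \<omega>)\<bar>)"
    by (rule integral_abs_bound)
  also have "\<dots> \<le> expectation (\<lambda>\<omega>. \<bar>h (X (int i) \<omega>)\<bar>)"
  proof (rule integral_mono)
    show "integrable M (\<lambda>\<omega>. \<bar>h (X (int i) \<omega>) * h (X (int j) \<omega>)\<bar>)" "integrable M (\<lambda>\<omega>. \<bar>h (X (int i) \<omega>)\<bar>)"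
      by (rule integrable_bounded[where B=1]; auto simp: abs_mult mult_le_one h1)+
    show "\<bar>h (X (int i) \<omega>) * h (X (int j) \<omega>)\<bar> \<le> \<bar>h (X (int i) \<omega>)\<bar>" for \<omega>
      unfolding abs_mult by (rule mult_left_le) (auto simp: h1)
  qed
  also have "\<dots> = expectation (\<lambda>\<omega>. \<bar>h (X 1 \<omega>)\<bar>)" by (rule expectation_single) measurable
  finally show "\<bar>expectation (\<lambda>\<omega>. h (X (int i) \<omega>) * h (X (int j) \<omega>))\<bar> \<le> min B (4 * \<alpha> (j - i))"
    using 1 hB by simp
qed

end

section \<open>The central limit theorem under summable mixing coefficients\<close>

lemma cmod_iexp_diff_le: "cmod (iexp x - iexp y) \<le> \<bar>x - y\<bar>"
proof -
  have "iexp x - iexp y = iexp y * (iexp (x - y) - 1)"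
    by (simp add: right_diff_distrib exp_add[symmetric])
  then have "cmod (iexp x - iexp y) = cmod (iexp (x - y) - 1)" by (simp add: norm_mult)
  also have "\<dots> \<le> \<bar>x - y\<bar>" using iexp_approx1[of "x - y" 0] by simp
  finally show ?thesis .
qed

lemma (in prob_space) expectation_abs_le_sqrt:
  fixes f :: "'a \<Rightarrow> real"
  assumes "integrable M f" "integrable M (\<lambda>\<omega>. (f \<omega>)\<^sup>2)"
  shows "expectation (\<lambda>\<omega>. \<bar>f \<omega>\<bar>) \<le> sqrt (expectation (\<lambda>\<omega>. (f \<omega>)\<^sup>2))"
proof (rule real_le_rsqrt)
  have "variance (\<lambda>\<omega>. \<bar>f \<omega>\<bar>) = expectation (\<lambda>\<omega>. (f \<omega>)\<^sup>2) - (expectation (\<lambda>\<omega>. \<bar>f \<omega>\<bar>))\<^sup>2"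
    by (subst variance_eq) (use assms in auto)
  then show "(expectation (\<lambda>\<omega>. \<bar>f \<omega>\<bar>))\<^sup>2 \<le> expectation (\<lambda>\<omega>. (f \<omega>)\<^sup>2)"
    using variance_positive[of "\<lambda>\<omega>. \<bar>f \<omega>\<bar>"] by simp
qed

context mixing_process
begin

text \<open>The coefficients decrease, so \<open>\<alpha> n\<close> is at most each of
  \<open>n div 2\<close> terms from index \<open>n div 2\<close> on; their sum is bounded by a tail
  of the convergent series.\<close>

lemma mixing_coeff_little_o: "(\<lambda>k. real k * \<alpha> k) \<longlonglongrightarrow> 0"
proof -
  define \<tau> where "\<tau> k = suminf \<alpha> - sum \<alpha> {..<k}" for k
  have "\<tau> \<longlonglongrightarrow> suminf \<alpha> - suminf \<alpha>"
    unfolding \<tau>_def by (intro tendsto_diff tendsto_const summable_LIMSEQ summable_alpha)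
  then have \<tau>: "\<tau> \<longlonglongrightarrow> 0" by simp
  have div2: "filterlim (\<lambda>n::nat. n div 2) at_top at_top"
    unfolding filterlim_at_top eventually_sequentially
  proof (intro allI exI impI)
    fix Z n :: nat assume "2 * Z \<le> n" then show "Z \<le> n div 2" by simp
  qed
  have bound: "real n * \<alpha> n \<le> 2 * \<tau> (n div 2) + \<alpha> n" for n
  proof -
    have "real (n div 2) * \<alpha> n = (\<Sum>i\<in>{n div 2..<n div 2 + n div 2}. \<alpha> n)" by simp
    also have "\<dots> \<le> (\<Sum>i\<in>{n div 2..<n div 2 + n div 2}. \<alpha> i)"
      by (intro sum_mono mixing_coeff_antimono) auto
    also have "\<dots> = sum \<alpha> {..<n div 2 + n div 2} - sum \<alpha> {..<n div 2}"
      using sum.atLeastLessThan_concat[of 0 "n div 2" "n div 2 + n div 2" \<alpha>] by (simp add: lessThan_atLeast0)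
    also have "\<dots> \<le> \<tau> (n div 2)"
      unfolding \<tau>_def using sum_le_suminf[OF summable_alpha, of "{..<n div 2 + n div 2}"]
      by (simp add: mixing_coeff_nonneg)
    finally have "real (n div 2) * \<alpha> n \<le> \<tau> (n div 2)" .
    moreover have "real n * \<alpha> n \<le> (2 * real (n div 2) + 1) * \<alpha> n"
      by (intro mult_right_mono mixing_coeff_nonneg) linarith
    ultimately show ?thesis by (simp add: algebra_simps)
  qed
  show ?thesis
  proof (rule tendsto_sandwich[OF _ _ tendsto_const])
    show "(\<lambda>n. 2 * \<tau> (n div 2) + \<alpha> n) \<longlonglongrightarrow> 0"
      using tendsto_add[OF tendsto_mult[OF tendsto_const[of 2] filterlim_compose[OF \<tau> div2]] summable_LIMSEQ_zero[OF summable_alpha]]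
      by simp
  qed (auto intro!: always_eventually bound simp: mixing_coeff_nonneg)
qed

end

text \<open>The function \<open>h\<close> is kept general because the theorem is needed for the
  centred indicator of \<open>{..tp}\<close> and, in \<open>Rn_tp_clt\<close>, for its
  negative.\<close>

locale clt_setup = mixing_process +
  fixes h :: "real \<Rightarrow> real" and v :: real
  assumes h_measurable [measurable]: "h \<in> borel_measurable borel"
    and h_le_1: "\<And>x. \<bar>h x\<bar> \<le> 1"
    and h_mean: "expectation (\<lambda>\<omega>. h (X 1 \<omega>)) = 0"
    and v_pos: "0 < v"
    and v_lim: "(\<lambda>n. expectation (\<lambda>\<omega>. (\<Sum>r<n. h (X (int (1 + r)) \<omega>))\<^sup>2) / real n) \<longlonglongrightarrow> v"
begin

section \<open>Block sums and their moments\<close>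

definition S :: "nat \<Rightarrow> nat \<Rightarrow> 'a \<Rightarrow> real" where
  "S j n \<omega> = (\<Sum>r<n. h (X (int (j + r)) \<omega>))"

lemma S_measurable [measurable]: "S j n \<in> borel_measurable M"
  unfolding S_def[abs_def] by measurable

lemma S_gen_sigma:
  assumes "{int j..<int (j + n)} \<subseteq> I" shows "S j n \<in> borel_measurable (\<F> I)"
  unfolding S_def[abs_def]
proof (rule borel_measurable_sum)
  fix r assume "r \<in> {..<n}"
  then have "int (j + r) \<in> I" using assms by auto
  then have "X (int (j + r)) \<in> borel_measurable (\<F> I)" by (rule measurable_gen_sigma)
  then show "(\<lambda>\<omega>. h (X (int (j + r)) \<omega>)) \<in> borel_measurable (\<F> I)" by measurable
qed

lemma S_abs_le: "\<bar>S j n \<omega>\<bar> \<le> real n"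
proof -
  have "\<bar>S j n \<omega>\<bar> \<le> (\<Sum>r<n. 1)" unfolding S_def by (intro order_trans[OF sum_abs] sum_mono h_le_1)
  then show ?thesis by simp
qed

lemma S_stationary:
  fixes f :: "real \<Rightarrow> 'b::{banach, second_countable_topology}"
  assumes "f \<in> borel_measurable borel"
  shows "expectation (\<lambda>\<omega>. f (S j n \<omega>)) = expectation (\<lambda>\<omega>. f (S 1 n \<omega>))"
  unfolding S_def by (rule expectation_block[OF assms h_measurable])

lemma h_integrable: "integrable M (\<lambda>\<omega>. h (X i \<omega>))"
  by (rule integrable_bounded[where B=1]) (auto simp: h_le_1)

lemma S_integrable: "integrable M (S j n)"
  unfolding S_def[abs_def] by (intro Bochner_Integration.integrable_sum h_integrable)

lemma S2_integrable: "integrable M (\<lambda>\<omega>. (S j n \<omega>)\<^sup>2)"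
proof (rule integrable_bounded[where B="(real n)\<^sup>2"])
  show "norm ((S j n \<omega>)\<^sup>2) \<le> (real n)\<^sup>2" for \<omega>
    using power_mono[OF S_abs_le, of j n \<omega> 2] by simp
qed measurable

lemma S_mean: "expectation (S j n) = 0"
  unfolding S_def[abs_def] by (simp add: h_integrable expectation_single[OF h_measurable, of "_ + _", simplified] h_mean)

lemma h_abs_mean_le: "expectation (\<lambda>\<omega>. \<bar>h (X 1 \<omega>)\<bar>) \<le> 1"
  by (rule integral_le_const) (auto intro!: integrable_abs h_integrable h_le_1)

lemma sum_second_moment:
  assumes "finite I" "\<And>i. i \<in> I \<Longrightarrow> 1 \<le> i"
  shows "expectation (\<lambda>\<omega>. (\<Sum>i\<in>I. h (X (int i) \<omega>))\<^sup>2) \<le> real (card I) * \<gamma> 1"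
  by (rule second_moment_le[OF h_measurable h_le_1 h_mean h_abs_mean_le assms])

lemma S_eq_sum: "S 1 n \<omega> = (\<Sum>i\<in>{1..n}. h (X (int i) \<omega>))"
  unfolding S_def by (rule sum.reindex_bij_witness[of _ "\<lambda>i. i - 1" "\<lambda>r. 1 + r"]) auto

lemma S_second_moment: "expectation (\<lambda>\<omega>. (S 1 n \<omega>)\<^sup>2) \<le> real n * \<gamma> 1"
  unfolding S_eq_sum using sum_second_moment[of "{1..n}"] by simp

text \<open>Splitting off one block as a factor costs a single covariance bound
  \<open>16 * \<alpha> q\<close>. Earlier errors are not enlarged, since a characteristic function
  has modulus at most 1.\<close>

lemma blocks_char:
  assumes "w + q = m"
  shows "cmod (expectation (\<lambda>\<omega>. iexp (t * (\<Sum>j<k. S (1 + j * m) w \<omega>))) - expectation (\<lambda>\<omega>. iexp (t * S 1 w \<omega>)) ^ k)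
    \<le> 16 * real k * \<alpha> q"
proof (induction k)
  case (Suc k)
  let ?U = "\<lambda>\<omega>. iexp (t * (\<Sum>j<k. S (1 + j * m) w \<omega>))" and ?V = "\<lambda>\<omega>. iexp (t * S (1 + k * m) w \<omega>)"
  let ?\<phi> = "expectation (\<lambda>\<omega>. iexp (t * S 1 w \<omega>))"
  \<comment> \<open>The last index of block \<open>k - 1\<close>, as blocks of length
    \<open>m - q\<close> start at \<open>1 + j * m\<close>; the next block starts at
    \<open>?n + q + 1\<close>. For \<open>k = 0\<close> the range \<open>{1..?n}\<close> is
    empty.\<close>
  let ?n = "int (k * m) - int q"
  have \<phi>: "cmod ?\<phi> \<le> 1"
  proof -
    have "cmod ?\<phi> \<le> expectation (\<lambda>\<omega>. cmod (iexp (t * S 1 w \<omega>)))" by (rule integral_norm_bound)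
    then show ?thesis by (simp add: prob_space)
  qed
  have V: "expectation ?V = ?\<phi>" by (rule S_stationary[of "\<lambda>x. iexp (t * x)"]) measurable
  have 1: "cmod (expectation (\<lambda>\<omega>. ?U \<omega> * ?V \<omega>) - expectation ?U * expectation ?V) \<le> 16 * \<alpha> q"
  proof (rule cov_complex[where n="?n"])
    have "(\<lambda>\<omega>. \<Sum>j<k. S (1 + j * m) w \<omega>) \<in> borel_measurable (\<F> {1..?n})"
    proof (intro borel_measurable_sum S_gen_sigma)
      fix j assume "j \<in> {..<k}"
      then have "Suc j * m \<le> k * m" by (intro mult_right_mono) auto
      then show "{int (1 + j * m)..<int (1 + j * m + w)} \<subseteq> {1..?n}" using assms by (auto simp: algebra_simps simp flip: of_nat_mult of_nat_add)
    qed
    then show "?U \<in> borel_measurable (\<F> {1..?n})" by measurable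
    have "S (1 + k * m) w \<in> borel_measurable (\<F> {?n + int q..})" by (rule S_gen_sigma) auto
    then show "?V \<in> borel_measurable (\<F> {?n + int q..})" by measurable
  qed auto
  have UV: "?U \<omega> * ?V \<omega> = iexp (t * (\<Sum>j<Suc k. S (1 + j * m) w \<omega>))" for \<omega>
    by (simp add: distrib_left exp_add algebra_simps)
  have "expectation ?U * ?\<phi> - ?\<phi> ^ Suc k = (expectation ?U - ?\<phi> ^ k) * ?\<phi>" by (simp add: algebra_simps)
  then have "cmod (expectation ?U * ?\<phi> - ?\<phi> ^ Suc k) = cmod (expectation ?U - ?\<phi> ^ k) * cmod ?\<phi>" by (simp only: norm_mult)
  also have "\<dots> \<le> (16 * real k * \<alpha> q) * 1" by (intro mult_mono Suc.IH \<phi>) (auto simp: mixing_coeff_nonneg)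
  finally have 2: "cmod (expectation ?U * ?\<phi> - ?\<phi> ^ Suc k) \<le> 16 * real k * \<alpha> q" by simp
  have "cmod (expectation (\<lambda>\<omega>. ?U \<omega> * ?V \<omega>) - ?\<phi> ^ Suc k)
      \<le> cmod (expectation (\<lambda>\<omega>. ?U \<omega> * ?V \<omega>) - expectation ?U * ?\<phi>) + cmod (expectation ?U * ?\<phi> - ?\<phi> ^ Suc k)"
    using norm_triangle_ineq[of "expectation (\<lambda>\<omega>. ?U \<omega> * ?V \<omega>) - expectation ?U * ?\<phi>" "expectation ?U * ?\<phi> - ?\<phi> ^ Suc k"] by simp
  also have "\<dots> \<le> 16 * \<alpha> q + 16 * real k * \<alpha> q" using 1 2 unfolding V by linarith
  also have "\<dots> = 16 * real (Suc k) * \<alpha> q" by (simp add: algebra_simps)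
  finally show ?case unfolding UV .
qed (simp add: prob_space)

text \<open>The blocks are disjoint, so the remainder is a sum over \<open>n - k * w\<close>
  distinct indices, and the linear variance bound applies to it.\<close>

lemma blocks_remainder:
  assumes "w \<le> m" "k * m \<le> n"
  shows "expectation (\<lambda>\<omega>. \<bar>S 1 n \<omega> - (\<Sum>j<k. S (1 + j * m) w \<omega>)\<bar>) \<le> sqrt (real (n - k * w) * \<gamma> 1)"
proof -
  let ?f = "\<lambda>(j, r). 1 + j * m + r"
  let ?B = "?f ` ({..<k} \<times> {..<w})"
  have inj: "inj_on ?f ({..<k} \<times> {..<w})"
  proof (rule inj_onI, clarsimp)
    fix j r j' r' assume "r < w" "r' < w" "j * m + r = j' * m + r'"
    then have "(j * m + r) div m = (j' * m + r') div m" "(j * m + r) mod m = (j' * m + r') mod m" by simp_all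
    then show "j = j' \<and> r = r'" using \<open>r < w\<close> \<open>r' < w\<close> assms(1) by simp
  qed
  have B: "?B \<subseteq> {1..n}"
  proof clarsimp
    fix j r assume "j < k" "r < w"
    then have "Suc j * m \<le> k * m" by (intro mult_right_mono) auto
    then show "Suc (j * m + r) \<le> n" using assms \<open>r < w\<close> by simp
  qed
  have cardB: "card ?B = k * w" using card_image[OF inj] by (simp add: card_cartesian_product)
  have "(\<Sum>j<k. S (1 + j * m) w \<omega>) = (\<Sum>i\<in>?B. h (X (int i) \<omega>))" for \<omega>
    unfolding S_def sum.reindex[OF inj] by (simp add: sum.cartesian_product comp_def split_beta)
  then have eq: "S 1 n \<omega> - (\<Sum>j<k. S (1 + j * m) w \<omega>) = (\<Sum>i\<in>{1..n} - ?B. h (X (int i) \<omega>))" for \<omega>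
    unfolding S_eq_sum using sum_diff[OF _ B, of "\<lambda>i. h (X (int i) \<omega>)"] by simp
  let ?R = "\<lambda>\<omega>. \<Sum>i\<in>{1..n} - ?B. h (X (int i) \<omega>)"
  have Rb: "\<bar>?R \<omega>\<bar> \<le> real n" for \<omega>
  proof -
    have "\<bar>?R \<omega>\<bar> \<le> (\<Sum>i\<in>{1..n} - ?B. 1)" by (intro order_trans[OF sum_abs] sum_mono h_le_1)
    also have "\<dots> \<le> real n" using card_mono[of "{1..n}" "{1..n} - ?B"] by simp
    finally show ?thesis .
  qed
  have int: "integrable M ?R" by (rule integrable_bounded[where B="real n"]) (use Rb in auto)
  have int2: "integrable M (\<lambda>\<omega>. (?R \<omega>)\<^sup>2)"
    by (rule integrable_bounded[where B="(real n)\<^sup>2"]) (use power_mono[OF Rb, of _ 2] in auto)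
  have "expectation (\<lambda>\<omega>. \<bar>?R \<omega>\<bar>) \<le> sqrt (expectation (\<lambda>\<omega>. (?R \<omega>)\<^sup>2))"
    by (rule expectation_abs_le_sqrt[OF int int2])
  also have "\<dots> \<le> sqrt (real (card ({1..n} - ?B)) * \<gamma> 1)"
    by (intro real_sqrt_le_mono sum_second_moment) auto
  also have "card ({1..n} - ?B) = n - k * w" using card_Diff_subset[OF _ B] cardB by simp
  finally show ?thesis unfolding eq .
qed

text \<open>Bernstein's method: blocks of length \<open>m - q\<close> separated by gaps of length \<open>q\<close>. The four terms of
  the bound are due to deleting the gaps, decoupling the blocks, the Taylor expansion of the
  characteristic function of a block, and the variance of a block.\<close>

lemma clt_bound:
  fixes u \<theta> :: real
  assumes n: "1 \<le> n" and m: "1 \<le> m" "real m \<le> \<theta> * sqrt (real n)" and \<theta>: "0 < \<theta>" "\<theta> \<le> 1 / 2"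
    and q: "real q \<le> \<theta> * real m"
  defines "A \<equiv> u\<^sup>2 * \<gamma> 1 / v" and "s2 \<equiv> expectation (\<lambda>\<omega>. (S 1 (m - q) \<omega>)\<^sup>2)"
  shows "cmod (expectation (\<lambda>\<omega>. iexp (u / sqrt (v * real n) * S 1 n \<omega>)) - exp (- u\<^sup>2 / 2))
    \<le> \<bar>u\<bar> / sqrt v * sqrt ((real m / real n + \<theta>) * \<gamma> 1) + 16 * (real n / real m * \<alpha> q)
      + (A * (\<bar>u\<bar> / sqrt v * \<theta>) + A\<^sup>2 * (real m / real n))
      + u\<^sup>2 * (\<bar>s2 / real (m - q) / v - 1\<bar> + (real m / real n + \<theta>))"
proof -
  define w k t where "w = m - q" and "k = n div m" and "t = u / sqrt (v * real n)"
  have \<gamma>: "0 \<le> \<gamma> 1" by (rule \<gamma>_nonneg) simp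
  have t2: "t\<^sup>2 = u\<^sup>2 / (v * real n)" using v_pos by (simp add: t_def power_divide)
  have abst: "\<bar>t\<bar> = \<bar>u\<bar> / sqrt v / sqrt (real n)" using v_pos by (simp add: t_def real_sqrt_mult)
  have A: "0 \<le> A" using \<gamma> v_pos by (simp add: A_def)
  have "real q \<le> 1 / 2 * real m" using q \<theta> m by (meson mult_right_mono of_nat_0_le_iff order_trans)
  then have qm: "q < m" using m(1) by linarith
  then have w: "1 \<le> w" "w \<le> m" "w + q = m" by (auto simp: w_def)
  have km: "k * m \<le> n" by (simp add: k_def)
  have kmr: "real k * real m \<le> real n" using km by (simp flip: of_nat_mult)
  have kn: "real k \<le> real n / real m" using kmr m by (simp add: le_divide_eq)
  \<comment> \<open>The indices outside the blocks are \<open>k\<close> gaps of length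
    \<open>q\<close>, together at most \<open>\<theta> * n\<close>, and an incomplete last stretch
    shorter than \<open>m\<close>.\<close>
  have rem: "real (n - k * w) \<le> real n * (real m / real n + \<theta>)" and kw: "k * w \<le> n"
  proof -
    have "n = k * m + n mod m" by (simp add: k_def)
    moreover have "n mod m < m" using m by simp
    ultimately have "n \<le> k * m + m" by linarith
    moreover have "k * m = k * w + k * q" using w(3) by (simp flip: distrib_left)
    ultimately have 1: "n \<le> k * w + k * q + m" "k * w \<le> n" using km by linarith+
    have "real k * real q \<le> real k * (\<theta> * real m)" using q by (intro mult_left_mono) auto
    also have "\<dots> = \<theta> * (real k * real m)" by simp
    also have "\<dots> \<le> \<theta> * real n" using kmr \<theta> by (intro mult_left_mono) auto
    finally have "real (k * q) \<le> \<theta> * real n" by simp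
    moreover have "real (n - k * w) \<le> real (k * q) + real m" using 1 by linarith
    ultimately show "real (n - k * w) \<le> real n * (real m / real n + \<theta>)" using n by (simp add: distrib_left mult.commute)
    show "k * w \<le> n" by fact
  qed
  have s2: "0 \<le> s2" "s2 \<le> real m * \<gamma> 1"
  proof -
    show "0 \<le> s2" by (simp add: s2_def)
    have "s2 \<le> real w * \<gamma> 1" unfolding s2_def w_def by (rule S_second_moment)
    also have "\<dots> \<le> real m * \<gamma> 1" using w \<gamma> by (intro mult_right_mono) auto
    finally show "s2 \<le> real m * \<gamma> 1" .
  qed
  have kts: "real k * t\<^sup>2 * s2 \<le> A"
  proof -
    have "real k * t\<^sup>2 * s2 \<le> real k * t\<^sup>2 * (real m * \<gamma> 1)" using s2 by (intro mult_left_mono) auto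
    also have "\<dots> = (real k * real m) * (t\<^sup>2 * \<gamma> 1)" by simp
    also have "\<dots> \<le> real n * (t\<^sup>2 * \<gamma> 1)" using kmr \<gamma> by (intro mult_right_mono) auto
    also have "\<dots> = A" using n by (simp add: t2 A_def)
    finally show ?thesis .
  qed
  let ?\<Sigma> = "\<lambda>\<omega>. \<Sum>j<k. S (1 + j * m) w \<omega>"
  let ?\<phi> = "expectation (\<lambda>\<omega>. iexp (t * S 1 w \<omega>))"
  have int: "integrable M (\<lambda>\<omega>. iexp (t * f \<omega>))" if "f \<in> borel_measurable M" for f
    by (rule integrable_bounded[where B=1]) (use that in auto)
  have int1: "integrable M (\<lambda>\<omega>. iexp (t * S 1 n \<omega>))" by (rule int) measurable
  have int2: "integrable M (\<lambda>\<omega>. iexp (t * ?\<Sigma> \<omega>))" by (rule int) measurable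
  have "cmod (expectation (\<lambda>\<omega>. iexp (t * S 1 n \<omega>)) - expectation (\<lambda>\<omega>. iexp (t * ?\<Sigma> \<omega>)))
      = cmod (expectation (\<lambda>\<omega>. iexp (t * S 1 n \<omega>) - iexp (t * ?\<Sigma> \<omega>)))"
    by (simp only: Bochner_Integration.integral_diff[OF int1 int2])
  also have "\<dots> \<le> expectation (\<lambda>\<omega>. cmod (iexp (t * S 1 n \<omega>) - iexp (t * ?\<Sigma> \<omega>)))"
    by (rule integral_norm_bound)
  also have "\<dots> \<le> expectation (\<lambda>\<omega>. \<bar>t\<bar> * \<bar>S 1 n \<omega> - ?\<Sigma> \<omega>\<bar>)"
  proof (rule integral_mono)
    show "integrable M (\<lambda>\<omega>. cmod (iexp (t * S 1 n \<omega>) - iexp (t * ?\<Sigma> \<omega>)))"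
      by (intro integrable_norm Bochner_Integration.integrable_diff int1 int2)
    show "integrable M (\<lambda>\<omega>. \<bar>t\<bar> * \<bar>S 1 n \<omega> - ?\<Sigma> \<omega>\<bar>)"
      by (intro integrable_mult_right integrable_abs Bochner_Integration.integrable_diff Bochner_Integration.integrable_sum S_integrable)
    show "cmod (iexp (t * S 1 n \<omega>) - iexp (t * ?\<Sigma> \<omega>)) \<le> \<bar>t\<bar> * \<bar>S 1 n \<omega> - ?\<Sigma> \<omega>\<bar>" for \<omega>
      using cmod_iexp_diff_le[of "t * S 1 n \<omega>" "t * ?\<Sigma> \<omega>"] by (simp only: right_diff_distrib[symmetric] abs_mult)
  qed
  also have "\<dots> = \<bar>t\<bar> * expectation (\<lambda>\<omega>. \<bar>S 1 n \<omega> - ?\<Sigma> \<omega>\<bar>)" by simp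
  also have "\<dots> \<le> \<bar>t\<bar> * sqrt (real (n - k * w) * \<gamma> 1)"
    by (intro mult_left_mono blocks_remainder[OF w(2) km]) simp
  also have "\<dots> \<le> \<bar>t\<bar> * sqrt (real n * (real m / real n + \<theta>) * \<gamma> 1)"
    using rem \<gamma> by (intro mult_left_mono real_sqrt_le_mono mult_right_mono) auto
  also have "\<dots> = \<bar>u\<bar> / sqrt v * sqrt ((real m / real n + \<theta>) * \<gamma> 1)"
    using n by (simp add: abst real_sqrt_mult)
  finally have R1: "cmod (expectation (\<lambda>\<omega>. iexp (t * S 1 n \<omega>)) - expectation (\<lambda>\<omega>. iexp (t * ?\<Sigma> \<omega>)))
      \<le> \<bar>u\<bar> / sqrt v * sqrt ((real m / real n + \<theta>) * \<gamma> 1)" .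
  have "cmod (expectation (\<lambda>\<omega>. iexp (t * ?\<Sigma> \<omega>)) - ?\<phi> ^ k) \<le> 16 * real k * \<alpha> q" by (rule blocks_char[OF w(3)])
  also have "\<dots> \<le> 16 * (real n / real m) * \<alpha> q"
    using kn by (intro mult_right_mono mult_left_mono mixing_coeff_nonneg) auto
  finally have R2: "cmod (expectation (\<lambda>\<omega>. iexp (t * ?\<Sigma> \<omega>)) - ?\<phi> ^ k) \<le> 16 * (real n / real m * \<alpha> q)" by simp
  \<comment> \<open>A block sum is at most \<open>m\<close> in modulus, so at the truncation level
    \<open>m\<close> the Lindeberg term is exactly zero.\<close>
  have L0: "expectation (\<lambda>\<omega>. (S 1 w \<omega>)\<^sup>2 * indicator {x. real m < \<bar>x\<bar>} (S 1 w \<omega>)) = 0"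
  proof -
    have "\<bar>S 1 w \<omega>\<bar> \<le> real m" for \<omega> using S_abs_le[of 1 w \<omega>] w by simp
    then have "(S 1 w \<omega>)\<^sup>2 * indicator {x. real m < \<bar>x\<bar>} (S 1 w \<omega>) = 0" for \<omega> by (simp add: indicator_def not_less)
    then show ?thesis by (simp only: Bochner_Integration.integral_zero)
  qed
  have ch: "char (distr M borel (S 1 w)) t = ?\<phi>" by (simp add: char_def integral_distr)
  have "cmod (?\<phi> ^ k - exp (- (real k * t\<^sup>2 * s2 / 2))) \<le> real k * t\<^sup>2 * (0 + \<bar>t\<bar> * real m * s2 / 6) + real k * t ^ 4 * s2\<^sup>2 / 8"
    using char_power_bound[OF S_measurable S2_integrable S_mean, of "real m" 1 w t k] unfolding L0 ch
    by (simp add: s2_def w_def)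
  also have "\<dots> = (real k * t\<^sup>2 * s2) * (\<bar>t\<bar> * real m / 6) + (real k * t\<^sup>2 * s2) * (t\<^sup>2 * s2 / 8)"
    by (simp add: power2_eq_square power4_eq_xxxx mult_ac)
  also have "\<dots> \<le> A * (\<bar>u\<bar> / sqrt v * \<theta>) + A * (A * (real m / real n))"
  proof (intro add_mono mult_mono kts)
    have "\<bar>t\<bar> * real m / 6 \<le> \<bar>t\<bar> * real m" by simp
    also have "\<dots> \<le> \<bar>t\<bar> * (\<theta> * sqrt (real n))" using m by (intro mult_left_mono) auto
    also have "\<dots> = \<bar>u\<bar> / sqrt v * \<theta>" using n by (simp add: abst)
    finally show "\<bar>t\<bar> * real m / 6 \<le> \<bar>u\<bar> / sqrt v * \<theta>" .
    have "t\<^sup>2 * s2 / 8 \<le> t\<^sup>2 * s2" using s2 by simp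
    also have "\<dots> \<le> t\<^sup>2 * (real m * \<gamma> 1)" using s2 by (intro mult_left_mono) auto
    also have "\<dots> = A * (real m / real n)" by (simp add: t2 A_def)
    finally show "t\<^sup>2 * s2 / 8 \<le> A * (real m / real n)" .
  qed (use A s2 in auto)
  finally have R3: "cmod (?\<phi> ^ k - of_real (exp (- (real k * t\<^sup>2 * s2 / 2)))) \<le> A * (\<bar>u\<bar> / sqrt v * \<theta>) + A\<^sup>2 * (real m / real n)"
    by (simp add: power2_eq_square mult.assoc)
  have R4: "cmod (of_real (exp (- (real k * t\<^sup>2 * s2 / 2))) - of_real (exp (- (u\<^sup>2 / 2))))
      \<le> u\<^sup>2 * (\<bar>s2 / real w / v - 1\<bar> + (real m / real n + \<theta>))"
  proof -
    \<comment> \<open>\<open>\<kappa>\<close> is the proportion of indices covered by blocks, which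
      misses 1 by at most \<open>m / n + \<theta>\<close>; \<open>\<zeta>\<close> is the normalised
      variance of one block.\<close>
    define \<kappa> \<zeta> where "\<kappa> = real (k * w) / real n" and "\<zeta> = s2 / real w / v"
    have "1 - \<kappa> = real (n - k * w) / real n" using n kw by (simp add: \<kappa>_def diff_divide_distrib)
    also have "\<dots> \<le> real m / real n + \<theta>" using rem n by (simp add: divide_le_eq mult.commute)
    finally have \<kappa>: "1 - \<kappa> \<le> real m / real n + \<theta>" .
    have \<kappa>01: "0 \<le> \<kappa>" "\<kappa> \<le> 1" using kw n by (auto simp: \<kappa>_def divide_le_eq simp flip: of_nat_mult)
    have eq: "real k * t\<^sup>2 * s2 = u\<^sup>2 * (\<kappa> * \<zeta>)" using w n v_pos by (simp add: t2 \<kappa>_def \<zeta>_def mult_ac)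
    have "cmod (of_real (exp (- (real k * t\<^sup>2 * s2 / 2))) - of_real (exp (- (u\<^sup>2 / 2))))
        = \<bar>exp (- (real k * t\<^sup>2 * s2 / 2)) - exp (- (u\<^sup>2 / 2))\<bar>"
      by (simp only: of_real_diff[symmetric] norm_of_real real_norm_def)
    also have "\<dots> \<le> \<bar>real k * t\<^sup>2 * s2 / 2 - u\<^sup>2 / 2\<bar>"
      by (rule abs_exp_minus_diff_le) (use s2 in auto)
    also have "real k * t\<^sup>2 * s2 / 2 - u\<^sup>2 / 2 = u\<^sup>2 / 2 * (\<kappa> * \<zeta> - 1)" unfolding eq by (simp add: field_simps)
    also have "\<bar>u\<^sup>2 / 2 * (\<kappa> * \<zeta> - 1)\<bar> = u\<^sup>2 / 2 * \<bar>\<kappa> * \<zeta> - 1\<bar>" by (simp add: abs_mult)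
    also have "\<dots> \<le> u\<^sup>2 * \<bar>\<kappa> * \<zeta> - 1\<bar>" by (intro mult_right_mono) auto
    also have "\<dots> \<le> u\<^sup>2 * (\<bar>\<zeta> - 1\<bar> + (real m / real n + \<theta>))"
    proof (rule mult_left_mono)
      have "\<kappa> * \<zeta> - 1 = \<kappa> * (\<zeta> - 1) - (1 - \<kappa>)" by (simp add: algebra_simps)
      then have "\<bar>\<kappa> * \<zeta> - 1\<bar> \<le> \<bar>\<kappa> * (\<zeta> - 1)\<bar> + \<bar>1 - \<kappa>\<bar>" by linarith
      also have "\<bar>\<kappa> * (\<zeta> - 1)\<bar> \<le> \<bar>\<zeta> - 1\<bar>" unfolding abs_mult using \<kappa>01 by (intro mult_left_le_one_le) auto
      finally show "\<bar>\<kappa> * \<zeta> - 1\<bar> \<le> \<bar>\<zeta> - 1\<bar> + (real m / real n + \<theta>)" using \<kappa> \<kappa>01 by linarith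
    qed simp
    finally show ?thesis by (simp add: \<zeta>_def)
  qed
  let ?a = "expectation (\<lambda>\<omega>. iexp (t * S 1 n \<omega>))" and ?b = "expectation (\<lambda>\<omega>. iexp (t * ?\<Sigma> \<omega>))"
  let ?c = "?\<phi> ^ k" and ?d = "of_real (exp (- (real k * t\<^sup>2 * s2 / 2))) :: complex" and ?e = "of_real (exp (- (u\<^sup>2 / 2))) :: complex"
  have "cmod (?a - ?e) \<le> cmod (?a - ?b) + cmod (?b - ?c) + cmod (?c - ?d) + cmod (?d - ?e)"
    using norm_triangle_ineq[of "?a - ?b" "?b - ?e"] norm_triangle_ineq[of "?b - ?c" "?c - ?e"] norm_triangle_ineq[of "?c - ?d" "?d - ?e"]
    by (simp only: diff_add_cancel add_diff_cancel diff_add_eq_diff_diff_swap add_diff_eq)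
  then show ?thesis using R1 R2 R3 R4 unfolding w_def t_def by (simp only: minus_divide_left)
qed

text \<open>Two limits in succession: for fixed \<open>\<theta>\<close> the bound of
  \<open>clt_bound\<close> tends to \<open>L \<theta>\<close> as \<open>n\<close> grows, and
  \<open>L \<theta>\<close> tends to 0 with \<open>\<theta>\<close>.\<close>

theorem clt: "weak_conv_m (\<lambda>n. distr M borel (\<lambda>\<omega>. S 1 n \<omega> / sqrt (v * real n))) std_normal_distribution"
proof (rule levy_continuity[OF _ real_dist_normal_dist])
  fix u :: real
  define A where "A = u\<^sup>2 * \<gamma> 1 / v"
  define L where "L \<theta> = \<bar>u\<bar> / sqrt v * sqrt ((0 + \<theta>) * \<gamma> 1) + 16 * 0 + (A * (\<bar>u\<bar> / sqrt v * \<theta>) + A\<^sup>2 * 0)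
      + u\<^sup>2 * (\<bar>v / v - 1\<bar> + (0 + \<theta>))" for \<theta>
  let ?\<phi> = "\<lambda>n. expectation (\<lambda>\<omega>. iexp (u / sqrt (v * real n) * S 1 n \<omega>))"
  have small: "eventually (\<lambda>n. cmod (?\<phi> n - exp (- u\<^sup>2 / 2)) < e) sequentially"
    if \<theta>: "0 < \<theta>" "\<theta> \<le> 1 / 2" and e: "L \<theta> < e" for \<theta> e
  proof -
    define m q where "m n = nat \<lfloor>\<theta> * sqrt (real n)\<rfloor>" and "q n = nat \<lfloor>\<theta> * real (m n)\<rfloor>" for n
    have m_le: "real (m n) \<le> \<theta> * sqrt (real n)" for n using \<theta> by (simp add: m_def of_nat_floor)
    have m_gt: "\<theta> * sqrt (real n) < real (m n) + 1" for n unfolding m_def by linarith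
    have q_le: "real (q n) \<le> \<theta> * real (m n)" for n using \<theta> by (simp add: q_def of_nat_floor)
    have q_gt: "\<theta> * real (m n) < real (q n) + 1" for n unfolding q_def by linarith
    have sq: "filterlim (\<lambda>n. \<theta> * sqrt (real n)) at_top sequentially"
      by (intro filterlim_tendsto_pos_mult_at_top[OF tendsto_const \<theta>(1)]
          filterlim_compose[OF sqrt_at_top filterlim_real_sequentially])
    have m_inf: "filterlim m at_top sequentially"
      unfolding m_def by (intro filterlim_compose[OF filterlim_nat_sequentially] filterlim_compose[OF filterlim_floor_sequentially] sq)
    have m_real: "filterlim (\<lambda>n. real (m n)) at_top sequentially"
      by (rule filterlim_compose[OF filterlim_real_sequentially m_inf])
    have q_inf: "filterlim q at_top sequentially"
      unfolding q_def by (intro filterlim_compose[OF filterlim_nat_sequentially] filterlim_compose[OF filterlim_floor_sequentially]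
          filterlim_tendsto_pos_mult_at_top[OF tendsto_const \<theta>(1)] m_real)
    have w_inf: "filterlim (\<lambda>n. m n - q n) at_top sequentially"
    proof (rule filterlim_at_top_mono[OF q_inf])
      have "q n \<le> m n - q n" for n
      proof -
        have "real (q n) \<le> 1 / 2 * real (m n)" using q_le[of n] \<theta> by (meson mult_right_mono of_nat_0_le_iff order_trans)
        then show ?thesis by linarith
      qed
      then show "\<forall>\<^sub>F n in sequentially. q n \<le> m n - q n" by simp
    qed
    have mn: "(\<lambda>n. real (m n) / real n) \<longlonglongrightarrow> 0"
    proof (rule tendsto_sandwich[OF _ _ tendsto_const])
      have "(\<lambda>n. 1 / sqrt (real n)) \<longlonglongrightarrow> 0"
        by (intro tendsto_divide_0[OF tendsto_const] filterlim_at_top_imp_at_infinity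
            filterlim_compose[OF sqrt_at_top filterlim_real_sequentially])
      then show "(\<lambda>n. \<theta> * (1 / sqrt (real n))) \<longlonglongrightarrow> 0" by (rule tendsto_mult_right_zero)
      have "real (m n) / real n \<le> \<theta> * (1 / sqrt (real n))" for n
      proof (cases "n = 0")
        case False
        have "real (m n) / real n \<le> \<theta> * sqrt (real n) / real n" by (intro divide_right_mono m_le) simp
        also have "\<dots> = \<theta> * (1 / sqrt (real n))"
          using False real_sqrt_mult_self[of "real n"] by (simp add: field_simps)
        finally show ?thesis .
      qed simp
      then show "\<forall>\<^sub>F n in sequentially. real (m n) / real n \<le> \<theta> * (1 / sqrt (real n))" by simp
    qed simp
    have ev: "eventually (\<lambda>n. 2 \<le> \<theta> * real (m n) \<and> 1 \<le> n) sequentially"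
    proof -
      have "filterlim (\<lambda>n. \<theta> * real (m n)) at_top sequentially"
        by (intro filterlim_tendsto_pos_mult_at_top[OF tendsto_const \<theta>(1)] m_real)
      then have "eventually (\<lambda>n. 2 \<le> \<theta> * real (m n)) sequentially" by (simp add: filterlim_at_top)
      with eventually_ge_at_top[of 1] show ?thesis by eventually_elim simp
    qed
    have nm: "(\<lambda>n. real n / real (m n) * \<alpha> (q n)) \<longlonglongrightarrow> 0"
    proof (rule tendsto_sandwich[OF _ _ tendsto_const])
      \<comment> \<open>From \<open>\<theta> * sqrt n \<le> 2 * m\<close> follows
        \<open>n / m \<le> 4 * m / \<theta>\<^sup>2\<close>, and
        \<open>\<theta> * m \<le> 2 * q\<close> turns this into
        \<open>8 * q / \<theta> ^ 3\<close>.\<close>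
      show "(\<lambda>n. 8 / \<theta> ^ 3 * (real (q n) * \<alpha> (q n))) \<longlonglongrightarrow> 0"
        by (rule tendsto_mult_right_zero[OF filterlim_compose[OF mixing_coeff_little_o q_inf]])
      show "\<forall>\<^sub>F n in sequentially. real n / real (m n) * \<alpha> (q n) \<le> 8 / \<theta> ^ 3 * (real (q n) * \<alpha> (q n))"
        using ev
      proof eventually_elim
        case (elim n)
        have m1: "1 \<le> real (m n)" using elim \<theta> by (cases "m n") auto
        have "\<theta> * sqrt (real n) \<le> 2 * real (m n)" using m_gt[of n] m1 by linarith
        then have "(\<theta> * sqrt (real n))\<^sup>2 \<le> (2 * real (m n))\<^sup>2" using \<theta> by (intro power_mono) auto
        then have "\<theta>\<^sup>2 * real n \<le> 4 * (real (m n))\<^sup>2" by (simp add: power_mult_distrib)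
        then have "\<theta>\<^sup>2 * (real n / real (m n)) \<le> 4 * real (m n)"
          using m1 by (simp add: divide_le_eq power2_eq_square)
        then have "\<theta> * (\<theta>\<^sup>2 * (real n / real (m n))) \<le> \<theta> * (4 * real (m n))" using \<theta> by (intro mult_left_mono) auto
        also have "\<dots> \<le> 8 * real (q n)" using q_gt[of n] elim by linarith
        finally have "real n / real (m n) \<le> 8 / \<theta> ^ 3 * real (q n)"
          using \<theta> by (simp add: le_divide_eq power2_eq_square power3_eq_cube mult_ac)
        from mult_right_mono[OF this mixing_coeff_nonneg] show ?case by (simp add: mult.assoc)
      qed
    qed (auto intro!: always_eventually divide_nonneg_nonneg mult_nonneg_nonneg mixing_coeff_nonneg)
    define s where "s n = expectation (\<lambda>\<omega>. (S 1 n \<omega>)\<^sup>2) / real n" for n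
    have sv: "(\<lambda>n. s (m n - q n)) \<longlonglongrightarrow> v"
      by (rule filterlim_compose[OF _ w_inf]) (use v_lim in \<open>simp add: s_def S_def\<close>)
    define B where "B n = \<bar>u\<bar> / sqrt v * sqrt ((real (m n) / real n + \<theta>) * \<gamma> 1) + 16 * (real n / real (m n) * \<alpha> (q n))
      + (A * (\<bar>u\<bar> / sqrt v * \<theta>) + A\<^sup>2 * (real (m n) / real n))
      + u\<^sup>2 * (\<bar>s (m n - q n) / v - 1\<bar> + (real (m n) / real n + \<theta>))" for n
    have "B \<longlonglongrightarrow> L \<theta>"
      unfolding B_def L_def using v_pos by (intro tendsto_intros mn nm sv) auto
    then have "eventually (\<lambda>n. B n < e) sequentially" using e by (rule order_tendstoD(2))
    with ev show ?thesis
    proof eventually_elim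
      case (elim n)
      have "1 \<le> m n" using elim \<theta> by (cases "m n") auto
      from clt_bound[OF _ this m_le \<theta> q_le, of u] elim show ?case by (simp add: B_def A_def s_def)
    qed
  qed
  have "(\<lambda>n. ?\<phi> n - exp (- u\<^sup>2 / 2)) \<longlonglongrightarrow> 0"
  proof (rule tendstoI)
    fix e :: real assume e: "0 < e"
    have "(L \<longlongrightarrow> L 0) (at_right 0)"
      unfolding L_def by (intro tendsto_intros) (use v_pos in auto)
    moreover have "L 0 < e" using e v_pos by (simp add: L_def)
    ultimately have "eventually (\<lambda>\<theta>. L \<theta> < e) (at_right 0)" by (rule order_tendstoD(2))
    moreover have "eventually (\<lambda>\<theta>::real. \<theta> \<in> {0<..<1/2}) (at_right 0)" by (rule eventually_at_right_real) simp
    ultimately have "eventually (\<lambda>\<theta>. L \<theta> < e \<and> \<theta> \<in> {0<..<1/2}) (at_right 0)" by (rule eventually_conj)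
    from eventually_happens'[OF trivial_limit_at_right_real this]
    obtain \<theta> where \<theta>: "L \<theta> < e" "\<theta> \<in> {0<..<1/2}" by blast
    then show "eventually (\<lambda>n. dist (?\<phi> n - exp (- u\<^sup>2 / 2)) 0 < e) sequentially"
      using small[of \<theta> e] by simp
  qed
  then have "?\<phi> \<longlonglongrightarrow> exp (- u\<^sup>2 / 2)" by (simp add: LIM_zero_iff)
  moreover have "char (distr M borel (\<lambda>\<omega>. S 1 n \<omega> / sqrt (v * real n))) u = ?\<phi> n" for n
    by (simp add: char_def integral_distr)
  ultimately show "(\<lambda>n. char (distr M borel (\<lambda>\<omega>. S 1 n \<omega> / sqrt (v * real n))) u) \<longlonglongrightarrow> char std_normal_distribution u"
    by (simp add: char_std_normal_distribution)
qed (auto intro!: real_distribution_distr)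

text \<open>Weak convergence together with convergence of second moments gives uniform integrability.\<close>

lemma truncated_excess:
  assumes "0 < \<epsilon>"
  shows "\<exists>K>0. eventually (\<lambda>n. expectation (\<lambda>\<omega>. max 0 ((S 1 n \<omega>)\<^sup>2 / (v * real n) - K)) < \<epsilon>) sequentially"
proof -
  let ?N = "std_normal_distribution"
  have i2: "integrable ?N (\<lambda>x. x\<^sup>2)" and m2: "(\<integral>x. x\<^sup>2 \<partial>?N) = 1"
    using std_normal_distribution_even_moments[of 1] by simp_all
  \<comment> \<open>\<open>K\<close> is chosen for the limit law. The excess over \<open>K\<close>
    is the second moment minus the mean of a bounded continuous function; the former converges by
    assumption, the latter by the central limit theorem.\<close>
  have "(\<lambda>k. \<integral>x. min (x\<^sup>2) (real k) \<partial>?N) \<longlonglongrightarrow> (\<integral>x. x\<^sup>2 \<partial>?N)"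
  proof (rule integral_dominated_convergence[OF _ _ i2])
    show "AE x in ?N. (\<lambda>k. min (x\<^sup>2) (real k)) \<longlonglongrightarrow> x\<^sup>2"
    proof (rule AE_I2)
      fix x :: real
      have "eventually (\<lambda>k. x\<^sup>2 \<le> real k) sequentially"
        using filterlim_real_sequentially by (simp add: filterlim_at_top)
      then have "eventually (\<lambda>k. min (x\<^sup>2) (real k) = x\<^sup>2) sequentially" by eventually_elim simp
      then show "(\<lambda>k. min (x\<^sup>2) (real k)) \<longlonglongrightarrow> x\<^sup>2" by (rule tendsto_eventually)
    qed
  qed auto
  then have "eventually (\<lambda>k. 1 - \<epsilon> < (\<integral>x. min (x\<^sup>2) (real k) \<partial>?N)) sequentially"
    unfolding m2 using assms by (intro order_tendstoD(1)) auto
  with eventually_gt_at_top[of 0] have "eventually (\<lambda>k. 0 < k \<and> 1 - \<epsilon> < (\<integral>x. min (x\<^sup>2) (real k) \<partial>?N)) sequentially"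
    by eventually_elim simp
  then obtain k :: nat where k: "0 < k" "1 - \<epsilon> < (\<integral>x. min (x\<^sup>2) (real k) \<partial>?N)"
    by (auto dest: eventually_happens)
  define K where "K = real k"
  have K: "0 < K" using k by (simp add: K_def)
  let ?Z = "\<lambda>n \<omega>. S 1 n \<omega> / sqrt (v * real n)"
  have Z2: "(?Z n \<omega>)\<^sup>2 = (S 1 n \<omega>)\<^sup>2 / (v * real n)" for n \<omega> using v_pos by (simp add: power_divide)
  have "(\<lambda>n. integral\<^sup>L (distr M borel (?Z n)) (\<lambda>x. min (x\<^sup>2) K)) \<longlonglongrightarrow> (\<integral>x. min (x\<^sup>2) K \<partial>?N)"
    by (rule weak_conv_imp_integral_bdd_continuous_conv[OF _ real_dist_normal_dist clt, of _ K])
      (use K in \<open>auto intro!: real_distribution_distr tendsto_intros tendsto_min simp: isCont_def\<close>)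
  then have 1: "(\<lambda>n. expectation (\<lambda>\<omega>. min ((?Z n \<omega>)\<^sup>2) K)) \<longlonglongrightarrow> (\<integral>x. min (x\<^sup>2) K \<partial>?N)"
    by (simp add: integral_distr)
  have 2: "(\<lambda>n. expectation (\<lambda>\<omega>. (?Z n \<omega>)\<^sup>2)) \<longlonglongrightarrow> 1"
  proof -
    have "(\<lambda>n. expectation (\<lambda>\<omega>. (S 1 n \<omega>)\<^sup>2) / real n / v) \<longlonglongrightarrow> v / v"
      using v_lim v_pos by (intro tendsto_divide tendsto_const) (simp_all add: S_def)
    then show ?thesis unfolding Z2 using v_pos by (simp add: mult.commute)
  qed
  have int2: "integrable M (\<lambda>\<omega>. (?Z n \<omega>)\<^sup>2)" for n unfolding Z2 by (intro integrable_divide S2_integrable)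
  have intm: "integrable M (\<lambda>\<omega>. min ((?Z n \<omega>)\<^sup>2) K)" for n
    by (rule integrable_bounded[where B=K]) (use K in auto)
  have "expectation (\<lambda>\<omega>. max 0 ((S 1 n \<omega>)\<^sup>2 / (v * real n) - K)) = expectation (\<lambda>\<omega>. (?Z n \<omega>)\<^sup>2) - expectation (\<lambda>\<omega>. min ((?Z n \<omega>)\<^sup>2) K)" for n
  proof -
    have "max 0 ((S 1 n \<omega>)\<^sup>2 / (v * real n) - K) = (?Z n \<omega>)\<^sup>2 - min ((?Z n \<omega>)\<^sup>2) K" for \<omega>
      unfolding Z2 by (auto simp: max_def min_def)
    then show ?thesis using int2 intm by simp
  qed
  moreover have "eventually (\<lambda>n. expectation (\<lambda>\<omega>. (?Z n \<omega>)\<^sup>2) - expectation (\<lambda>\<omega>. min ((?Z n \<omega>)\<^sup>2) K) < \<epsilon>) sequentially"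
    by (rule order_tendstoD(2)[OF tendsto_diff[OF 2 1]]) (use k in \<open>simp add: K_def\<close>)
  ultimately show ?thesis using K by (intro exI[of _ K]) simp
qed

end

section \<open>The bootstrap empirical distribution function\<close>

lemma mod_eq_near:
  fixes a b n :: nat
  assumes "a mod n = b mod n" "a < b + n" "b < a + n" shows "a = b"
proof -
  have *: "a = b" if "a mod n = b mod n" "a \<le> b" "b < a + n" for a b :: nat
  proof -
    have "n dvd b - a" using that by (metis mod_eq_dvd_iff_nat)
    then show ?thesis using that by (metis add.commute diff_is_0_eq dvd_imp_le le_antisym less_diff_conv2 linorder_not_less zero_less_diff)
  qed
  show ?thesis using *[of a b] *[of b a] assms by (cases "a \<le> b") auto
qed

definition wrap :: "nat \<Rightarrow> nat \<Rightarrow> nat" where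
  "wrap n i = (i - 1) mod n + 1"

lemma periodic_ext_wrap: "periodic_ext n x i = x (wrap n i)"
  by (simp add: periodic_ext_def wrap_def)

lemma wrap_in: "1 \<le> n \<Longrightarrow> wrap n i \<in> {1..n}"
  by (simp add: wrap_def Suc_leI)

lemma wrap_id: "1 \<le> i \<Longrightarrow> i \<le> n \<Longrightarrow> wrap n i = i"
  by (simp add: wrap_def)

text \<open>Since \<open>L \<le> n\<close>, no block meets an index twice, even when it wraps
  around. Its sum is therefore a sum over a set of \<open>L\<close> indices, to which the variance
  bounds apply.\<close>

lemma wrap_inj_block:
  assumes "1 \<le> j" "L \<le> n" shows "inj_on (\<lambda>r. wrap n (j + r)) {..<L}"
proof (rule inj_onI)
  fix r r' assume r: "r \<in> {..<L}" "r' \<in> {..<L}" and "wrap n (j + r) = wrap n (j + r')"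
  then have "(j + r - 1) mod n = (j + r' - 1) mod n" by (simp add: wrap_def)
  then have "j + r - 1 = j + r' - 1" by (rule mod_eq_near) (use assms r in auto)
  then show "r = r'" using assms by simp
qed

text \<open>A cyclic shift permutes the indices: at each place \<open>r\<close>, every observation
  occurs for exactly one starting index.\<close>

lemma sum_wrap_shift:
  fixes f :: "nat \<Rightarrow> real"
  assumes "1 \<le> n" shows "(\<Sum>j=1..n. f (wrap n (j + r))) = (\<Sum>i=1..n. f i)"
proof -
  have inj: "inj_on (\<lambda>j. wrap n (j + r)) {1..n}"
  proof (rule inj_onI)
    fix j j' assume j: "j \<in> {1..n}" "j' \<in> {1..n}" and "wrap n (j + r) = wrap n (j' + r)"
    then have "(j + r - 1) mod n = (j' + r - 1) mod n" by (simp add: wrap_def)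
    then have "j + r - 1 = j' + r - 1" by (rule mod_eq_near) (use j in auto)
    then show "j = j'" using j by (simp only: atLeastAtMost_iff) linarith
  qed
  have "(\<lambda>j. wrap n (j + r)) ` {1..n} = {1..n}"
    by (rule endo_inj_surj[OF _ _ inj]) (use wrap_in[OF assms] in auto)
  with sum.reindex[OF inj, of f] show ?thesis by simp
qed

lemma cbb_ecdf:
  assumes "1 \<le> L"
  shows "ecdf (b * L) (cbb_sample n L x s) \<tau>
    = (1 / real (b * L)) * (\<Sum>k<b. \<Sum>r<L. indicator {..\<tau>} (x (wrap n (s k + r))))"
proof -
  let ?f = "\<lambda>(k, r). k * L + (r + 1)"
  have "bij_betw ?f ({..<b} \<times> {..<L}) {1..b * L}"
  proof (rule bij_betw_byWitness[where f'="\<lambda>i. ((i - 1) div L, (i - 1) mod L)"])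
    show "\<forall>a\<in>{..<b} \<times> {..<L}. ((?f a - 1) div L, (?f a - 1) mod L) = a"
      using assms by (auto simp: add.commute)
    show "\<forall>i\<in>{1..b * L}. ?f ((i - 1) div L, (i - 1) mod L) = i" by simp
    show "?f ` ({..<b} \<times> {..<L}) \<subseteq> {1..b * L}"
    proof clarsimp
      fix k r assume "k < b" "r < L"
      then have "Suc k * L \<le> b * L" by (intro mult_right_mono) auto
      then show "Suc (k * L + r) \<le> b * L" using \<open>r < L\<close> by simp
    qed
    show "(\<lambda>i. ((i - 1) div L, (i - 1) mod L)) ` {1..b * L} \<subseteq> {..<b} \<times> {..<L}"
      using assms by (auto simp: less_mult_imp_div_less)
  qed
  then have "(\<Sum>i=1..b * L. indicator {..\<tau>} (cbb_sample n L x s i) :: real)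
      = (\<Sum>a\<in>{..<b} \<times> {..<L}. indicator {..\<tau>} (cbb_sample n L x s (?f a)))"
    by (rule sum.reindex_bij_betw[symmetric])
  also have "\<dots> = (\<Sum>(k, r)\<in>{..<b} \<times> {..<L}. indicator {..\<tau>} (x (wrap n (s k + r))))"
  proof (rule sum.cong[OF refl])
    fix a assume "a \<in> {..<b} \<times> {..<L}"
    then obtain k r where a: "a = (k, r)" "r < L" by auto
    have "cbb_sample n L x s (k * L + (r + 1)) = x (wrap n (s k + r))"
      using a(2) by (subst cbb_sample_block) (auto simp: periodic_ext_wrap)
    then show "(indicator {..\<tau>} (cbb_sample n L x s (?f a)) :: real) = (case a of (k, r) \<Rightarrow> indicator {..\<tau>} (x (wrap n (s k + r))))"
      by (simp only: a(1) prod.case)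
  qed
  also have "\<dots> = (\<Sum>k<b. \<Sum>r<L. indicator {..\<tau>} (x (wrap n (s k + r))))"
    by (simp add: sum.cartesian_product)
  finally show ?thesis unfolding ecdf_def by simp
qed

section \<open>The bootstrap event in terms of independent blocks\<close>

lemma ecdf_mono: "s \<le> t \<Longrightarrow> ecdf m x s \<le> ecdf m x t"
  unfolding ecdf_def by (intro mult_left_mono sum_mono) (auto simp: indicator_def)

text \<open>The conditional probability that the bootstrap quantile is at most \<open>\<tau>\<close>.\<close>

definition cbb_le :: "real \<Rightarrow> nat \<Rightarrow> nat \<Rightarrow> (nat \<Rightarrow> real) \<Rightarrow> real \<Rightarrow> real" where
  "cbb_le p n L x \<tau> = measure_pmf.prob (cbb_starts n L) {s. p \<le> ecdf ((n div L) * L) (cbb_sample n L x s) \<tau>}"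

text \<open>The random centring becomes a shift of the argument, so \<open>cbb_le\<close> can be
  studied at deterministic points first.\<close>

lemma cbb_prob_eq_cbb_le:
  assumes "0 < p" "p \<le> 1" "1 \<le> L" "L \<le> n"
  shows "cbb_prob p n L x t = cbb_le p n L x (quantile (ecdf n x) p + t)"
proof -
  have "0 < (n div L) * L" using assms by (simp add: div_greater_zero_iff)
  then have "cbb_quantile p n L x s - quantile (ecdf n x) p \<le> t \<longleftrightarrow>
      p \<le> ecdf ((n div L) * L) (cbb_sample n L x s) (quantile (ecdf n x) p + t)" for s
    unfolding cbb_quantile_def using quantile_ecdf_le_iff[OF _ assms(1,2)] by (simp add: algebra_simps)
  then show ?thesis by (simp add: cbb_prob_def cbb_le_def)
qed

lemma cbb_le_mono: "mono (cbb_le p n L x)"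
  unfolding cbb_le_def
  by (intro monoI measure_pmf.finite_measure_mono) (auto intro: order_trans ecdf_mono)

definition block_dev :: "nat \<Rightarrow> nat \<Rightarrow> (nat \<Rightarrow> real) \<Rightarrow> real \<Rightarrow> nat \<Rightarrow> real" where
  "block_dev n L x \<tau> j = (\<Sum>r<L. indicator {..\<tau>} (x (wrap n (j + r))) - ecdf n x \<tau>)"

text \<open>Because of the circular extension the block sums are exactly centred.\<close>

lemma block_dev_sum:
  assumes "1 \<le> n" shows "(\<Sum>j=1..n. block_dev n L x \<tau> j) = 0"
proof -
  have "(\<Sum>j=1..n. block_dev n L x \<tau> j) = (\<Sum>r<L. \<Sum>j=1..n. indicator {..\<tau>} (x (wrap n (j + r))) - ecdf n x \<tau>)"
    unfolding block_dev_def by (rule sum.swap)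
  also have "\<dots> = (\<Sum>r<L. (\<Sum>i=1..n. indicator {..\<tau>} (x i)) - real n * ecdf n x \<tau>)"
    unfolding sum_subtractf sum_wrap_shift[OF assms, of "\<lambda>i. indicator {..\<tau>} (x i)"] by simp
  also have "\<dots> = 0" using assms by (simp add: ecdf_def)
  finally show ?thesis .
qed

text \<open>Brings the event into the form of \<open>resample_clt\<close>: centred independent block
  sums on the left, the empirical drift at \<open>\<tau>\<close> on the right. The minus sign arises
  because the event bounds the fluctuation from below.\<close>

lemma cbb_le_eq:
  assumes L: "1 \<le> L" "L \<le> n" and \<sigma>: "0 < \<sigma>"
  defines "b \<equiv> n div L"
  shows "cbb_le p n L x \<tau> = measure_pmf.prob (Pi_pmf {..<b} 1 (\<lambda>_. pmf_of_set {1..n}))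
    {s. (\<Sum>k<b. - block_dev n L x \<tau> (s k) / (\<sigma> * sqrt (real L))) / sqrt (real b)
      \<le> sqrt (real (b * L)) * (ecdf n x \<tau> - p) / \<sigma>}"
proof -
  have b: "1 \<le> b" using L by (simp add: b_def Suc_le_eq div_greater_zero_iff)
  have "(p \<le> ecdf (b * L) (cbb_sample n L x s) \<tau>) \<longleftrightarrow>
    (\<Sum>k<b. - block_dev n L x \<tau> (s k) / (\<sigma> * sqrt (real L))) / sqrt (real b) \<le> sqrt (real (b * L)) * (ecdf n x \<tau> - p) / \<sigma>" for s
  proof -
    let ?c = "\<sigma> * sqrt (real b * real L)"
    have c: "0 < ?c" using b L \<sigma> by simp
    have bL: "0 < real b * real L" using b L by simp
    let ?D = "\<Sum>k<b. block_dev n L x \<tau> (s k)"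
    have "(\<Sum>k<b. \<Sum>r<L. indicator {..\<tau>} (x (wrap n (s k + r)))) = ?D + real b * real L * ecdf n x \<tau>"
      by (simp add: block_dev_def sum_subtractf)
    then have "ecdf (b * L) (cbb_sample n L x s) \<tau> = ?D / (real b * real L) + ecdf n x \<tau>"
      unfolding cbb_ecdf[OF L(1)] using b L by (simp add: add_divide_distrib)
    then have "(p \<le> ecdf (b * L) (cbb_sample n L x s) \<tau>) \<longleftrightarrow> - (?D / (real b * real L)) \<le> ecdf n x \<tau> - p" by linarith
    also have "\<dots> \<longleftrightarrow> real b * real L * (- (?D / (real b * real L))) \<le> real b * real L * (ecdf n x \<tau> - p)"
      using bL by (simp only: mult_le_cancel_left_pos)
    also have "real b * real L * (- (?D / (real b * real L))) = - ?D" using b L by simp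
    also have "(- ?D \<le> real b * real L * (ecdf n x \<tau> - p)) \<longleftrightarrow> - ?D / ?c \<le> real b * real L * (ecdf n x \<tau> - p) / ?c"
      using c by (simp only: divide_le_cancel) simp
    also have "real b * real L * (ecdf n x \<tau> - p) / ?c = sqrt (real (b * L)) * (ecdf n x \<tau> - p) / \<sigma>"
    proof -
      define y where "y = sqrt (real b * real L)"
      have y: "0 < y" "real b * real L = y * y" using bL by (simp_all add: y_def)
      have "real b * real L * (ecdf n x \<tau> - p) / (\<sigma> * y) = y * (ecdf n x \<tau> - p) / \<sigma>"
        unfolding y(2) using y(1) by simp
      then show ?thesis by (simp add: y_def)
    qed
    also have "- ?D / ?c = (\<Sum>k<b. - block_dev n L x \<tau> (s k) / (\<sigma> * sqrt (real L))) / sqrt (real b)"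
      by (simp add: sum_divide_distrib[symmetric] sum_negf real_sqrt_mult mult_ac)
    finally show ?thesis .
  qed
  then show ?thesis unfolding cbb_le_def cbb_starts_def b_def by simp
qed

section \<open>The bootstrap central limit theorem\<close>

lemma sq_add_le: "(a + b)\<^sup>2 \<le> 2 * a\<^sup>2 + 2 * (b::real)\<^sup>2"
proof -
  have "0 \<le> (a - b)\<^sup>2" by simp
  then show ?thesis by (simp add: power2_sum power2_diff)
qed

text \<open>Young's inequality with weight \<open>\<eta>\<close> for the mixed term. It transfers
  averages of squares when only the mean square of \<open>a - b\<close> is known to be
  small.\<close>

lemma sq_diff_le:
  fixes a b \<eta> :: real assumes "0 < \<eta>"
  shows "\<bar>a\<^sup>2 - b\<^sup>2\<bar> \<le> (1 + 1 / \<eta>) * (a - b)\<^sup>2 + \<eta> * b\<^sup>2"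
proof -
  have "2 * \<bar>b * (a - b)\<bar> \<le> (a - b)\<^sup>2 / \<eta> + \<eta> * b\<^sup>2"
  proof -
    have "0 \<le> (\<bar>a - b\<bar> - \<eta> * \<bar>b\<bar>)\<^sup>2" by simp
    also have "\<dots> = (a - b)\<^sup>2 + \<eta>\<^sup>2 * b\<^sup>2 - 2 * \<eta> * \<bar>b * (a - b)\<bar>"
      by (simp add: power2_diff power_mult_distrib abs_mult mult_ac)
    finally have "2 * \<eta> * \<bar>b * (a - b)\<bar> \<le> (a - b)\<^sup>2 + \<eta>\<^sup>2 * b\<^sup>2" by simp
    then have "(2 * \<eta> * \<bar>b * (a - b)\<bar>) / \<eta> \<le> ((a - b)\<^sup>2 + \<eta>\<^sup>2 * b\<^sup>2) / \<eta>"
      using assms by (intro divide_right_mono) auto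
    then show ?thesis using assms by (simp add: add_divide_distrib power2_eq_square)
  qed
  moreover have "\<bar>a\<^sup>2 - b\<^sup>2\<bar> \<le> (a - b)\<^sup>2 + 2 * \<bar>b * (a - b)\<bar>"
  proof -
    have eq: "a\<^sup>2 - b\<^sup>2 = (a - b)\<^sup>2 + 2 * (b * (a - b))" by (simp add: power2_eq_square algebra_simps)
    show ?thesis unfolding eq by (rule order_trans[OF abs_triangle_ineq]) (simp add: abs_mult)
  qed
  ultimately show ?thesis by (simp add: distrib_right)
qed

text \<open>In modulus, if \<open>b\<close> is at most \<open>a - b\<close>, then \<open>a\<close>
  is at most twice the difference; otherwise \<open>a\<close> is at most twice \<open>b\<close>, and
  \<open>b\<close> exceeds \<open>c / 2\<close> whenever \<open>a\<close> exceeds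
  \<open>c\<close>.\<close>

lemma sq_indicator_split:
  fixes a b c :: real assumes "0 \<le> c"
  shows "a\<^sup>2 * indicator {x. c < \<bar>x\<bar>} a \<le> 4 * (b\<^sup>2 * indicator {x. c / 2 < \<bar>x\<bar>} b) + 4 * (a - b)\<^sup>2"
proof (cases "c < \<bar>a\<bar>")
  case True
  show ?thesis
  proof (cases "\<bar>b\<bar> \<le> \<bar>a - b\<bar>")
    case True
    then have "\<bar>a\<bar> \<le> 2 * \<bar>a - b\<bar>" using abs_triangle_ineq[of b "a - b"] by simp
    then have "\<bar>a\<bar>\<^sup>2 \<le> (2 * \<bar>a - b\<bar>)\<^sup>2" by (rule power_mono) simp
    then have "a\<^sup>2 \<le> 4 * (a - b)\<^sup>2" by (simp add: power_mult_distrib)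
    moreover have "0 \<le> 4 * (b\<^sup>2 * indicator {x. c / 2 < \<bar>x\<bar>} b)" by simp
    moreover have "a\<^sup>2 * indicator {x. c < \<bar>x\<bar>} a = a\<^sup>2" using \<open>c < \<bar>a\<bar>\<close> by simp
    ultimately show ?thesis by linarith
  next
    case False
    then have le: "\<bar>a\<bar> \<le> 2 * \<bar>b\<bar>" using abs_triangle_ineq[of b "a - b"] by simp
    then have "\<bar>a\<bar>\<^sup>2 \<le> (2 * \<bar>b\<bar>)\<^sup>2" by (rule power_mono) simp
    then have "a\<^sup>2 \<le> 4 * b\<^sup>2" by (simp add: power_mult_distrib)
    moreover have "c / 2 < \<bar>b\<bar>" using le True by linarith
    then have "b\<^sup>2 * indicator {x. c / 2 < \<bar>x\<bar>} b = b\<^sup>2" by simp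
    moreover have "a\<^sup>2 * indicator {x. c < \<bar>x\<bar>} a = a\<^sup>2" using True by simp
    moreover have "0 \<le> 4 * (a - b)\<^sup>2" by simp
    ultimately show ?thesis by linarith
  qed
qed (simp add: add_nonneg_nonneg)

locale cbb_setup = mixing_process +
  fixes F :: "real \<Rightarrow> real" and p tp v :: real and l :: "nat \<Rightarrow> nat"
  assumes F: "\<And>t. prob {\<omega>\<in>space M. X 1 \<omega> \<le> t} = F t"
    and F_tp: "F tp = p" and p01: "0 < p" "p < 1" and v: "0 < v"
    and v_lim': "(\<lambda>n. expectation (\<lambda>\<omega>. (\<Sum>r<n. (indicator {..tp} (X (int (1 + r)) \<omega>) - p))\<^sup>2) / real n) \<longlonglongrightarrow> v"
    and l: "\<And>n. 1 \<le> n \<Longrightarrow> 1 \<le> l n" "\<And>n. 1 \<le> n \<Longrightarrow> l n \<le> n"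
    and l_lim: "(\<lambda>n. 1 / real (l n) + real (l n) / real n) \<longlonglongrightarrow> 0"
begin

abbreviation x :: "'a \<Rightarrow> nat \<Rightarrow> real" where "x \<omega> \<equiv> (\<lambda>i. X (int i) \<omega>)"

lemma F01: "0 \<le> F t" "F t \<le> 1"
  by (auto simp: F[symmetric])

lemma F_mono: "s \<le> t \<Longrightarrow> F s \<le> F t"
  by (auto simp: F[symmetric] intro!: finite_measure_mono)

lemma expectation_ind: "expectation (\<lambda>\<omega>. indicator {..t} (X 1 \<omega>)) = F t"
proof -
  have "expectation (\<lambda>\<omega>. indicator {..t} (X 1 \<omega>) :: real) = expectation (indicator {\<omega>\<in>space M. X 1 \<omega> \<le> t})"
    by (rule Bochner_Integration.integral_cong) (auto simp: indicator_def)
  then show ?thesis by (simp add: F)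
qed

lemma ind_integrable: "integrable M (\<lambda>\<omega>. indicator {..t} (X i \<omega>) :: real)"
  by (rule integrable_bounded[where B=1]) (auto simp: indicator_def)

sublocale clt_setup M X "\<lambda>z. indicator {..tp} z - p" v
proof unfold_locales
  show "\<bar>indicator {..tp} z - p\<bar> \<le> 1" for z :: real using p01 by (auto simp: indicator_def)
  show "expectation (\<lambda>\<omega>. indicator {..tp} (X 1 \<omega>) - p) = 0"
    using ind_integrable by (simp add: expectation_ind F_tp prob_space)
  show "(\<lambda>z. indicator {..tp} z - p) \<in> borel_measurable borel" by measurable
qed (use v v_lim' in auto)

lemma l_div_lim: "(\<lambda>n. real (l n) / real n) \<longlonglongrightarrow> 0"
  by (rule tendsto_sandwich[OF _ _ tendsto_const l_lim]) auto

lemma l_inf: "filterlim l at_top sequentially"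
proof -
  have "(\<lambda>n. inverse (real (l n))) \<longlonglongrightarrow> 0"
    by (rule tendsto_sandwich[OF _ _ tendsto_const l_lim]) (auto simp: field_simps)
  moreover have "eventually (\<lambda>n. 0 < inverse (real (l n))) sequentially"
    using eventually_ge_at_top[of 1] by eventually_elim (use l(1) in force)
  ultimately have "filterlim (\<lambda>n. inverse (inverse (real (l n)))) at_top sequentially"
    by (rule filterlim_inverse_at_top)
  then have "filterlim (\<lambda>n. real (l n)) at_top sequentially" by simp
  then show ?thesis unfolding filterlim_at_top by (metis (mono_tags, lifting) eventually_mono of_nat_le_iff)
qed

definition b :: "nat \<Rightarrow> nat" where "b n = n div l n"

lemma b_ge_1: "1 \<le> n \<Longrightarrow> 1 \<le> b n"
  using l[of n] by (simp add: b_def Suc_le_eq div_greater_zero_iff)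

lemma bl_bounds:
  assumes "1 \<le> n" shows "real (b n * l n) \<le> real n" "real n - real (l n) \<le> real (b n * l n)"
proof -
  have "n = b n * l n + n mod l n" by (simp add: b_def)
  moreover have "n mod l n < l n" using l(1)[OF assms] by simp
  ultimately show "real (b n * l n) \<le> real n" "real n - real (l n) \<le> real (b n * l n)" by linarith+
qed

lemma b_inf: "filterlim (\<lambda>n. real (b n)) at_top sequentially"
proof -
  have pos: "eventually (\<lambda>n. 0 < real (l n) / real n) sequentially"
    using eventually_ge_at_top[of 1] by eventually_elim (use l(1) in force)
  have "filterlim (\<lambda>n. inverse (real (l n) / real n)) at_top sequentially"
    by (rule filterlim_inverse_at_top[OF l_div_lim pos])
  then have "filterlim (\<lambda>n. - 1 + inverse (real (l n) / real n)) at_top sequentially"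
    by (rule filterlim_tendsto_add_at_top[OF tendsto_const])
  then show ?thesis
  proof (rule filterlim_at_top_mono)
    show "\<forall>\<^sub>F n in sequentially. - 1 + inverse (real (l n) / real n) \<le> real (b n)"
      using eventually_ge_at_top[of 1]
    proof eventually_elim
      case (elim n)
      have "real n \<le> (real (b n) + 1) * real (l n)" using bl_bounds(2)[OF elim] by (simp add: distrib_right)
      then have "real n / real (l n) \<le> real (b n) + 1" using l(1)[OF elim] by (simp add: divide_le_eq)
      then show ?case by simp
    qed
  qed
qed

lemma bl_ratio_lim: "(\<lambda>n. sqrt (real (b n * l n) / real n)) \<longlonglongrightarrow> 1"
proof -
  have "(\<lambda>n. real (b n * l n) / real n) \<longlonglongrightarrow> 1"
  proof (rule tendsto_sandwich[OF _ _ _ tendsto_const])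
    show "(\<lambda>n. 1 - real (l n) / real n) \<longlonglongrightarrow> 1" using tendsto_diff[OF tendsto_const[of 1] l_div_lim] by simp
    show "\<forall>\<^sub>F n in sequentially. 1 - real (l n) / real n \<le> real (b n * l n) / real n"
      using eventually_ge_at_top[of 1]
    proof eventually_elim
      case (elim n)
      have "(real n - real (l n)) / real n \<le> real (b n * l n) / real n" using bl_bounds(2)[OF elim] by (intro divide_right_mono) auto
      then show ?case using elim by (simp add: diff_divide_distrib)
    qed
    show "\<forall>\<^sub>F n in sequentially. real (b n * l n) / real n \<le> 1"
      using eventually_ge_at_top[of 1]
      by eventually_elim (use bl_bounds(1) in \<open>simp add: divide_le_eq\<close>)
  qed
  from tendsto_real_sqrt[OF this] show ?thesis by simp
qed

text \<open>\<open>Y'\<close> is centred by \<open>p\<close> and, instead of wrapping around, continues with the observations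
  after time \<open>n\<close>; this makes it stationary in \<open>j\<close>.\<close>

definition Y :: "nat \<Rightarrow> real \<Rightarrow> nat \<Rightarrow> 'a \<Rightarrow> real" where
  "Y n \<tau> j \<omega> = block_dev n (l n) (x \<omega>) \<tau> j / (sqrt v * sqrt (real (l n)))"

definition Y' :: "nat \<Rightarrow> nat \<Rightarrow> 'a \<Rightarrow> real" where
  "Y' n j \<omega> = S j (l n) \<omega> / (sqrt v * sqrt (real (l n)))"

section \<open>Boundedness and integrability of the normalised block sums\<close>

lemma ecdf_measurable [measurable]: "(\<lambda>\<omega>. ecdf n (x \<omega>) \<tau>) \<in> borel_measurable M"
  unfolding ecdf_def by measurable

lemma Y_measurable [measurable]: "Y n \<tau> j \<in> borel_measurable M"
  unfolding Y_def[abs_def] block_dev_def by measurable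

lemma Y'_measurable [measurable]: "Y' n j \<in> borel_measurable M"
  unfolding Y'_def[abs_def] by measurable

lemma ecdf_01: "0 \<le> ecdf n z \<tau>" "ecdf n z \<tau> \<le> 1"
proof -
  have "(\<Sum>i=1..n. indicator {..\<tau>} (z i) :: real) \<le> (\<Sum>i=1..n. 1)" by (intro sum_mono) (auto simp: indicator_def)
  then show "ecdf n z \<tau> \<le> 1" by (cases "n = 0") (simp_all add: ecdf_def divide_le_eq)
qed (simp add: ecdf_def sum_nonneg)

lemma block_dev_abs_le: "\<bar>block_dev n L z \<tau> j\<bar> \<le> real L"
proof -
  have "\<bar>block_dev n L z \<tau> j\<bar> \<le> (\<Sum>r<L. 1)"
    unfolding block_dev_def using ecdf_01[of n z \<tau>]
    by (intro order_trans[OF sum_abs] sum_mono) (auto simp: indicator_def)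
  then show ?thesis by simp
qed

lemma Y_bdd: "\<exists>B. \<forall>\<omega>. \<bar>Y n \<tau> j \<omega>\<bar> \<le> B"
proof (intro exI allI)
  fix \<omega>
  show "\<bar>Y n \<tau> j \<omega>\<bar> \<le> real (l n) / (sqrt v * sqrt (real (l n)))"
    unfolding Y_def using block_dev_abs_le v by (simp add: abs_mult divide_right_mono)
qed

lemma Y'_bdd: "\<exists>B. \<forall>\<omega>. \<bar>Y' n j \<omega>\<bar> \<le> B"
proof (intro exI allI)
  fix \<omega>
  show "\<bar>Y' n j \<omega>\<bar> \<le> real (l n) / (sqrt v * sqrt (real (l n)))"
    unfolding Y'_def using S_abs_le v by (simp add: abs_mult divide_right_mono)
qed

lemma bdd_sq_integrable:
  assumes [measurable]: "f \<in> borel_measurable M" and "\<exists>B. \<forall>\<omega>. \<bar>f \<omega>\<bar> \<le> (B::real)"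
  shows "integrable M f" "integrable M (\<lambda>\<omega>. (f \<omega>)\<^sup>2)"
proof -
  obtain B where B: "\<And>\<omega>. \<bar>f \<omega>\<bar> \<le> B" using assms(2) by auto
  show "integrable M f" by (rule integrable_bounded[where B=B]) (use B in auto)
  show "integrable M (\<lambda>\<omega>. (f \<omega>)\<^sup>2)"
    by (rule integrable_bounded[where B="B\<^sup>2"]) (use power_mono[OF B, of _ 2] in auto)
qed

lemmas Y_int = bdd_sq_integrable[OF Y_measurable Y_bdd]
lemmas Y'_int = bdd_sq_integrable[OF Y'_measurable Y'_bdd]

lemma Y_diff_int: "integrable M (\<lambda>\<omega>. (Y n \<tau> j \<omega> - Y' n j \<omega>)\<^sup>2)"
proof (rule bdd_sq_integrable(2))
  obtain B B' where "\<And>\<omega>. \<bar>Y n \<tau> j \<omega>\<bar> \<le> B" "\<And>\<omega>. \<bar>Y' n j \<omega>\<bar> \<le> B'" using Y_bdd Y'_bdd by metis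
  then have "\<bar>Y n \<tau> j \<omega> - Y' n j \<omega>\<bar> \<le> B + B'" for \<omega> using abs_triangle_ineq4 by (meson add_mono order_trans)
  then show "\<exists>B. \<forall>\<omega>. \<bar>Y n \<tau> j \<omega> - Y' n j \<omega>\<bar> \<le> B" by blast
qed measurable

section \<open>Second moments of the empirical process and its increments\<close>

lemma centred_ind_second_moment:
  assumes "finite I" "\<And>i. i \<in> I \<Longrightarrow> 1 \<le> i"
  shows "expectation (\<lambda>\<omega>. (\<Sum>i\<in>I. indicator {..\<tau>} (x \<omega> i) - F \<tau>)\<^sup>2) \<le> real (card I) * \<gamma> 1"
proof (rule second_moment_le[OF _ _ _ _ assms])
  show "\<bar>indicator {..\<tau>} z - F \<tau>\<bar> \<le> 1" for z :: real using F01[of \<tau>] by (auto simp: indicator_def)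
  then show "expectation (\<lambda>\<omega>. \<bar>indicator {..\<tau>} (X 1 \<omega>) - F \<tau>\<bar>) \<le> 1"
    by (intro integral_le_const) (auto intro!: integrable_abs Bochner_Integration.integrable_diff ind_integrable)
  show "expectation (\<lambda>\<omega>. indicator {..\<tau>} (X 1 \<omega>) - F \<tau>) = 0"
    using ind_integrable by (simp add: expectation_ind prob_space)
qed measurable

text \<open>Bounds the first absolute moment of \<open>incr \<tau>\<close>: the difference of the
  indicators and its centring contribute \<open>\<bar>F \<tau> - p\<bar>\<close> each.\<close>

definition B :: "real \<Rightarrow> real" where "B \<tau> = 2 * \<bar>F \<tau> - p\<bar>"

definition incr :: "real \<Rightarrow> real \<Rightarrow> real" where
  "incr \<tau> z = (indicator {..\<tau>} z - F \<tau>) - (indicator {..tp} z - p)"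

lemma incr_measurable [measurable]: "incr \<tau> \<in> borel_measurable borel"
  unfolding incr_def[abs_def] by measurable

text \<open>The difference of the indicators and its mean \<open>F \<tau> - p\<close> lie on the
  same side of 0 and have modulus at most 1, so subtracting one from the other does not leave
  \<open>[-1, 1]\<close>.\<close>

lemma incr_le_1: "\<bar>incr \<tau> z\<bar> \<le> 1"
proof -
  show ?thesis
  proof (cases "\<tau> \<le> tp")
    case True
    then show ?thesis using F_mono[OF True] F01[of \<tau>] p01 F_tp by (auto simp: incr_def indicator_def)
  next
    case False
    then show ?thesis using F_mono[of tp \<tau>] F01[of \<tau>] p01 F_tp by (auto simp: incr_def indicator_def)
  qed
qed

lemma incr_second_moment:
  assumes "finite I" "\<And>i. i \<in> I \<Longrightarrow> 1 \<le> i"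
  shows "expectation (\<lambda>\<omega>. (\<Sum>i\<in>I. incr \<tau> (x \<omega> i))\<^sup>2) \<le> real (card I) * \<gamma> (B \<tau>)"
proof (rule second_moment_le[OF incr_measurable incr_le_1 _ _ assms])
  have inti: "integrable M (\<lambda>\<omega>. indicator {..t} (X 1 \<omega>) - c :: real)" for t c
    by (intro Bochner_Integration.integrable_diff ind_integrable) simp
  show "expectation (\<lambda>\<omega>. incr \<tau> (X 1 \<omega>)) = 0"
    unfolding incr_def using ind_integrable by (simp add: inti expectation_ind prob_space F_tp)
  have abs_ind: "\<bar>indicator {..\<tau>} z - indicator {..tp} z\<bar> = (if tp \<le> \<tau> then 1 else - 1) * (indicator {..\<tau>} z - indicator {..tp} z :: real)" for z
    by (auto simp: indicator_def)
  have "expectation (\<lambda>\<omega>. \<bar>incr \<tau> (X 1 \<omega>)\<bar>) \<le> expectation (\<lambda>\<omega>. (if tp \<le> \<tau> then 1 else - 1) * (indicator {..\<tau>} (X 1 \<omega>) - indicator {..tp} (X 1 \<omega>)) + \<bar>F \<tau> - p\<bar>)"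
  proof (rule integral_mono)
    show "integrable M (\<lambda>\<omega>. \<bar>incr \<tau> (X 1 \<omega>)\<bar>)"
      unfolding incr_def by (intro integrable_abs Bochner_Integration.integrable_diff inti)
    show "integrable M (\<lambda>\<omega>. (if tp \<le> \<tau> then 1 else - 1) * (indicator {..\<tau>} (X 1 \<omega>) - indicator {..tp} (X 1 \<omega>)) + \<bar>F \<tau> - p\<bar>)"
      by (intro Bochner_Integration.integrable_add integrable_mult_right Bochner_Integration.integrable_diff ind_integrable) simp
    fix \<omega>
    show "\<bar>incr \<tau> (X 1 \<omega>)\<bar> \<le> (if tp \<le> \<tau> then 1 else - 1) * (indicator {..\<tau>} (X 1 \<omega>) - indicator {..tp} (X 1 \<omega>)) + \<bar>F \<tau> - p\<bar>"
      unfolding abs_ind[symmetric] incr_def by linarith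
  qed
  also have "\<dots> = (if tp \<le> \<tau> then 1 else - 1) * (F \<tau> - p) + \<bar>F \<tau> - p\<bar>"
    using ind_integrable by (simp add: expectation_ind prob_space F_tp)
  also have "\<dots> \<le> B \<tau>" by (auto simp: B_def)
  finally show "expectation (\<lambda>\<omega>. \<bar>incr \<tau> (X 1 \<omega>)\<bar>) \<le> B \<tau>" .
qed

lemma ecdf_minus_F: "1 \<le> n \<Longrightarrow> ecdf n (x \<omega>) \<tau> - F \<tau> = (\<Sum>i\<in>{1..n}. indicator {..\<tau>} (x \<omega> i) - F \<tau>) / real n"
  by (simp add: ecdf_def sum_subtractf diff_divide_distrib)

lemma ecdf_second_moment:
  assumes "1 \<le> n" shows "expectation (\<lambda>\<omega>. (ecdf n (x \<omega>) \<tau> - F \<tau>)\<^sup>2) \<le> \<gamma> 1 / real n"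
proof -
  have "expectation (\<lambda>\<omega>. (ecdf n (x \<omega>) \<tau> - F \<tau>)\<^sup>2) = expectation (\<lambda>\<omega>. (\<Sum>i\<in>{1..n}. indicator {..\<tau>} (x \<omega> i) - F \<tau>)\<^sup>2) / (real n)\<^sup>2"
    unfolding ecdf_minus_F[OF assms] power_divide by simp
  also have "\<dots> \<le> (real n * \<gamma> 1) / (real n)\<^sup>2"
    using centred_ind_second_moment[of "{1..n}" \<tau>] by (intro divide_right_mono) auto
  also have "\<dots> = \<gamma> 1 / real n" using assms by (simp add: power2_eq_square)
  finally show ?thesis .
qed

lemma ecdf_dev_int: "integrable M (\<lambda>\<omega>. (ecdf n (x \<omega>) \<tau> - F \<tau>)\<^sup>2)"
proof (rule bdd_sq_integrable(2))
  have "\<bar>ecdf n (x \<omega>) \<tau> - F \<tau>\<bar> \<le> 1" for \<omega> using ecdf_01[of n "x \<omega>" \<tau>] F01[of \<tau>] by linarith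
  then show "\<exists>B. \<forall>\<omega>. \<bar>ecdf n (x \<omega>) \<tau> - F \<tau>\<bar> \<le> B" by blast
qed measurable

text \<open>The random centring of a block sum costs a term of order \<open>l n / n\<close>.\<close>

lemma centred_block_second_moment:
  assumes n: "1 \<le> n" and f [measurable]: "f \<in> borel_measurable M" and fb: "\<exists>C. \<forall>\<omega>. \<bar>f \<omega>\<bar> \<le> (C::real)"
    and fE: "expectation (\<lambda>\<omega>. (f \<omega>)\<^sup>2) \<le> real (l n) * \<Gamma>"
  shows "expectation (\<lambda>\<omega>. ((f \<omega> - real (l n) * (ecdf n (x \<omega>) \<tau> - F \<tau>)) / (sqrt v * sqrt (real (l n))))\<^sup>2)
    \<le> 2 / v * (\<Gamma> + real (l n) / real n * \<gamma> 1)"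
proof -
  let ?e = "\<lambda>\<omega>. ecdf n (x \<omega>) \<tau> - F \<tau>" and ?L = "real (l n)"
  have L: "0 < ?L" using l(1)[OF n] by simp
  have "expectation (\<lambda>\<omega>. ((f \<omega> - ?L * ?e \<omega>) / (sqrt v * sqrt ?L))\<^sup>2)
      \<le> expectation (\<lambda>\<omega>. (2 * (f \<omega>)\<^sup>2 + 2 * (?L\<^sup>2 * (?e \<omega>)\<^sup>2)) / (v * ?L))"
  proof (rule integral_mono)
    have int: "integrable M (\<lambda>\<omega>. (2 * (f \<omega>)\<^sup>2 + 2 * (?L\<^sup>2 * (?e \<omega>)\<^sup>2)) / (v * ?L))"
      by (intro integrable_divide Bochner_Integration.integrable_add integrable_mult_right bdd_sq_integrable[OF f fb] ecdf_dev_int)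
    then show "integrable M (\<lambda>\<omega>. (2 * (f \<omega>)\<^sup>2 + 2 * (?L\<^sup>2 * (?e \<omega>)\<^sup>2)) / (v * ?L))" .
    fix \<omega>
    have "(f \<omega> + - (?L * ?e \<omega>))\<^sup>2 \<le> 2 * (f \<omega>)\<^sup>2 + 2 * (- (?L * ?e \<omega>))\<^sup>2" by (rule sq_add_le)
    then have "(f \<omega> - ?L * ?e \<omega>)\<^sup>2 / (v * ?L) \<le> (2 * (f \<omega>)\<^sup>2 + 2 * (?L\<^sup>2 * (?e \<omega>)\<^sup>2)) / (v * ?L)"
      using v L by (intro divide_right_mono) (auto simp: power_mult_distrib)
    moreover have "(sqrt v * sqrt ?L)\<^sup>2 = v * ?L" using v L by (simp add: power_mult_distrib)
    ultimately show le: "((f \<omega> - ?L * ?e \<omega>) / (sqrt v * sqrt ?L))\<^sup>2 \<le> (2 * (f \<omega>)\<^sup>2 + 2 * (?L\<^sup>2 * (?e \<omega>)\<^sup>2)) / (v * ?L)"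
      by (simp add: power_divide)
  next
    obtain C where C: "\<And>\<omega>. \<bar>f \<omega>\<bar> \<le> C" using fb by auto
    have e1: "\<bar>?e \<omega>\<bar> \<le> 1" for \<omega> using ecdf_01[of n "x \<omega>" \<tau>] F01[of \<tau>] by linarith
    have bd: "\<bar>(f \<omega> - ?L * ?e \<omega>) / (sqrt v * sqrt ?L)\<bar> \<le> (C + ?L * 1) / (sqrt v * sqrt ?L)" for \<omega>
    proof -
      have "\<bar>f \<omega> - ?L * ?e \<omega>\<bar> \<le> \<bar>f \<omega>\<bar> + ?L * \<bar>?e \<omega>\<bar>"
        using abs_triangle_ineq4[of "f \<omega>" "?L * ?e \<omega>"] by (simp add: abs_mult)
      also have "\<dots> \<le> C + ?L * 1" using C e1 by (intro add_mono mult_left_mono) auto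
      finally show ?thesis using v L by (simp add: abs_mult divide_right_mono)
    qed
    show "integrable M (\<lambda>\<omega>. ((f \<omega> - ?L * ?e \<omega>) / (sqrt v * sqrt ?L))\<^sup>2)"
      by (rule bdd_sq_integrable(2)) (use bd in \<open>measurable, blast\<close>)
  qed
  also have "\<dots> = (2 * expectation (\<lambda>\<omega>. (f \<omega>)\<^sup>2) + 2 * (?L\<^sup>2 * expectation (\<lambda>\<omega>. (?e \<omega>)\<^sup>2))) / (v * ?L)"
    using bdd_sq_integrable[OF f fb] ecdf_dev_int by simp
  also have "\<dots> \<le> (2 * (?L * \<Gamma>) + 2 * (?L\<^sup>2 * (\<gamma> 1 / real n))) / (v * ?L)"
    using v L fE ecdf_second_moment[OF n, of \<tau>] by (intro divide_right_mono add_mono mult_left_mono) auto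
  also have "\<dots> = 2 / v * (\<Gamma> + ?L / real n * \<gamma> 1)"
    using v L by (simp add: power2_eq_square field_simps)
  finally show ?thesis .
qed

section \<open>Comparison of circular and stationary block sums\<close>

lemma Y_eq:
  "Y n \<tau> j \<omega> = ((\<Sum>r<l n. indicator {..\<tau>} (x \<omega> (wrap n (j + r))) - F \<tau>) - real (l n) * (ecdf n (x \<omega>) \<tau> - F \<tau>)) / (sqrt v * sqrt (real (l n)))"
  by (simp add: Y_def block_dev_def sum_subtractf algebra_simps)

text \<open>A crude bound that also covers blocks that wrap around; for these the difference to
  \<open>Y'\<close> need not be small.\<close>

lemma Y_second_moment:
  assumes n: "1 \<le> n" and j: "1 \<le> j"
  shows "expectation (\<lambda>\<omega>. (Y n \<tau> j \<omega>)\<^sup>2) \<le> 4 / v * \<gamma> 1"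
proof -
  have \<gamma>: "0 \<le> \<gamma> 1" by (rule \<gamma>_nonneg) simp
  let ?I = "(\<lambda>r. wrap n (j + r)) ` {..<l n}"
  have inj: "inj_on (\<lambda>r. wrap n (j + r)) {..<l n}" by (rule wrap_inj_block[OF j l(2)[OF n]])
  have sumI: "(\<Sum>r<l n. indicator {..\<tau>} (x \<omega> (wrap n (j + r))) - F \<tau>) = (\<Sum>i\<in>?I. indicator {..\<tau>} (x \<omega> i) - F \<tau>)" for \<omega>
    by (simp add: sum.reindex[OF inj])
  have "expectation (\<lambda>\<omega>. (Y n \<tau> j \<omega>)\<^sup>2) \<le> 2 / v * (\<gamma> 1 + real (l n) / real n * \<gamma> 1)"
    unfolding Y_eq
  proof (rule centred_block_second_moment[OF n])
    show "(\<lambda>\<omega>. \<Sum>r<l n. indicator {..\<tau>} (x \<omega> (wrap n (j + r))) - F \<tau>) \<in> borel_measurable M" by measurable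
    have "\<bar>\<Sum>r<l n. indicator {..\<tau>} (x \<omega> (wrap n (j + r))) - F \<tau>\<bar> \<le> (\<Sum>r<l n. 1)" for \<omega>
      using F01[of \<tau>] by (intro order_trans[OF sum_abs] sum_mono) (auto simp: indicator_def)
    then show "\<exists>C. \<forall>\<omega>. \<bar>\<Sum>r<l n. indicator {..\<tau>} (x \<omega> (wrap n (j + r))) - F \<tau>\<bar> \<le> C" by blast
    have "expectation (\<lambda>\<omega>. (\<Sum>i\<in>?I. indicator {..\<tau>} (x \<omega> i) - F \<tau>)\<^sup>2) \<le> real (card ?I) * \<gamma> 1"
      by (rule centred_ind_second_moment) (use wrap_in[OF n] in auto)
    then show "expectation (\<lambda>\<omega>. (\<Sum>r<l n. indicator {..\<tau>} (x \<omega> (wrap n (j + r))) - F \<tau>)\<^sup>2) \<le> real (l n) * \<gamma> 1"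
      unfolding sumI by (simp add: card_image[OF inj])
  qed
  also have "\<dots> \<le> 2 / v * (\<gamma> 1 + 1 * \<gamma> 1)"
    using v \<gamma> n l(2)[OF n] by (intro mult_left_mono add_mono mult_right_mono) (auto simp: divide_le_eq)
  finally show ?thesis by simp
qed

lemma Y'_sq: "1 \<le> n \<Longrightarrow> (Y' n j \<omega>)\<^sup>2 = (S j (l n) \<omega>)\<^sup>2 / (v * real (l n))"
  using v by (simp add: Y'_def power_divide power_mult_distrib)

lemma Y'_stationary:
  fixes f :: "real \<Rightarrow> real"
  assumes "f \<in> borel_measurable borel"
  shows "expectation (\<lambda>\<omega>. f (Y' n j \<omega>)) = expectation (\<lambda>\<omega>. f (Y' n 1 \<omega>))"
  unfolding Y'_def by (rule S_stationary[of "\<lambda>z. f (z / (sqrt v * sqrt (real (l n))))"]) (use assms in measurable)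

lemma Y'_second_moment: "1 \<le> n \<Longrightarrow> expectation (\<lambda>\<omega>. (Y' n j \<omega>)\<^sup>2) \<le> \<gamma> 1 / v"
proof -
  assume n: "1 \<le> n"
  have "expectation (\<lambda>\<omega>. (Y' n j \<omega>)\<^sup>2) = expectation (\<lambda>\<omega>. (Y' n 1 \<omega>)\<^sup>2)" by (rule Y'_stationary) measurable
  also have "\<dots> = expectation (\<lambda>\<omega>. (S 1 (l n) \<omega>)\<^sup>2) / (v * real (l n))" by (simp add: Y'_sq[OF n])
  also have "\<dots> \<le> (real (l n) * \<gamma> 1) / (v * real (l n))" using v by (intro divide_right_mono S_second_moment) auto
  also have "\<dots> = \<gamma> 1 / v" using l(1)[OF n] by simp
  finally show ?thesis .
qed

text \<open>Without wrapping, the difference to \<open>Y'\<close> is a block sum of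
  \<open>incr \<tau>\<close> up to the random centring, hence small once \<open>F \<tau>\<close> is
  near \<open>p\<close> and \<open>l n / n\<close> is small.\<close>

lemma Y_diff_inner:
  assumes n: "1 \<le> n" and j: "1 \<le> j" "j + l n \<le> n + 1"
  shows "expectation (\<lambda>\<omega>. (Y n \<tau> j \<omega> - Y' n j \<omega>)\<^sup>2) \<le> 2 / v * (\<gamma> (B \<tau>) + real (l n) / real n * \<gamma> 1)"
proof -
  have w: "wrap n (j + r) = j + r" if "r < l n" for r using that j by (intro wrap_id) auto
  have eq: "Y n \<tau> j \<omega> - Y' n j \<omega> = ((\<Sum>r<l n. incr \<tau> (x \<omega> (j + r))) - real (l n) * (ecdf n (x \<omega>) \<tau> - F \<tau>)) / (sqrt v * sqrt (real (l n)))" for \<omega>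
  proof -
    have "(\<Sum>r<l n. indicator {..\<tau>} (x \<omega> (wrap n (j + r))) - F \<tau>) - S j (l n) \<omega> = (\<Sum>r<l n. incr \<tau> (x \<omega> (j + r)))"
      unfolding S_def sum_subtractf[symmetric] by (rule sum.cong) (auto simp: w incr_def)
    then show ?thesis unfolding Y_eq Y'_def diff_divide_distrib[symmetric] by (intro arg_cong2[where f="(/)"] refl) (simp only: algebra_simps)
  qed
  show ?thesis unfolding eq
  proof (rule centred_block_second_moment[OF n])
    show "(\<lambda>\<omega>. \<Sum>r<l n. incr \<tau> (x \<omega> (j + r))) \<in> borel_measurable M" by measurable
    have "\<bar>\<Sum>r<l n. incr \<tau> (x \<omega> (j + r))\<bar> \<le> (\<Sum>r<l n. 1)" for \<omega>
      by (intro order_trans[OF sum_abs] sum_mono incr_le_1)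
    then show "\<exists>C. \<forall>\<omega>. \<bar>\<Sum>r<l n. incr \<tau> (x \<omega> (j + r))\<bar> \<le> C" by blast
    have "(\<Sum>r<l n. incr \<tau> (x \<omega> (j + r))) = (\<Sum>i\<in>{j..<j + l n}. incr \<tau> (x \<omega> i))" for \<omega>
      by (rule sum.reindex_bij_witness[of _ "\<lambda>i. i - j" "\<lambda>r. j + r"]) auto
    moreover have "expectation (\<lambda>\<omega>. (\<Sum>i\<in>{j..<j + l n}. incr \<tau> (x \<omega> i))\<^sup>2) \<le> real (card {j..<j + l n}) * \<gamma> (B \<tau>)"
      by (rule incr_second_moment) (use j in auto)
    ultimately show "expectation (\<lambda>\<omega>. (\<Sum>r<l n. incr \<tau> (x \<omega> (j + r)))\<^sup>2) \<le> real (l n) * \<gamma> (B \<tau>)" by simp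
  qed
qed

text \<open>A bounded error suffices here, because fewer than \<open>l n\<close> of the
  \<open>n\<close> starting points give a block that wraps around.\<close>

lemma Y_diff_outer:
  assumes n: "1 \<le> n" and j: "1 \<le> j"
  shows "expectation (\<lambda>\<omega>. (Y n \<tau> j \<omega> - Y' n j \<omega>)\<^sup>2) \<le> 10 / v * \<gamma> 1"
proof -
  have "expectation (\<lambda>\<omega>. (Y n \<tau> j \<omega> - Y' n j \<omega>)\<^sup>2) \<le> expectation (\<lambda>\<omega>. 2 * (Y n \<tau> j \<omega>)\<^sup>2 + 2 * (Y' n j \<omega>)\<^sup>2)"
  proof (rule integral_mono[OF Y_diff_int])
    show "integrable M (\<lambda>\<omega>. 2 * (Y n \<tau> j \<omega>)\<^sup>2 + 2 * (Y' n j \<omega>)\<^sup>2)" using Y_int Y'_int by simp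
    show "(Y n \<tau> j \<omega> - Y' n j \<omega>)\<^sup>2 \<le> 2 * (Y n \<tau> j \<omega>)\<^sup>2 + 2 * (Y' n j \<omega>)\<^sup>2" for \<omega>
      using sq_add_le[of "Y n \<tau> j \<omega>" "- Y' n j \<omega>"] by simp
  qed
  also have "\<dots> = 2 * expectation (\<lambda>\<omega>. (Y n \<tau> j \<omega>)\<^sup>2) + 2 * expectation (\<lambda>\<omega>. (Y' n j \<omega>)\<^sup>2)"
    using Y_int Y'_int by simp
  also have "\<dots> \<le> 2 * (4 / v * \<gamma> 1) + 2 * (\<gamma> 1 / v)"
    using Y_second_moment[OF n j] Y'_second_moment[OF n] by (intro add_mono mult_left_mono) auto
  finally show ?thesis by simp
qed

definition D :: "nat \<Rightarrow> real \<Rightarrow> real" where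
  "D n \<tau> = expectation (\<lambda>\<omega>. (\<Sum>j=1..n. (Y n \<tau> j \<omega> - Y' n j \<omega>)\<^sup>2) / real n)"

lemma D_bound:
  assumes n: "1 \<le> n"
  shows "D n \<tau> \<le> 2 / v * (\<gamma> (B \<tau>) + real (l n) / real n * \<gamma> 1) + real (l n) / real n * (10 / v * \<gamma> 1)"
proof -
  let ?E = "\<lambda>j. expectation (\<lambda>\<omega>. (Y n \<tau> j \<omega> - Y' n j \<omega>)\<^sup>2)"
  let ?a = "2 / v * (\<gamma> (B \<tau>) + real (l n) / real n * \<gamma> 1)" and ?c = "10 / v * \<gamma> 1"
  have a: "0 \<le> ?a" using v by (intro mult_nonneg_nonneg add_nonneg_nonneg \<gamma>_nonneg) (auto simp: B_def)
  have c: "0 \<le> ?c" using v by (intro mult_nonneg_nonneg \<gamma>_nonneg) auto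
  have "(\<Sum>j=1..n. ?E j) \<le> (\<Sum>j=1..n. ?a + (if n + 1 < j + l n then ?c else 0))"
  proof (rule sum_mono)
    fix j assume j: "j \<in> {1..n}"
    show "?E j \<le> ?a + (if n + 1 < j + l n then ?c else 0)"
    proof (cases "n + 1 < j + l n")
      case True then show ?thesis using Y_diff_outer[OF n, of j \<tau>] j a by simp
    next
      case False then show ?thesis using Y_diff_inner[OF n, of j \<tau>] j by simp
    qed
  qed
  also have "\<dots> = real n * ?a + (\<Sum>j\<in>{j\<in>{1..n}. n + 1 < j + l n}. ?c)"
    by (simp only: sum.distrib sum.inter_filter[OF finite_atLeastAtMost, symmetric]) simp
  also have "(\<Sum>j\<in>{j\<in>{1..n}. n + 1 < j + l n}. ?c) \<le> real (l n) * ?c"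
  proof -
    have "{j\<in>{1..n}. n + 1 < j + l n} \<subseteq> {n + 1 - l n..<n + 1}" by auto
    then have "card {j\<in>{1..n}. n + 1 < j + l n} \<le> card {n + 1 - l n..<n + 1}" by (rule card_mono[rotated]) simp
    also have "\<dots> \<le> l n" by simp
    finally have "real (card {j\<in>{1..n}. n + 1 < j + l n}) * ?c \<le> real (l n) * ?c"
      using c by (intro mult_right_mono) auto
    then show ?thesis by (simp only: sum_constant)
  qed
  finally have "(\<Sum>j=1..n. ?E j) / real n \<le> (real n * ?a + real (l n) * ?c) / real n"
    by (intro divide_right_mono) auto
  also have "\<dots> = ?a + real (l n) / real n * ?c" using n by (simp add: add_divide_distrib)
  finally show ?thesis unfolding D_def using Y_diff_int by simp
qed

lemma D_nonneg: "0 \<le> D n \<tau>"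
  unfolding D_def by (intro integral_nonneg_AE AE_I2 divide_nonneg_nonneg sum_nonneg) auto

lemma D_lim:
  assumes "(\<lambda>n. F (\<tau> n)) \<longlonglongrightarrow> p" shows "(\<lambda>n. D n (\<tau> n)) \<longlonglongrightarrow> 0"
proof (rule tendsto_sandwich[OF _ _ tendsto_const])
  have "(\<lambda>n. B (\<tau> n)) \<longlonglongrightarrow> 2 * \<bar>p - p\<bar>" unfolding B_def by (intro tendsto_intros assms)
  then have g: "(\<lambda>n. \<gamma> (B (\<tau> n))) \<longlonglongrightarrow> 0" by (intro \<gamma>_tendsto_0) (auto simp: B_def)
  have "(\<lambda>n. 2 / v * (\<gamma> (B (\<tau> n)) + real (l n) / real n * \<gamma> 1) + real (l n) / real n * (10 / v * \<gamma> 1)) \<longlonglongrightarrow> 2 / v * (0 + 0 * \<gamma> 1) + 0 * (10 / v * \<gamma> 1)"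
    by (intro tendsto_add tendsto_mult tendsto_const g l_div_lim)
  then show "(\<lambda>n. 2 / v * (\<gamma> (B (\<tau> n)) + real (l n) / real n * \<gamma> 1) + real (l n) / real n * (10 / v * \<gamma> 1)) \<longlonglongrightarrow> 0" by simp
  show "\<forall>\<^sub>F n in sequentially. D n (\<tau> n) \<le> 2 / v * (\<gamma> (B (\<tau> n)) + real (l n) / real n * \<gamma> 1) + real (l n) / real n * (10 / v * \<gamma> 1)"
    using eventually_ge_at_top[of 1] by eventually_elim (rule D_bound)
qed (simp add: D_nonneg)

text \<open>The conditional variance of a normalised bootstrap block, given the data;
  \<open>resample_clt\<close> asks for it to be near 1.\<close>

definition V :: "nat \<Rightarrow> real \<Rightarrow> 'a \<Rightarrow> real" where
  "V n \<tau> \<omega> = (\<Sum>j=1..n. (Y n \<tau> j \<omega>)\<^sup>2) / real n"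

definition V' :: "nat \<Rightarrow> 'a \<Rightarrow> real" where
  "V' n \<omega> = (\<Sum>j=1..n. (Y' n j \<omega>)\<^sup>2) / real n"

lemma V_int: "integrable M (V n \<tau>)"
  unfolding V_def[abs_def] by (intro integrable_divide Bochner_Integration.integrable_sum Y_int)

lemma V'_int: "integrable M (V' n)"
  unfolding V'_def[abs_def] by (intro integrable_divide Bochner_Integration.integrable_sum Y'_int)

section \<open>Law of large numbers for the squared block sums\<close>

definition m2 :: "nat \<Rightarrow> real" where
  "m2 n = expectation (\<lambda>\<omega>. (Y' n 1 \<omega>)\<^sup>2)"

lemma m2_lim: "m2 \<longlonglongrightarrow> 1"
proof -
  have "(\<lambda>n. expectation (\<lambda>\<omega>. (S 1 n \<omega>)\<^sup>2) / real n / v) \<longlonglongrightarrow> v / v"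
    using v_lim v by (intro tendsto_divide tendsto_const) (simp_all add: S_def)
  then have "(\<lambda>n. expectation (\<lambda>\<omega>. (S 1 (l n) \<omega>)\<^sup>2) / real (l n) / v) \<longlonglongrightarrow> 1"
    using v by (intro filterlim_compose[OF _ l_inf]) simp
  then show ?thesis
  proof (rule Lim_transform_eventually)
    show "\<forall>\<^sub>F n in sequentially. expectation (\<lambda>\<omega>. (S 1 (l n) \<omega>)\<^sup>2) / real (l n) / v = m2 n"
      using eventually_ge_at_top[of 1]
      by eventually_elim (use v in \<open>simp add: m2_def Y'_sq mult.commute\<close>)
  qed
qed

lemma V'_mean: "1 \<le> n \<Longrightarrow> expectation (V' n) = m2 n"
proof -
  assume n: "1 \<le> n"
  have "expectation (\<lambda>\<omega>. (Y' n j \<omega>)\<^sup>2) = m2 n" for j unfolding m2_def by (rule Y'_stationary) measurable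
  then show ?thesis unfolding V'_def[abs_def] using n Y'_int by simp
qed

definition excess :: "real \<Rightarrow> nat \<Rightarrow> real" where
  "excess K n = expectation (\<lambda>\<omega>. max 0 ((Y' n 1 \<omega>)\<^sup>2 - K))"

lemma excess_nonneg: "0 \<le> excess K n"
  unfolding excess_def by (rule integral_nonneg_AE) simp

lemma excess_small:
  assumes "0 < \<epsilon>" shows "\<exists>K>0. eventually (\<lambda>n. excess K n < \<epsilon>) sequentially"
proof -
  obtain K where K: "0 < K" "eventually (\<lambda>n. expectation (\<lambda>\<omega>. max 0 ((S 1 n \<omega>)\<^sup>2 / (v * real n) - K)) < \<epsilon>) sequentially"
    using truncated_excess[OF assms] by auto
  have "eventually (\<lambda>n. expectation (\<lambda>\<omega>. max 0 ((S 1 (l n) \<omega>)\<^sup>2 / (v * real (l n)) - K)) < \<epsilon>) sequentially"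
    by (rule eventually_compose_filterlim[OF K(2) l_inf])
  with eventually_ge_at_top[of 1] have "eventually (\<lambda>n. excess K n < \<epsilon>) sequentially"
    by eventually_elim (simp add: excess_def Y'_sq)
  with K(1) show ?thesis by blast
qed

lemma excess_int: "integrable M (\<lambda>\<omega>. max 0 ((Y' n j \<omega>)\<^sup>2 - K))"
  by (intro Bochner_Integration.integrable_max Bochner_Integration.integrable_diff Y'_int) auto

lemma excess_stationary: "expectation (\<lambda>\<omega>. max 0 ((Y' n j \<omega>)\<^sup>2 - K)) = excess K n"
  unfolding excess_def by (rule Y'_stationary) measurable

text \<open>Truncated squares of block sums are bounded, so their average has variance \<open>O(l n / n)\<close>.\<close>

lemma truncated_average:
  assumes n: "1 \<le> n" and K: "0 < K"
  defines "\<mu> \<equiv> expectation (\<lambda>\<omega>. min ((Y' n 1 \<omega>)\<^sup>2) K)"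
  shows "expectation (\<lambda>\<omega>. \<bar>(\<Sum>j=1..n. min ((Y' n j \<omega>)\<^sup>2) K) / real n - \<mu>\<bar>)
    \<le> K * sqrt (2 * (real (l n) / real n + 4 * suminf \<alpha> / real n))"
proof -
  define U where "U j \<omega> = (min ((Y' n j \<omega>)\<^sup>2) K - \<mu>) / K" for j \<omega>
  have mean: "expectation (\<lambda>\<omega>. min ((Y' n j \<omega>)\<^sup>2) K) = \<mu>" for j unfolding \<mu>_def by (rule Y'_stationary) measurable
  have int_min: "integrable M (\<lambda>\<omega>. min ((Y' n j \<omega>)\<^sup>2) K)" for j
    by (rule integrable_bounded[where B=K]) (use K in auto)
  have \<mu>: "0 \<le> \<mu>" "\<mu> \<le> K"
    unfolding \<mu>_def using int_min[of 1] K by (auto intro!: integral_nonneg_AE integral_le_const)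
  have U1: "\<bar>U j \<omega>\<bar> \<le> 1" for j \<omega>
  proof -
    have "0 \<le> min ((Y' n j \<omega>)\<^sup>2) K" "min ((Y' n j \<omega>)\<^sup>2) K \<le> K" using K by auto
    then have "\<bar>min ((Y' n j \<omega>)\<^sup>2) K - \<mu>\<bar> \<le> K" using \<mu> by linarith
    then show ?thesis using K by (simp add: U_def)
  qed
  have [measurable]: "U j \<in> borel_measurable M" for j unfolding U_def[abs_def] by measurable
  have U0: "expectation (U j) = 0" for j
    unfolding U_def[abs_def] using int_min mean by (simp add: prob_space)
  have UF: "U j \<in> borel_measurable (\<F> I)" if "{int j..<int (j + l n)} \<subseteq> I" for j I
  proof -
    have "S j (l n) \<in> borel_measurable (\<F> I)" using that by (rule S_gen_sigma)
    then show ?thesis unfolding U_def[abs_def] Y'_def by measurable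
  qed
  \<comment> \<open>At lags below \<open>l n\<close> the blocks overlap and only the trivial bound 1
    is available; from \<open>l n\<close> on they are disjoint and mixing applies. The series is
    \<open>l n\<close> plus a constant, which produces the order \<open>l n / n\<close>.\<close>
  define c where "c k = (if k < l n then 1 else 4 * \<alpha> (k - l n))" for k
  have c_shift: "c (k + l n) = 4 * \<alpha> k" for k by (simp add: c_def)
  have c_sum: "summable c"
    by (subst summable_iff_shift[symmetric, of _ "l n"]) (simp add: c_shift summable_mult summable_alpha)
  have c_suminf: "suminf c = real (l n) + 4 * suminf \<alpha>"
  proof -
    have "suminf c = (\<Sum>k. c (k + l n)) + (\<Sum>k<l n. c k)" by (rule suminf_split_initial_segment[OF c_sum])
    also have "(\<Sum>k. c (k + l n)) = 4 * suminf \<alpha>" unfolding c_shift by (rule suminf_mult[OF summable_alpha])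
    also have "(\<Sum>k<l n. c k) = real (l n)" by (simp add: c_def)
    finally show ?thesis by simp
  qed
  have "expectation (\<lambda>\<omega>. (\<Sum>j\<in>{1..n}. U j \<omega>)\<^sup>2) \<le> real (card {1..n}) * (2 * suminf c)"
  proof (rule second_moment_sum_le)
    show "integrable M (\<lambda>\<omega>. U i \<omega> * U j \<omega>)" for i j
      by (rule integrable_bounded[where B=1]) (auto simp: abs_mult mult_le_one U1)
    show "0 \<le> c k" for k by (simp add: c_def mixing_coeff_nonneg)
    fix i j assume ij: "i \<in> {1..n}" "j \<in> {1..n}" "i \<le> j"
    show "\<bar>expectation (\<lambda>\<omega>. U i \<omega> * U j \<omega>)\<bar> \<le> c (j - i)"
    proof (cases "j - i < l n")
      case True
      have "\<bar>expectation (\<lambda>\<omega>. U i \<omega> * U j \<omega>)\<bar> \<le> expectation (\<lambda>\<omega>. \<bar>U i \<omega> * U j \<omega>\<bar>)" by (rule integral_abs_bound)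
      also have "\<dots> \<le> 1"
        by (rule integral_le_const) (auto intro!: integrable_bounded[where B=1] simp: abs_mult mult_le_one U1)
      finally show ?thesis using True by (simp add: c_def)
    next
      case False
      let ?m = "int i + int (l n) - 1"
      have "\<bar>expectation (\<lambda>\<omega>. U i \<omega> * U j \<omega>) - expectation (U i) * expectation (U j)\<bar> \<le> 4 * \<alpha> (j - i - l n)"
      proof (rule cov_bounded[where n="?m"])
        show "U i \<in> borel_measurable (\<F> {1..?m})" by (rule UF) (use ij in auto)
        show "U j \<in> borel_measurable (\<F> {?m + int (j - i - l n)..})" by (rule UF) (use ij False in auto)
      qed (rule U1)+
      then show ?thesis using False by (simp add: c_def U0)
    qed
  qed (use c_sum in auto)
  then have sm: "expectation (\<lambda>\<omega>. (\<Sum>j\<in>{1..n}. U j \<omega>)\<^sup>2) \<le> real n * (2 * (real (l n) + 4 * suminf \<alpha>))"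
    by (simp add: c_suminf)
  have Ub: "\<bar>\<Sum>j\<in>{1..n}. U j \<omega>\<bar> \<le> real n" for \<omega>
  proof -
    have "\<bar>\<Sum>j\<in>{1..n}. U j \<omega>\<bar> \<le> (\<Sum>j\<in>{1..n}. 1)" by (intro order_trans[OF sum_abs] sum_mono U1)
    then show ?thesis by simp
  qed
  have "\<exists>B. \<forall>\<omega>. \<bar>\<Sum>j\<in>{1..n}. U j \<omega>\<bar> \<le> B" using Ub by blast
  note Uint = bdd_sq_integrable[OF _ this]
  have "(\<Sum>j=1..n. min ((Y' n j \<omega>)\<^sup>2) K) / real n - \<mu> = K * (\<Sum>j\<in>{1..n}. U j \<omega>) / real n" for \<omega>
  proof -
    have "K * (\<Sum>j\<in>{1..n}. U j \<omega>) = (\<Sum>j=1..n. min ((Y' n j \<omega>)\<^sup>2) K) - real n * \<mu>"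
      using K by (simp add: U_def sum_divide_distrib[symmetric] sum_subtractf)
    then show ?thesis using n by (simp add: diff_divide_distrib)
  qed
  then have "expectation (\<lambda>\<omega>. \<bar>(\<Sum>j=1..n. min ((Y' n j \<omega>)\<^sup>2) K) / real n - \<mu>\<bar>) = K / real n * expectation (\<lambda>\<omega>. \<bar>\<Sum>j\<in>{1..n}. U j \<omega>\<bar>)"
    using K by (simp add: abs_mult)
  also have "\<dots> \<le> K / real n * sqrt (expectation (\<lambda>\<omega>. (\<Sum>j\<in>{1..n}. U j \<omega>)\<^sup>2))"
    using K by (intro mult_left_mono expectation_abs_le_sqrt Uint) auto
  also have "\<dots> \<le> K / real n * sqrt (real n * (2 * (real (l n) + 4 * suminf \<alpha>)))"
    using K by (intro mult_left_mono real_sqrt_le_mono sm) auto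
  also have "\<dots> = K * (sqrt (real n * (2 * (real (l n) + 4 * suminf \<alpha>))) / sqrt ((real n)\<^sup>2))"
    by simp
  also have "\<dots> = K * sqrt (2 * (real (l n) / real n + 4 * suminf \<alpha> / real n))"
    unfolding real_sqrt_divide[symmetric] using n by (simp add: power2_eq_square add_divide_distrib)
  finally show ?thesis .
qed

text \<open>A weak law based on truncation: the truncated squares are handled by mixing, the excess
  over \<open>K\<close> by uniform integrability, which by stationarity is the same for all
  blocks.\<close>

lemma V'_lim: "(\<lambda>n. expectation (\<lambda>\<omega>. \<bar>V' n \<omega> - 1\<bar>)) \<longlonglongrightarrow> 0"
proof (rule LIMSEQ_I)
  fix r :: real assume r: "0 < r"
  obtain K where K: "0 < K" "eventually (\<lambda>n. excess K n < r / 4) sequentially"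
    using excess_small[of "r / 4"] r by auto
  define e where "e n = K * sqrt (2 * (real (l n) / real n + 4 * suminf \<alpha> / real n)) + \<bar>m2 n - 1\<bar>" for n
  have "e \<longlonglongrightarrow> K * sqrt (2 * (0 + 0)) + \<bar>1 - 1\<bar>"
    unfolding e_def by (intro tendsto_intros l_div_lim m2_lim lim_const_over_n)
  then have "e \<longlonglongrightarrow> 0" by simp
  then have "eventually (\<lambda>n. e n < r / 4) sequentially" using r by (intro order_tendstoD(2)) auto
  with K(2) eventually_ge_at_top[of 1] have "eventually (\<lambda>n. expectation (\<lambda>\<omega>. \<bar>V' n \<omega> - 1\<bar>) < r) sequentially"
  proof eventually_elim
    case (elim n)
    define \<mu> where "\<mu> = expectation (\<lambda>\<omega>. min ((Y' n 1 \<omega>)\<^sup>2) K)"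
    let ?T = "\<lambda>\<omega>. (\<Sum>j=1..n. min ((Y' n j \<omega>)\<^sup>2) K) / real n" and ?X = "\<lambda>\<omega>. (\<Sum>j=1..n. max 0 ((Y' n j \<omega>)\<^sup>2 - K)) / real n"
    have split: "(y::real) = min y K + max 0 (y - K)" for y by (simp add: min_def max_def)
    have int_min: "integrable M (\<lambda>\<omega>. min ((Y' n j \<omega>)\<^sup>2) K)" for j
      by (rule integrable_bounded[where B=K]) (use K in auto)
    have intT: "integrable M ?T" by (intro integrable_divide Bochner_Integration.integrable_sum int_min)
    have intX: "integrable M ?X" by (intro integrable_divide Bochner_Integration.integrable_sum excess_int)
    have "m2 n = expectation (\<lambda>\<omega>. min ((Y' n 1 \<omega>)\<^sup>2) K + max 0 ((Y' n 1 \<omega>)\<^sup>2 - K))"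
      unfolding m2_def by (rule Bochner_Integration.integral_cong[OF refl]) (rule split)
    also have "\<dots> = \<mu> + excess K n" unfolding \<mu>_def excess_def by (rule Bochner_Integration.integral_add[OF int_min excess_int])
    finally have \<mu>: "\<mu> = m2 n - excess K n" by simp
    have V': "V' n \<omega> = ?T \<omega> + ?X \<omega>" for \<omega>
      unfolding V'_def add_divide_distrib[symmetric] sum.distrib[symmetric] by (subst split) (rule refl)
    have "expectation (\<lambda>\<omega>. \<bar>V' n \<omega> - 1\<bar>) \<le> expectation (\<lambda>\<omega>. \<bar>?T \<omega> - \<mu>\<bar> + ?X \<omega> + \<bar>\<mu> - 1\<bar>)"
    proof (rule integral_mono)
      show "integrable M (\<lambda>\<omega>. \<bar>V' n \<omega> - 1\<bar>)" by (intro integrable_abs Bochner_Integration.integrable_diff V'_int) simp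
      show "integrable M (\<lambda>\<omega>. \<bar>?T \<omega> - \<mu>\<bar> + ?X \<omega> + \<bar>\<mu> - 1\<bar>)"
        by (intro Bochner_Integration.integrable_add integrable_abs Bochner_Integration.integrable_diff intT intX) auto
      fix \<omega>
      have "0 \<le> ?X \<omega>" by (intro divide_nonneg_nonneg sum_nonneg) auto
      then show "\<bar>V' n \<omega> - 1\<bar> \<le> \<bar>?T \<omega> - \<mu>\<bar> + ?X \<omega> + \<bar>\<mu> - 1\<bar>" unfolding V' by linarith
    qed
    also have "\<dots> = expectation (\<lambda>\<omega>. \<bar>?T \<omega> - \<mu>\<bar>) + expectation ?X + \<bar>\<mu> - 1\<bar>"
      using intT intX by (simp add: prob_space)
    also have "expectation ?X = excess K n" using elim(2) by (simp add: excess_int excess_stationary)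
    also have "expectation (\<lambda>\<omega>. \<bar>?T \<omega> - \<mu>\<bar>) \<le> K * sqrt (2 * (real (l n) / real n + 4 * suminf \<alpha> / real n))"
      unfolding \<mu>_def by (rule truncated_average[OF elim(2) K(1)])
    \<comment> \<open>The excess enters twice, once as the mean of \<open>?X\<close> and once
      through \<open>\<mu> = m2 n - excess K n\<close>.\<close>
    finally have "expectation (\<lambda>\<omega>. \<bar>V' n \<omega> - 1\<bar>) \<le> e n + 2 * excess K n"
      using excess_nonneg[of K n] unfolding e_def \<mu> by linarith
    then show ?case using elim r by linarith
  qed
  then show "\<exists>no. \<forall>n\<ge>no. norm (expectation (\<lambda>\<omega>. \<bar>V' n \<omega> - 1\<bar>) - 0) < r"
    by (simp add: eventually_sequentially)
qed

text \<open>\<open>sq_diff_le\<close> leaves the error \<open>\<eta> * m2 n\<close>, which tends to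
  \<open>\<eta> = r / 4\<close>; for fixed \<open>\<eta>\<close> the other terms vanish.\<close>

lemma V_lim:
  assumes \<tau>: "(\<lambda>n. F (\<tau> n)) \<longlonglongrightarrow> p"
  shows "(\<lambda>n. expectation (\<lambda>\<omega>. \<bar>V n (\<tau> n) \<omega> - 1\<bar>)) \<longlonglongrightarrow> 0"
proof (rule LIMSEQ_I)
  fix r :: real assume r: "0 < r"
  define \<eta> where "\<eta> = r / 4"
  have \<eta>: "0 < \<eta>" using r by (simp add: \<eta>_def)
  define e where "e n = (1 + 1 / \<eta>) * D n (\<tau> n) + \<eta> * m2 n + expectation (\<lambda>\<omega>. \<bar>V' n \<omega> - 1\<bar>)" for n
  have "e \<longlonglongrightarrow> (1 + 1 / \<eta>) * 0 + \<eta> * 1 + 0"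
    unfolding e_def by (intro tendsto_add tendsto_mult tendsto_const D_lim[OF \<tau>] m2_lim V'_lim)
  moreover have "(1 + 1 / \<eta>) * 0 + \<eta> * 1 + 0 < r" using r by (simp add: \<eta>_def)
  ultimately have "eventually (\<lambda>n. e n < r) sequentially" by (rule order_tendstoD(2))
  with eventually_ge_at_top[of 1] have "eventually (\<lambda>n. expectation (\<lambda>\<omega>. \<bar>V n (\<tau> n) \<omega> - 1\<bar>) < r) sequentially"
  proof eventually_elim
    case (elim n)
    define \<Delta> where "\<Delta> \<omega> = (\<Sum>j=1..n. (Y n (\<tau> n) j \<omega> - Y' n j \<omega>)\<^sup>2) / real n" for \<omega>
    have int\<Delta>: "integrable M \<Delta>" unfolding \<Delta>_def[abs_def] by (intro integrable_divide Bochner_Integration.integrable_sum Y_diff_int)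
    have "expectation (\<lambda>\<omega>. \<bar>V n (\<tau> n) \<omega> - 1\<bar>) \<le> expectation (\<lambda>\<omega>. (1 + 1 / \<eta>) * \<Delta> \<omega> + \<eta> * V' n \<omega> + \<bar>V' n \<omega> - 1\<bar>)"
    proof (rule integral_mono)
      show "integrable M (\<lambda>\<omega>. \<bar>V n (\<tau> n) \<omega> - 1\<bar>)" by (intro integrable_abs Bochner_Integration.integrable_diff V_int) simp
      show "integrable M (\<lambda>\<omega>. (1 + 1 / \<eta>) * \<Delta> \<omega> + \<eta> * V' n \<omega> + \<bar>V' n \<omega> - 1\<bar>)"
        by (intro Bochner_Integration.integrable_add integrable_mult_right integrable_abs Bochner_Integration.integrable_diff int\<Delta> V'_int) auto
      fix \<omega>
      have "\<bar>V n (\<tau> n) \<omega> - V' n \<omega>\<bar> = \<bar>\<Sum>j=1..n. (Y n (\<tau> n) j \<omega>)\<^sup>2 - (Y' n j \<omega>)\<^sup>2\<bar> / real n"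
        unfolding V_def V'_def diff_divide_distrib[symmetric] sum_subtractf[symmetric] by simp
      also have "\<dots> \<le> (\<Sum>j=1..n. (1 + 1 / \<eta>) * (Y n (\<tau> n) j \<omega> - Y' n j \<omega>)\<^sup>2 + \<eta> * (Y' n j \<omega>)\<^sup>2) / real n"
        by (intro divide_right_mono order_trans[OF sum_abs] sum_mono sq_diff_le \<eta>) simp
      also have "\<dots> = (1 + 1 / \<eta>) * \<Delta> \<omega> + \<eta> * V' n \<omega>"
        unfolding V'_def \<Delta>_def by (simp only: sum.distrib sum_distrib_left[symmetric] add_divide_distrib times_divide_eq_right)
      finally show "\<bar>V n (\<tau> n) \<omega> - 1\<bar> \<le> (1 + 1 / \<eta>) * \<Delta> \<omega> + \<eta> * V' n \<omega> + \<bar>V' n \<omega> - 1\<bar>" by linarith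
    qed
    also have "\<dots> = (1 + 1 / \<eta>) * expectation \<Delta> + \<eta> * expectation (V' n) + expectation (\<lambda>\<omega>. \<bar>V' n \<omega> - 1\<bar>)"
      using int\<Delta> V'_int by simp
    also have "\<dots> = e n"
      unfolding e_def D_def V'_mean[OF elim(1)] \<Delta>_def[abs_def] by (rule refl)
    finally show ?case using elim by linarith
  qed
  then show "\<exists>no. \<forall>n\<ge>no. norm (expectation (\<lambda>\<omega>. \<bar>V n (\<tau> n) \<omega> - 1\<bar>) - 0) < r"
    by (simp add: eventually_sequentially)
qed

text \<open>The Lindeberg expression for \<open>b n\<close> independent copies of a normalised block
  under the conditional law.\<close>

definition lind :: "nat \<Rightarrow> real \<Rightarrow> real \<Rightarrow> 'a \<Rightarrow> real" where
  "lind n \<tau> \<delta> \<omega> = (\<Sum>j=1..n. (Y n \<tau> j \<omega>)\<^sup>2 * indicator {z. \<delta> * sqrt (real (b n)) < \<bar>z\<bar>} (Y n \<tau> j \<omega>)) / real n"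

lemma lind_int: "integrable M (lind n \<tau> \<delta>)"
  unfolding lind_def[abs_def]
proof (intro integrable_divide Bochner_Integration.integrable_sum)
  fix j
  show "integrable M (\<lambda>\<omega>. (Y n \<tau> j \<omega>)\<^sup>2 * indicator {z. \<delta> * sqrt (real (b n)) < \<bar>z\<bar>} (Y n \<tau> j \<omega>))"
    by (rule Bochner_Integration.integrable_bound[OF Y_int(2)]) (auto simp: indicator_def)
qed

text \<open>Transferred to the stationary blocks by \<open>sq_indicator_split\<close>. There the
  truncation level grows with \<open>b n\<close>, so eventually the squares above it are at most
  twice their excess over \<open>K\<close>.\<close>

lemma lind_lim:
  assumes \<tau>: "(\<lambda>n. F (\<tau> n)) \<longlonglongrightarrow> p" and \<delta>: "0 < \<delta>"
  shows "(\<lambda>n. expectation (\<lambda>\<omega>. lind n (\<tau> n) \<delta> \<omega>)) \<longlonglongrightarrow> 0"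
proof (rule LIMSEQ_I)
  fix r :: real assume r: "0 < r"
  obtain K where K: "0 < K" "eventually (\<lambda>n. excess K n < r / 16) sequentially"
    using excess_small[of "r / 16"] r by auto
  have "eventually (\<lambda>n. 4 * D n (\<tau> n) < r / 2) sequentially"
    by (rule order_tendstoD(2)[OF tendsto_mult_right_zero[OF D_lim[OF \<tau>]]]) (use r in simp)
  \<comment> \<open>Equivalent to \<open>2 * K \<le> (\<delta> * sqrt (b n) / 2)\<^sup>2\<close>,
    the square of the halved level; a square of size at least \<open>2 * K\<close> is at most twice
    its excess.\<close>
  moreover have "eventually (\<lambda>n. 8 * K / \<delta>\<^sup>2 \<le> real (b n)) sequentially"
    using b_inf by (simp add: filterlim_at_top)
  ultimately have "eventually (\<lambda>n. expectation (\<lambda>\<omega>. lind n (\<tau> n) \<delta> \<omega>) < r) sequentially"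
    using K(2) eventually_ge_at_top[of 1]
  proof eventually_elim
    case (elim n)
    let ?c = "\<delta> * sqrt (real (b n))"
    have c0: "0 \<le> ?c" using \<delta> by simp
    have "8 * K \<le> \<delta>\<^sup>2 * real (b n)" using elim(2) \<delta> by (simp add: divide_le_eq mult.commute)
    then have cK: "2 * K \<le> (?c / 2)\<^sup>2" by (simp add: power_divide power_mult_distrib)
    let ?\<Delta> = "\<lambda>\<omega>. (\<Sum>j=1..n. (Y n (\<tau> n) j \<omega> - Y' n j \<omega>)\<^sup>2) / real n" and ?X = "\<lambda>\<omega>. (\<Sum>j=1..n. max 0 ((Y' n j \<omega>)\<^sup>2 - K)) / real n"
    have int\<Delta>: "integrable M ?\<Delta>" by (intro integrable_divide Bochner_Integration.integrable_sum Y_diff_int)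
    have intX: "integrable M ?X" by (intro integrable_divide Bochner_Integration.integrable_sum excess_int)
    have "expectation (\<lambda>\<omega>. lind n (\<tau> n) \<delta> \<omega>) \<le> expectation (\<lambda>\<omega>. 8 * ?X \<omega> + 4 * ?\<Delta> \<omega>)"
    proof (rule integral_mono)
      show "integrable M (\<lambda>\<omega>. lind n (\<tau> n) \<delta> \<omega>)" by (rule lind_int)
      show "integrable M (\<lambda>\<omega>. 8 * ?X \<omega> + 4 * ?\<Delta> \<omega>)"
        by (intro Bochner_Integration.integrable_add integrable_mult_right intX int\<Delta>)
      fix \<omega>
      have "(Y n (\<tau> n) j \<omega>)\<^sup>2 * indicator {z. ?c < \<bar>z\<bar>} (Y n (\<tau> n) j \<omega>)
          \<le> 8 * max 0 ((Y' n j \<omega>)\<^sup>2 - K) + 4 * (Y n (\<tau> n) j \<omega> - Y' n j \<omega>)\<^sup>2" for j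
      proof -
        have "(Y' n j \<omega>)\<^sup>2 * indicator {z. ?c / 2 < \<bar>z\<bar>} (Y' n j \<omega>) \<le> 2 * max 0 ((Y' n j \<omega>)\<^sup>2 - K)"
        proof (cases "?c / 2 < \<bar>Y' n j \<omega>\<bar>")
          case True
          then have "(?c / 2)\<^sup>2 \<le> \<bar>Y' n j \<omega>\<bar>\<^sup>2" using c0 by (intro power_mono) auto
          then have "(?c / 2)\<^sup>2 \<le> (Y' n j \<omega>)\<^sup>2" by simp
          then have "2 * K \<le> (Y' n j \<omega>)\<^sup>2" by (rule order_trans[OF cK])
          then have "(Y' n j \<omega>)\<^sup>2 \<le> 2 * ((Y' n j \<omega>)\<^sup>2 - K)" by simp
          also have "\<dots> \<le> 2 * max 0 ((Y' n j \<omega>)\<^sup>2 - K)" by (intro mult_left_mono) auto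
          finally show ?thesis using True by simp
        qed (simp add: indicator_def)
        with sq_indicator_split[OF c0, of "Y n (\<tau> n) j \<omega>" "Y' n j \<omega>"] show ?thesis by linarith
      qed
      then have "lind n (\<tau> n) \<delta> \<omega> \<le> (\<Sum>j=1..n. 8 * max 0 ((Y' n j \<omega>)\<^sup>2 - K) + 4 * (Y n (\<tau> n) j \<omega> - Y' n j \<omega>)\<^sup>2) / real n"
        unfolding lind_def by (intro divide_right_mono sum_mono) auto
      then show "lind n (\<tau> n) \<delta> \<omega> \<le> 8 * ?X \<omega> + 4 * ?\<Delta> \<omega>"
        by (simp only: sum.distrib sum_distrib_left[symmetric] add_divide_distrib times_divide_eq_right)
    qed
    also have "\<dots> = 8 * expectation ?X + 4 * D n (\<tau> n)"
    proof -
      have "expectation (\<lambda>\<omega>. 8 * f \<omega> + 4 * f' \<omega>) = 8 * expectation f + 4 * expectation f'"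
        if "integrable M f" "integrable M f'" for f f' :: "'a \<Rightarrow> real" using that by simp
      from this[OF intX int\<Delta>] show ?thesis by (simp only: D_def)
    qed
    also have "expectation ?X = excess K n" using elim(4) by (simp add: excess_int excess_stationary)
    finally show ?case using elim by linarith
  qed
  moreover have "0 \<le> expectation (\<lambda>\<omega>. lind n (\<tau> n) \<delta> \<omega>)" for n
    by (intro integral_nonneg_AE AE_I2) (auto simp: lind_def intro!: divide_nonneg_nonneg sum_nonneg)
  ultimately show "\<exists>no. \<forall>n\<ge>no. norm (expectation (\<lambda>\<omega>. lind n (\<tau> n) \<delta> \<omega>) - 0) < r"
    by (simp add: eventually_sequentially)
qed

end

section \<open>Conditional normal approximation of the bootstrap\<close>

context cbb_setup
begin

lemma cbb_le_measurable [measurable]: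
  assumes "1 \<le> n" shows "(\<lambda>\<omega>. cbb_le p n L (x \<omega>) \<tau>) \<in> borel_measurable M"
proof -
  let ?P = "cbb_starts n L"
  have [measurable]: "(\<lambda>\<omega>. ecdf m (cbb_sample n L (x \<omega>) s) \<tau>) \<in> borel_measurable M" for m s
    unfolding ecdf_def cbb_sample_def periodic_ext_def by measurable
  have "cbb_le p n L (x \<omega>) \<tau> = (\<Sum>s\<in>set_pmf ?P. pmf ?P s * indicator {p..} (ecdf ((n div L) * L) (cbb_sample n L (x \<omega>) s) \<tau>))" for \<omega>
  proof -
    have "cbb_le p n L (x \<omega>) \<tau> = measure_pmf.expectation ?P (indicator {s. p \<le> ecdf ((n div L) * L) (cbb_sample n L (x \<omega>) s) \<tau>})"
      by (simp add: cbb_le_def)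
    also have "\<dots> = (\<Sum>s\<in>set_pmf ?P. pmf ?P s * indicator {p..} (ecdf ((n div L) * L) (cbb_sample n L (x \<omega>) s) \<tau>))"
      by (subst integral_measure_pmf[OF finite_set_cbb_starts[OF assms]]) (auto simp: indicator_def)
    finally show ?thesis .
  qed
  then show ?thesis by simp
qed

lemma cbb_le_01: "0 \<le> cbb_le p n L z \<tau>" "cbb_le p n L z \<tau> \<le> 1"
  by (auto simp: cbb_le_def)

definition Rn :: "nat \<Rightarrow> real \<Rightarrow> 'a \<Rightarrow> real" where
  "Rn n \<tau> \<omega> = sqrt (real n) * (ecdf n (x \<omega>) \<tau> - p) / sqrt v"

lemma Rn_int: "integrable M (Rn n \<tau>)"
proof (rule integrable_bounded[where B="sqrt (real n) / sqrt v"])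
  fix \<omega>
  have "\<bar>ecdf n (x \<omega>) \<tau> - p\<bar> \<le> 1" using ecdf_01[of n "x \<omega>" \<tau>] p01 by linarith
  then have "sqrt (real n) * \<bar>ecdf n (x \<omega>) \<tau> - p\<bar> \<le> sqrt (real n) * 1" by (intro mult_left_mono) auto
  then show "norm (Rn n \<tau> \<omega>) \<le> sqrt (real n) / sqrt v"
    using v by (simp add: Rn_def abs_mult divide_right_mono)
qed (unfold Rn_def[abs_def], measurable)

lemma Rn_measurable [measurable]: "Rn n \<tau> \<in> borel_measurable M"
  using Rn_int by auto

text \<open>An inequality for every \<open>\<omega>\<close>. Where the conditions of
  \<open>resample_clt\<close> fail, one of the two quotients exceeds 1 and covers the trivial bound,
  so that convergence in mean of \<open>V\<close> and \<open>lind\<close> suffices afterwards. The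
  factor \<open>c\<close> reflects that the bootstrap sample has \<open>b n * l n\<close> instead of
  \<open>n\<close> observations.\<close>

lemma cbb_le_near:
  assumes n: "1 \<le> n" and \<delta>: "0 < \<delta>"
    and clt: "\<forall>(Q :: nat pmf) y b z d. finite (set_pmf Q) \<longrightarrow> 1 \<le> b \<longrightarrow>
      measure_pmf.expectation Q y = 0 \<longrightarrow>
      \<bar>measure_pmf.expectation Q (\<lambda>i. (y i)\<^sup>2) - 1\<bar> \<le> \<delta> \<longrightarrow>
      measure_pmf.expectation Q (\<lambda>i. (y i)\<^sup>2 * indicator {x. \<delta> * sqrt (real b) < \<bar>x\<bar>} (y i)) \<le> \<delta> \<longrightarrow>
      \<bar>measure_pmf.prob (Pi_pmf {..<b} d (\<lambda>_. Q)) {s. (\<Sum>k<b. y (s k)) / sqrt (real b) \<le> z} - Phi z\<bar> \<le> \<epsilon>"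
    and \<epsilon>: "0 < \<epsilon>"
  defines "c \<equiv> sqrt (real (b n * l n) / real n)"
  shows "\<bar>cbb_le p n (l n) (x \<omega>) \<tau> - Phi (c * Rn n \<tau> \<omega>)\<bar> \<le> \<epsilon> + \<bar>V n \<tau> \<omega> - 1\<bar> / \<delta> + lind n \<tau> \<delta> \<omega> / \<delta>"
proof -
  have V0: "0 \<le> \<bar>V n \<tau> \<omega> - 1\<bar> / \<delta>" using \<delta> by simp
  have "0 \<le> lind n \<tau> \<delta> \<omega>" unfolding lind_def by (intro divide_nonneg_nonneg sum_nonneg) auto
  then have L0: "0 \<le> lind n \<tau> \<delta> \<omega> / \<delta>" using \<delta> by simp
  have le1: "\<bar>cbb_le p n (l n) (x \<omega>) \<tau> - Phi (c * Rn n \<tau> \<omega>)\<bar> \<le> 1"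
    using cbb_le_01[of n "l n" "x \<omega>" \<tau>] Phi_nonneg[of "c * Rn n \<tau> \<omega>"] Phi_le_1[of "c * Rn n \<tau> \<omega>"] by linarith
  consider "\<delta> < \<bar>V n \<tau> \<omega> - 1\<bar>" | "\<delta> < lind n \<tau> \<delta> \<omega>" | "\<bar>V n \<tau> \<omega> - 1\<bar> \<le> \<delta>" "lind n \<tau> \<delta> \<omega> \<le> \<delta>" by linarith
  then show ?thesis
  proof cases
    case 1
    then have "1 \<le> \<bar>V n \<tau> \<omega> - 1\<bar> / \<delta>" using \<delta> by (simp add: le_divide_eq)
    with le1 L0 \<epsilon> show ?thesis by linarith
  next
    case 2
    then have "1 \<le> lind n \<tau> \<delta> \<omega> / \<delta>" using \<delta> by (simp add: le_divide_eq)
    with le1 V0 \<epsilon> show ?thesis by linarith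
  next
    case 3
    let ?Q = "pmf_of_set {1..n}" and ?y = "\<lambda>j. - Y n \<tau> j \<omega>"
    have E: "measure_pmf.expectation ?Q f = sum f {1..n} / real n" for f :: "nat \<Rightarrow> real"
      using n by (subst integral_pmf_of_set) auto
    have "\<bar>measure_pmf.prob (Pi_pmf {..<b n} 1 (\<lambda>_. ?Q)) {s. (\<Sum>k<b n. ?y (s k)) / sqrt (real (b n)) \<le> c * Rn n \<tau> \<omega>} - Phi (c * Rn n \<tau> \<omega>)\<bar> \<le> \<epsilon>"
    proof (rule clt[rule_format])
      show "finite (set_pmf ?Q)" using n by (subst set_pmf_of_set) auto
      show "1 \<le> b n" by (rule b_ge_1[OF n])
      show "measure_pmf.expectation ?Q ?y = 0"
        unfolding E Y_def using block_dev_sum[OF n, of "l n" "x \<omega>" \<tau>]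
        by (simp add: sum_negf sum_divide_distrib[symmetric])
      show "\<bar>measure_pmf.expectation ?Q (\<lambda>i. (?y i)\<^sup>2) - 1\<bar> \<le> \<delta>"
        unfolding E using 3(1) by (simp add: V_def)
      have "indicator {x. \<delta> * sqrt (real (b n)) < \<bar>x\<bar>} (- z) = (indicator {x. \<delta> * sqrt (real (b n)) < \<bar>x\<bar>} z :: real)" for z
        by (simp add: indicator_def)
      then show "measure_pmf.expectation ?Q (\<lambda>i. (?y i)\<^sup>2 * indicator {x. \<delta> * sqrt (real (b n)) < \<bar>x\<bar>} (?y i)) \<le> \<delta>"
        unfolding E using 3(2) by (simp add: lind_def)
    qed
    moreover have "c * Rn n \<tau> \<omega> = sqrt (real (b n * l n)) * (ecdf n (x \<omega>) \<tau> - p) / sqrt v"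
      unfolding c_def Rn_def using n by (simp add: real_sqrt_divide)
    ultimately have "\<bar>cbb_le p n (l n) (x \<omega>) \<tau> - Phi (c * Rn n \<tau> \<omega>)\<bar> \<le> \<epsilon>"
      using cbb_le_eq[OF l[OF n], of "sqrt v" p "x \<omega>" \<tau>] v by (simp add: Y_def b_def)
    with V0 L0 show ?thesis by linarith
  qed
qed

text \<open>The bound \<open>a n\<close> on the mean of
  \<open>\<bar>Rn n (\<tau> n) \<omega>\<bar>\<close> serves to remove the factor
  \<open>c n\<close>: its removal costs at most \<open>\<bar>c n - 1\<bar> * a n\<close>, where
  \<open>c n\<close> tends to 1.\<close>

theorem cbb_le_lim:
  assumes \<tau>: "(\<lambda>n. F (\<tau> n)) \<longlonglongrightarrow> p" and a: "\<And>n. 1 \<le> n \<Longrightarrow> expectation (\<lambda>\<omega>. \<bar>Rn n (\<tau> n) \<omega>\<bar>) \<le> a n" "a \<longlonglongrightarrow> A"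
  shows "(\<lambda>n. expectation (\<lambda>\<omega>. \<bar>cbb_le p n (l n) (x \<omega>) (\<tau> n) - Phi (Rn n (\<tau> n) \<omega>)\<bar>)) \<longlonglongrightarrow> 0"
proof (rule LIMSEQ_I)
  fix r :: real assume r: "0 < r"
  define \<epsilon> where "\<epsilon> = r / 2"
  have \<epsilon>: "0 < \<epsilon>" using r by (simp add: \<epsilon>_def)
  obtain \<delta> where \<delta>: "0 < \<delta>" and clt: "\<forall>(Q :: nat pmf) y b z d. finite (set_pmf Q) \<longrightarrow> 1 \<le> b \<longrightarrow>
      measure_pmf.expectation Q y = 0 \<longrightarrow>
      \<bar>measure_pmf.expectation Q (\<lambda>i. (y i)\<^sup>2) - 1\<bar> \<le> \<delta> \<longrightarrow>
      measure_pmf.expectation Q (\<lambda>i. (y i)\<^sup>2 * indicator {x. \<delta> * sqrt (real b) < \<bar>x\<bar>} (y i)) \<le> \<delta> \<longrightarrow>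
      \<bar>measure_pmf.prob (Pi_pmf {..<b} d (\<lambda>_. Q)) {s. (\<Sum>k<b. y (s k)) / sqrt (real b) \<le> z} - Phi z\<bar> \<le> \<epsilon>"
    using resample_clt[OF \<epsilon>] by blast
  define c where "c n = sqrt (real (b n * l n) / real n)" for n
  define e where "e n = \<epsilon> + expectation (\<lambda>\<omega>. \<bar>V n (\<tau> n) \<omega> - 1\<bar>) / \<delta> + expectation (\<lambda>\<omega>. lind n (\<tau> n) \<delta> \<omega>) / \<delta> + \<bar>c n - 1\<bar> * a n" for n
  have "e \<longlonglongrightarrow> \<epsilon> + 0 / \<delta> + 0 / \<delta> + \<bar>1 - 1\<bar> * A"
    unfolding e_def c_def using \<delta> by (intro tendsto_intros V_lim[OF \<tau>] lind_lim[OF \<tau> \<delta>] bl_ratio_lim a(2)) auto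
  moreover have "\<epsilon> + 0 / \<delta> + 0 / \<delta> + \<bar>1 - 1\<bar> * A < r" using r by (simp add: \<epsilon>_def)
  ultimately have "eventually (\<lambda>n. e n < r) sequentially" by (rule order_tendstoD(2))
  with eventually_ge_at_top[of 1]
  have "eventually (\<lambda>n. expectation (\<lambda>\<omega>. \<bar>cbb_le p n (l n) (x \<omega>) (\<tau> n) - Phi (Rn n (\<tau> n) \<omega>)\<bar>) < r) sequentially"
  proof eventually_elim
    case (elim n)
    have [measurable]: "(\<lambda>\<omega>. cbb_le p n (l n) (x \<omega>) (\<tau> n)) \<in> borel_measurable M" by (rule cbb_le_measurable[OF elim(1)])
    have "expectation (\<lambda>\<omega>. \<bar>cbb_le p n (l n) (x \<omega>) (\<tau> n) - Phi (Rn n (\<tau> n) \<omega>)\<bar>)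
        \<le> expectation (\<lambda>\<omega>. \<epsilon> + \<bar>V n (\<tau> n) \<omega> - 1\<bar> / \<delta> + lind n (\<tau> n) \<delta> \<omega> / \<delta> + \<bar>c n - 1\<bar> * \<bar>Rn n (\<tau> n) \<omega>\<bar>)"
    proof (rule integral_mono)
      show "integrable M (\<lambda>\<omega>. \<bar>cbb_le p n (l n) (x \<omega>) (\<tau> n) - Phi (Rn n (\<tau> n) \<omega>)\<bar>)"
      proof (rule integrable_bounded[where B=1])
        show "norm \<bar>cbb_le p n (l n) (x \<omega>) (\<tau> n) - Phi (Rn n (\<tau> n) \<omega>)\<bar> \<le> 1" for \<omega>
          using abs_diff_le_1[OF cbb_le_01 Phi_nonneg Phi_le_1] by simp
      qed measurable
      show "integrable M (\<lambda>\<omega>. \<epsilon> + \<bar>V n (\<tau> n) \<omega> - 1\<bar> / \<delta> + lind n (\<tau> n) \<delta> \<omega> / \<delta> + \<bar>c n - 1\<bar> * \<bar>Rn n (\<tau> n) \<omega>\<bar>)"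
        by (intro Bochner_Integration.integrable_add integrable_divide integrable_mult_right integrable_abs
            Bochner_Integration.integrable_diff V_int lind_int Rn_int) auto
      fix \<omega>
      have "\<bar>Phi (c n * Rn n (\<tau> n) \<omega>) - Phi (Rn n (\<tau> n) \<omega>)\<bar> \<le> \<bar>c n * Rn n (\<tau> n) \<omega> - Rn n (\<tau> n) \<omega>\<bar>" by (rule Phi_lipschitz)
      also have "c n * Rn n (\<tau> n) \<omega> - Rn n (\<tau> n) \<omega> = (c n - 1) * Rn n (\<tau> n) \<omega>" by (simp add: algebra_simps)
      finally have "\<bar>Phi (c n * Rn n (\<tau> n) \<omega>) - Phi (Rn n (\<tau> n) \<omega>)\<bar> \<le> \<bar>c n - 1\<bar> * \<bar>Rn n (\<tau> n) \<omega>\<bar>" by (simp add: abs_mult)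
      with cbb_le_near[OF elim(1) \<delta> clt \<epsilon>, of \<omega> "\<tau> n"]
      show "\<bar>cbb_le p n (l n) (x \<omega>) (\<tau> n) - Phi (Rn n (\<tau> n) \<omega>)\<bar> \<le> \<epsilon> + \<bar>V n (\<tau> n) \<omega> - 1\<bar> / \<delta> + lind n (\<tau> n) \<delta> \<omega> / \<delta> + \<bar>c n - 1\<bar> * \<bar>Rn n (\<tau> n) \<omega>\<bar>"
        unfolding c_def by linarith
    qed
    also have "\<dots> = \<epsilon> + expectation (\<lambda>\<omega>. \<bar>V n (\<tau> n) \<omega> - 1\<bar>) / \<delta> + expectation (\<lambda>\<omega>. lind n (\<tau> n) \<delta> \<omega>) / \<delta> + \<bar>c n - 1\<bar> * expectation (\<lambda>\<omega>. \<bar>Rn n (\<tau> n) \<omega>\<bar>)"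
      using V_int lind_int Rn_int by (simp add: prob_space)
    also have "\<dots> \<le> e n" unfolding e_def by (intro add_left_mono mult_left_mono a(1) elim) simp
    finally show ?case using elim by linarith
  qed
  then show "\<exists>no. \<forall>n\<ge>no. norm (expectation (\<lambda>\<omega>. \<bar>cbb_le p n (l n) (x \<omega>) (\<tau> n) - Phi (Rn n (\<tau> n) \<omega>)\<bar>) - 0) < r"
    by (simp add: eventually_sequentially)
qed

end


section \<open>The limit of the bootstrap approximation error\<close>

locale cbb_scaled = cbb_setup M X F p tp v l + scale g k
  for M :: "'a measure" and X F p tp v l g k +
  fixes r :: "nat \<Rightarrow> real"
  assumes r_pos: "\<And>n. 1 \<le> n \<Longrightarrow> 0 < r n"
    and F_expansion: "\<And>y. (\<lambda>n. sqrt (real n) * (F (tp + r n * y) - p) / sqrt v) \<longlonglongrightarrow> g y"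
begin

lemma F_lim: "(\<lambda>n. F (tp + r n * y)) \<longlonglongrightarrow> p"
proof -
  have "(\<lambda>n. sqrt v / sqrt (real n)) \<longlonglongrightarrow> 0"
    by (intro tendsto_divide_0[OF tendsto_const] filterlim_at_top_imp_at_infinity
        filterlim_compose[OF sqrt_at_top filterlim_real_sequentially])
  from tendsto_mult[OF this F_expansion[of y]]
  have "(\<lambda>n. sqrt v / sqrt (real n) * (sqrt (real n) * (F (tp + r n * y) - p) / sqrt v)) \<longlonglongrightarrow> 0" by simp
  then have "(\<lambda>n. F (tp + r n * y) - p) \<longlonglongrightarrow> 0"
  proof (rule Lim_transform_eventually)
    show "\<forall>\<^sub>F n in sequentially. sqrt v / sqrt (real n) * (sqrt (real n) * (F (tp + r n * y) - p) / sqrt v) = F (tp + r n * y) - p"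
      using eventually_ge_at_top[of 1] by eventually_elim (use v in simp)
  qed
  then show ?thesis by (simp add: LIM_zero_iff)
qed

text \<open>The first term bounds the fluctuation of the increment of the empirical process, the
  second is the error of its deterministic drift.\<close>

definition incr_bound :: "real \<Rightarrow> nat \<Rightarrow> real" where
  "incr_bound y n = sqrt (\<gamma> (B (tp + r n * y))) / sqrt v + \<bar>sqrt (real n) * (F (tp + r n * y) - p) / sqrt v - g y\<bar>"

lemma incr_bound_lim: "incr_bound y \<longlonglongrightarrow> 0"
proof -
  have "(\<lambda>n. B (tp + r n * y)) \<longlonglongrightarrow> 2 * \<bar>p - p\<bar>" unfolding B_def by (intro tendsto_intros F_lim)
  then have "(\<lambda>n. \<gamma> (B (tp + r n * y))) \<longlonglongrightarrow> 0" by (intro \<gamma>_tendsto_0) (auto simp: B_def)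
  then have "incr_bound y \<longlonglongrightarrow> sqrt 0 / sqrt v + \<bar>g y - g y\<bar>"
    unfolding incr_bound_def using v by (intro tendsto_intros F_expansion) auto
  then show ?thesis by simp
qed

lemma Rn_increment:
  assumes n: "1 \<le> n"
  shows "expectation (\<lambda>\<omega>. \<bar>Rn n (tp + r n * y) \<omega> - Rn n tp \<omega> - g y\<bar>) \<le> incr_bound y n"
proof -
  let ?\<tau> = "tp + r n * y" and ?c = "sqrt (real n) * sqrt v"
  let ?I = "\<lambda>\<omega>. \<Sum>i\<in>{1..n}. incr ?\<tau> (x \<omega> i)"
  have c: "0 < ?c" using n v by simp
  have eq: "Rn n ?\<tau> \<omega> - Rn n tp \<omega> - g y = ?I \<omega> / ?c + (sqrt (real n) * (F ?\<tau> - p) / sqrt v - g y)" for \<omega>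
  proof -
    have "?I \<omega> = real n * ((ecdf n (x \<omega>) ?\<tau> - F ?\<tau>) - (ecdf n (x \<omega>) tp - F tp))"
      using n unfolding incr_def sum_subtractf[of "\<lambda>i. indicator {..?\<tau>} (x \<omega> i) - F ?\<tau>"] ecdf_minus_F[OF n]
      by (simp add: F_tp flip: diff_divide_distrib)
    then have "?I \<omega> / ?c = sqrt (real n) * ((ecdf n (x \<omega>) ?\<tau> - F ?\<tau>) - (ecdf n (x \<omega>) tp - p)) / sqrt v"
      using n v real_sqrt_mult_self[of "real n"] by (simp add: F_tp divide_simps)
    then show ?thesis by (simp add: Rn_def diff_divide_distrib right_diff_distrib)
  qed
  have Ib: "\<bar>?I \<omega>\<bar> \<le> real n" for \<omega>
  proof -
    have "\<bar>?I \<omega>\<bar> \<le> (\<Sum>i\<in>{1..n}. 1)" by (intro order_trans[OF sum_abs] sum_mono incr_le_1)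
    then show ?thesis by simp
  qed
  have "\<exists>B. \<forall>\<omega>. \<bar>?I \<omega>\<bar> \<le> B" using Ib by blast
  note Iint = bdd_sq_integrable[OF _ this]
  have Im [measurable]: "?I \<in> borel_measurable M" by measurable
  have "expectation (\<lambda>\<omega>. \<bar>Rn n ?\<tau> \<omega> - Rn n tp \<omega> - g y\<bar>)
      \<le> expectation (\<lambda>\<omega>. \<bar>?I \<omega>\<bar> / ?c + \<bar>sqrt (real n) * (F ?\<tau> - p) / sqrt v - g y\<bar>)"
  proof (rule integral_mono)
    show "integrable M (\<lambda>\<omega>. \<bar>Rn n ?\<tau> \<omega> - Rn n tp \<omega> - g y\<bar>)"
      by (intro integrable_abs Bochner_Integration.integrable_diff Rn_int) simp
    show "integrable M (\<lambda>\<omega>. \<bar>?I \<omega>\<bar> / ?c + \<bar>sqrt (real n) * (F ?\<tau> - p) / sqrt v - g y\<bar>)"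
      by (intro Bochner_Integration.integrable_add integrable_divide integrable_abs Iint(1)[OF Im]) simp
    show "\<bar>Rn n ?\<tau> \<omega> - Rn n tp \<omega> - g y\<bar> \<le> \<bar>?I \<omega>\<bar> / ?c + \<bar>sqrt (real n) * (F ?\<tau> - p) / sqrt v - g y\<bar>" for \<omega>
      unfolding eq using abs_triangle_ineq[of "?I \<omega> / ?c" "sqrt (real n) * (F ?\<tau> - p) / sqrt v - g y"] c by (simp only: abs_divide abs_of_pos)
  qed
  also have "\<dots> = expectation (\<lambda>\<omega>. \<bar>?I \<omega>\<bar>) / ?c + \<bar>sqrt (real n) * (F ?\<tau> - p) / sqrt v - g y\<bar>"
    using Iint(1)[OF Im] by (simp add: prob_space)
  also have "expectation (\<lambda>\<omega>. \<bar>?I \<omega>\<bar>) \<le> sqrt (real n * \<gamma> (B ?\<tau>))"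
  proof -
    have "expectation (\<lambda>\<omega>. \<bar>?I \<omega>\<bar>) \<le> sqrt (expectation (\<lambda>\<omega>. (?I \<omega>)\<^sup>2))" by (rule expectation_abs_le_sqrt[OF Iint[OF Im]])
    also have "\<dots> \<le> sqrt (real (card {1..n}) * \<gamma> (B ?\<tau>))" by (intro real_sqrt_le_mono incr_second_moment) auto
    finally show ?thesis by simp
  qed
  also have "sqrt (real n * \<gamma> (B ?\<tau>)) / ?c = sqrt (\<gamma> (B ?\<tau>)) / sqrt v" using n by (simp add: real_sqrt_mult)
  finally show ?thesis using c by (simp add: incr_bound_def divide_right_mono)
qed

lemma Rn_tp_L1: assumes n: "1 \<le> n" shows "expectation (\<lambda>\<omega>. \<bar>Rn n tp \<omega>\<bar>) \<le> sqrt (\<gamma> 1) / sqrt v"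
proof -
  let ?e = "\<lambda>\<omega>. ecdf n (x \<omega>) tp - F tp"
  have b: "\<bar>?e \<omega>\<bar> \<le> 1" for \<omega> using ecdf_01[of n "x \<omega>" tp] F01[of tp] by linarith
  have int: "integrable M ?e" by (rule integrable_bounded[where B=1]) (use b in auto)
  have "expectation (\<lambda>\<omega>. \<bar>Rn n tp \<omega>\<bar>) = sqrt (real n) / sqrt v * expectation (\<lambda>\<omega>. \<bar>?e \<omega>\<bar>)"
    using v by (simp add: Rn_def abs_mult F_tp)
  also have "\<dots> \<le> sqrt (real n) / sqrt v * sqrt (\<gamma> 1 / real n)"
  proof (rule mult_left_mono)
    have "expectation (\<lambda>\<omega>. \<bar>?e \<omega>\<bar>) \<le> sqrt (expectation (\<lambda>\<omega>. (?e \<omega>)\<^sup>2))" by (rule expectation_abs_le_sqrt[OF int ecdf_dev_int])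
    also have "\<dots> \<le> sqrt (\<gamma> 1 / real n)" by (intro real_sqrt_le_mono ecdf_second_moment n)
    finally show "expectation (\<lambda>\<omega>. \<bar>?e \<omega>\<bar>) \<le> sqrt (\<gamma> 1 / real n)" .
  qed (use v in simp)
  also have "\<dots> = sqrt (\<gamma> 1) / sqrt v" using n by (simp add: real_sqrt_divide)
  finally show ?thesis .
qed

lemma Rn_L1:
  assumes n: "1 \<le> n"
  shows "expectation (\<lambda>\<omega>. \<bar>Rn n (tp + r n * y) \<omega>\<bar>) \<le> incr_bound y n + sqrt (\<gamma> 1) / sqrt v + \<bar>g y\<bar>"
proof -
  let ?\<tau> = "tp + r n * y"
  have int: "integrable M (\<lambda>\<omega>. \<bar>Rn n ?\<tau> \<omega> - Rn n tp \<omega> - g y\<bar>)"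
    by (intro integrable_abs Bochner_Integration.integrable_diff Rn_int) simp
  have "expectation (\<lambda>\<omega>. \<bar>Rn n ?\<tau> \<omega>\<bar>) \<le> expectation (\<lambda>\<omega>. \<bar>Rn n ?\<tau> \<omega> - Rn n tp \<omega> - g y\<bar> + \<bar>Rn n tp \<omega>\<bar> + \<bar>g y\<bar>)"
  proof (rule integral_mono)
    show "integrable M (\<lambda>\<omega>. \<bar>Rn n ?\<tau> \<omega>\<bar>)" by (intro integrable_abs Rn_int)
    show "integrable M (\<lambda>\<omega>. \<bar>Rn n ?\<tau> \<omega> - Rn n tp \<omega> - g y\<bar> + \<bar>Rn n tp \<omega>\<bar> + \<bar>g y\<bar>)"
      by (intro Bochner_Integration.integrable_add int integrable_abs Rn_int) simp
    show "\<bar>Rn n ?\<tau> \<omega>\<bar> \<le> \<bar>Rn n ?\<tau> \<omega> - Rn n tp \<omega> - g y\<bar> + \<bar>Rn n tp \<omega>\<bar> + \<bar>g y\<bar>" for \<omega> by linarith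
  qed
  also have "\<dots> = expectation (\<lambda>\<omega>. \<bar>Rn n ?\<tau> \<omega> - Rn n tp \<omega> - g y\<bar>) + expectation (\<lambda>\<omega>. \<bar>Rn n tp \<omega>\<bar>) + \<bar>g y\<bar>"
    using int Rn_int by (simp add: prob_space)
  also have "\<dots> \<le> incr_bound y n + sqrt (\<gamma> 1) / sqrt v + \<bar>g y\<bar>"
    by (intro add_mono Rn_increment Rn_tp_L1 n order_refl)
  finally show ?thesis .
qed

text \<open>The sign is that of \<open>R_clt\<close>, where \<open>- R n 0\<close> approximates
  \<open>g\<close> of the quantile. The index \<open>Suc n\<close> avoids the empty sample.\<close>

lemma Rn_tp_clt: "weak_conv_m (\<lambda>n. distr M borel (\<lambda>\<omega>. - Rn (Suc n) tp \<omega>)) std_normal_distribution"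
proof -
  interpret neg: clt_setup M X "\<lambda>z. - (indicator {..tp} z - p)" v
  proof unfold_locales
    show "(\<lambda>z. - (indicator {..tp} z - p)) \<in> borel_measurable borel" by measurable
    show "\<bar>- (indicator {..tp} z - p)\<bar> \<le> 1" for z :: real using p01 by (auto simp: indicator_def)
    show "expectation (\<lambda>\<omega>. - (indicator {..tp} (X 1 \<omega>) - p)) = 0"
      using h_mean by (simp only: Bochner_Integration.integral_minus neg_equal_0_iff_equal)
    show "(\<lambda>n. expectation (\<lambda>\<omega>. (\<Sum>r<n. - (indicator {..tp} (X (int (1 + r)) \<omega>) - p))\<^sup>2) / real n) \<longlonglongrightarrow> v"
      using v_lim' by (simp only: sum_negf power2_minus)
  qed (use v in auto)
  have "- Rn n tp \<omega> = neg.S 1 n \<omega> / sqrt (v * real n)" if "1 \<le> n" for n \<omega>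
  proof -
    have "neg.S 1 n \<omega> = - S 1 n \<omega>" unfolding neg.S_def S_def by (rule sum_negf)
    also have "S 1 n \<omega> = real n * (ecdf n (x \<omega>) tp - p)"
      unfolding S_eq_sum using that by (simp add: ecdf_def sum_subtractf right_diff_distrib)
    finally show ?thesis
      using that v real_sqrt_mult_self[of "real n"] by (simp add: Rn_def real_sqrt_mult divide_simps)
  qed
  then have eq: "distr M borel (\<lambda>\<omega>. - Rn (Suc n) tp \<omega>) = distr M borel (\<lambda>\<omega>. neg.S 1 (Suc n) \<omega> / sqrt (v * real (Suc n)))" for n
    by (metis le_add1 plus_1_eq_Suc)
  show ?thesis
    unfolding weak_conv_m_def weak_conv_def
  proof (intro allI impI)
    fix y assume "isCont (cdf std_normal_distribution) y"
    then have "(\<lambda>n. cdf (distr M borel (\<lambda>\<omega>. neg.S 1 n \<omega> / sqrt (v * real n))) y) \<longlonglongrightarrow> cdf std_normal_distribution y"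
      using neg.clt by (simp only: weak_conv_m_def weak_conv_def)
    from LIMSEQ_Suc[OF this] show "(\<lambda>n. cdf (distr M borel (\<lambda>\<omega>. - Rn (Suc n) tp \<omega>)) y) \<longlonglongrightarrow> cdf std_normal_distribution y"
      by (simp only: eq)
  qed
qed

section \<open>The rescaled quantile and the distance\<close>

definition qn :: "nat \<Rightarrow> 'a \<Rightarrow> real" where
  "qn n \<omega> = (quantile (ecdf n (x \<omega>)) p - tp) / r n"

definition Tn :: "nat \<Rightarrow> 'a \<Rightarrow> real" where
  "Tn n \<omega> = (SUP t. \<bar>cbb_prob p n (l n) (x \<omega>) t - prob {\<omega>'\<in>space M. quantile (ecdf n (x \<omega>')) p - tp \<le> t}\<bar>)"

text \<open>The substitution \<open>t = r n * s\<close> permutes the real line as \<open>r n\<close>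
  is positive, so the supremum does not see the scale.\<close>

lemma Tn_eq:
  assumes n: "1 \<le> n"
  shows "Tn n \<omega> = (SUP s. \<bar>cbb_le p n (l n) (x \<omega>) (tp + r n * (qn n \<omega> + s)) - prob {\<omega>'\<in>space M. qn n \<omega>' \<le> s}\<bar>)"
proof -
  let ?f = "\<lambda>t. \<bar>cbb_prob p n (l n) (x \<omega>) t - prob {\<omega>'\<in>space M. quantile (ecdf n (x \<omega>')) p - tp \<le> t}\<bar>"
  have r: "0 < r n" by (rule r_pos[OF n])
  have "range ?f = range (\<lambda>s. ?f (r n * s))"
  proof (rule antisym)
    show "range ?f \<subseteq> range (\<lambda>s. ?f (r n * s))"
    proof (rule image_subsetI)
      fix t
      have "?f t = ?f (r n * (t / r n))" using r by simp
      then show "?f t \<in> range (\<lambda>s. ?f (r n * s))" by (rule range_eqI)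
    qed
  qed auto
  moreover have "?f (r n * s) = \<bar>cbb_le p n (l n) (x \<omega>) (tp + r n * (qn n \<omega> + s)) - prob {\<omega>'\<in>space M. qn n \<omega>' \<le> s}\<bar>" for s
  proof -
    have "tp + r n * (qn n \<omega> + s) = quantile (ecdf n (x \<omega>)) p + r n * s" using r by (simp add: qn_def distrib_left)
    moreover have "qn n \<omega>' \<le> s \<longleftrightarrow> quantile (ecdf n (x \<omega>')) p - tp \<le> r n * s" for \<omega>'
      using r by (simp add: qn_def divide_le_eq mult.commute)
    ultimately show ?thesis using cbb_prob_eq_cbb_le[OF p01(1) less_imp_le[OF p01(2)] l[OF n]] by simp
  qed
  ultimately show ?thesis unfolding Tn_def by simp
qed

text \<open>The interpretation uses \<open>Suc n\<close>, as positivity of \<open>r n\<close> and a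
  nonempty sample are guaranteed from 1 on; the shift does not affect the limit.\<close>

theorem Tn_lim: "weak_conv_m (\<lambda>n. distr M borel (Tn n)) (distr std_normal_distribution borel (\<lambda>z. gap (k z)))"
proof -
  have p': "0 < p" "p \<le> 1" using p01 by auto
  interpret gap_limit M g k "\<lambda>n y. Rn (Suc n) (tp + r (Suc n) * y)"
    "\<lambda>n y \<omega>. cbb_le p (Suc n) (l (Suc n)) (x \<omega>) (tp + r (Suc n) * y)" "\<lambda>n. qn (Suc n)" "\<lambda>n. Tn (Suc n)"
  proof unfold_locales
    fix n
    have n: "1 \<le> Suc n" by simp
    have r: "0 < r (Suc n)" by (rule r_pos[OF n])
    have [measurable]: "(\<lambda>\<omega>. quantile (ecdf (Suc n) (x \<omega>)) p) \<in> borel_measurable M"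
      by (rule measurable_quantile_ecdf[OF p']) simp
    show "qn (Suc n) \<in> borel_measurable M" unfolding qn_def[abs_def] by measurable
    show "Tn (Suc n) \<in> borel_measurable M"
      unfolding Tn_def[abs_def] by (rule measurable_cbb_distance[OF p' n prob_space_axioms X_measurable])
    show "integrable M (Rn (Suc n) (tp + r (Suc n) * y))" for y by (rule Rn_int)
    show "(\<lambda>\<omega>. cbb_le p (Suc n) (l (Suc n)) (x \<omega>) (tp + r (Suc n) * y)) \<in> borel_measurable M" for y
      by (rule cbb_le_measurable[OF n])
    show "qn (Suc n) \<omega> \<le> y \<longleftrightarrow> 0 \<le> Rn (Suc n) (tp + r (Suc n) * y) \<omega>" for y \<omega>
    proof -
      have "qn (Suc n) \<omega> \<le> y \<longleftrightarrow> quantile (ecdf (Suc n) (x \<omega>)) p \<le> tp + r (Suc n) * y"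
        using r by (simp add: qn_def divide_le_eq algebra_simps)
      also have "\<dots> \<longleftrightarrow> p \<le> ecdf (Suc n) (x \<omega>) (tp + r (Suc n) * y)" by (rule quantile_ecdf_le_iff[OF _ p']) simp
      also have "\<dots> \<longleftrightarrow> 0 \<le> Rn (Suc n) (tp + r (Suc n) * y) \<omega>"
        using v by (simp add: Rn_def zero_le_divide_iff zero_le_mult_iff)
      finally show ?thesis .
    qed
    show "mono (\<lambda>y. cbb_le p (Suc n) (l (Suc n)) (x \<omega>) (tp + r (Suc n) * y))" for \<omega>
      using r by (intro monoI monoD[OF cbb_le_mono] add_left_mono mult_left_mono) auto
    show "Tn (Suc n) \<omega> = (SUP t. \<bar>cbb_le p (Suc n) (l (Suc n)) (x \<omega>) (tp + r (Suc n) * (qn (Suc n) \<omega> + t)) - prob {\<omega>'\<in>space M. qn (Suc n) \<omega>' \<le> t}\<bar>)" for \<omega>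
      by (rule Tn_eq[OF n])
  next
    fix y
    have "(\<lambda>n. expectation (\<lambda>\<omega>. \<bar>Rn n (tp + r n * y) \<omega> - Rn n (tp + r n * 0) \<omega> - g y\<bar>)) \<longlonglongrightarrow> 0"
    proof (rule tendsto_sandwich[OF _ _ tendsto_const incr_bound_lim[of y]])
      show "\<forall>\<^sub>F n in sequentially. expectation (\<lambda>\<omega>. \<bar>Rn n (tp + r n * y) \<omega> - Rn n (tp + r n * 0) \<omega> - g y\<bar>) \<le> incr_bound y n"
        using eventually_ge_at_top[of 1] by eventually_elim (use Rn_increment in simp)
    qed simp
    then show "(\<lambda>n. expectation (\<lambda>\<omega>. \<bar>Rn (Suc n) (tp + r (Suc n) * y) \<omega> - Rn (Suc n) (tp + r (Suc n) * 0) \<omega> - g y\<bar>)) \<longlonglongrightarrow> 0"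
      by (rule LIMSEQ_Suc)
    have "(\<lambda>n. expectation (\<lambda>\<omega>. \<bar>cbb_le p n (l n) (x \<omega>) (tp + r n * y) - Phi (Rn n (tp + r n * y) \<omega>)\<bar>)) \<longlonglongrightarrow> 0"
      by (rule cbb_le_lim[OF F_lim Rn_L1]) (auto intro!: tendsto_intros incr_bound_lim)
    then show "(\<lambda>n. expectation (\<lambda>\<omega>. \<bar>cbb_le p (Suc n) (l (Suc n)) (x \<omega>) (tp + r (Suc n) * y) - Phi (Rn (Suc n) (tp + r (Suc n) * y) \<omega>)\<bar>)) \<longlonglongrightarrow> 0"
      by (rule LIMSEQ_Suc)
  next
    show "weak_conv_m (\<lambda>n. distr M borel (\<lambda>\<omega>. - Rn (Suc n) (tp + r (Suc n) * 0) \<omega>)) std_normal_distribution"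
      using Rn_tp_clt by simp
  qed (auto simp: cbb_le_01)
  show ?thesis
    using T_lim unfolding weak_conv_m_def weak_conv_def
    by (subst (asm) filterlim_sequentially_Suc)
qed

end

section \<open>The power function and the expansion of the distribution function\<close>

definition spow :: "real \<Rightarrow> real \<Rightarrow> real" where
  "spow \<rho> y = \<bar>y\<bar> powr \<rho> * sgn y"

lemma spow_pos: "0 < y \<Longrightarrow> spow \<rho> y = y powr \<rho>"
  by (simp add: spow_def)

lemma spow_minus: "spow \<rho> (- y) = - spow \<rho> y"
  by (simp add: spow_def)

lemma spow_0: "spow \<rho> 0 = 0"
  by (simp add: spow_def)

lemma spow_inverse:
  assumes "0 < \<rho>" shows "spow \<rho> (spow (1 / \<rho>) y) = y"
proof -
  have pos: "spow \<rho> (spow (1 / \<rho>) y) = y" if "0 < y" for y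
  proof -
    have "0 < y powr (1 / \<rho>)" using that by simp
    then show ?thesis using that assms by (simp add: spow_pos powr_powr)
  qed
  show ?thesis
    using pos[of y] pos[of "- y"] by (cases y "0 :: real" rule: linorder_cases) (auto simp: spow_minus spow_0)
qed

lemma spow_nonneg_mono:
  assumes "0 < \<rho>" "0 \<le> s" "s \<le> t" shows "spow \<rho> s \<le> spow \<rho> t"
proof (cases "s = 0")
  case True
  then show ?thesis using assms by (cases "t = 0") (simp_all add: spow_0 spow_pos)
next
  case False
  then show ?thesis using assms by (simp add: spow_pos powr_mono2)
qed

lemma spow_mono:
  assumes "0 < \<rho>" shows "mono (spow \<rho>)"
proof (rule monoI)
  fix s t :: real assume st: "s \<le> t"
  have nn: "0 \<le> spow \<rho> y" if "0 \<le> y" for y using that by (simp add: spow_def)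
  consider "0 \<le> s" | "s < 0" "0 \<le> t" | "t < 0" by linarith
  then show "spow \<rho> s \<le> spow \<rho> t"
  proof cases
    case 1 then show ?thesis by (rule spow_nonneg_mono[OF assms _ st])
  next
    case 2
    then have "spow \<rho> s \<le> 0" using nn[of "- s"] by (simp add: spow_minus)
    with nn[of t] 2 show ?thesis by linarith
  next
    case 3
    then have "spow \<rho> (- t) \<le> spow \<rho> (- s)" using st by (intro spow_nonneg_mono[OF assms]) auto
    then show ?thesis by (simp add: spow_minus)
  qed
qed

lemma isCont_spow:
  assumes "0 < \<rho>" shows "isCont (spow \<rho>) y"
proof (cases "y = 0")
  case True
  have "((\<lambda>z. \<bar>z\<bar> powr \<rho>) \<longlongrightarrow> 0) (at 0)"
    by (rule tendsto_eq_rhs[OF tendsto_powr'[where a="0::real" and b=\<rho>]])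
      (use assms in \<open>auto intro!: tendsto_intros tendsto_rabs_zero\<close>)
  then have "((\<lambda>z. spow \<rho> z) \<longlongrightarrow> 0) (at 0)"
    by (rule Lim_null_comparison[rotated]) (auto simp: spow_def abs_mult abs_sgn_eq)
  then show ?thesis using True by (simp add: isCont_def spow_0)
next
  case False
  have "isCont sgn y" using False by (rule isCont_sgn[OF continuous_ident])
  then show ?thesis unfolding spow_def using False by (intro continuous_intros) auto
qed

lemma scale_spow: "0 < \<rho> \<Longrightarrow> scale (spow \<rho>) (spow (1 / \<rho>))"
  using spow_inverse[of "1 / \<rho>"] by unfold_locales (auto simp: spow_mono isCont_spow spow_inverse spow_0)

text \<open>By homogeneity of degree \<open>\<rho>\<close>, doubling multiplies by
  \<open>2 powr \<rho>\<close>, which equals 2 only for \<open>\<rho> = 1\<close>.\<close>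

lemma spow_double_ne:
  assumes "0 < \<rho>" "\<rho> \<noteq> 1" "y \<noteq> 0" shows "spow \<rho> (2 * y) \<noteq> 2 * spow \<rho> y"
proof -
  have "2 powr \<rho> \<noteq> 2 powr (1::real)" using assms powr_inj[of 2 \<rho> 1] by simp
  moreover have "spow \<rho> (2 * y) = 2 powr \<rho> * spow \<rho> y"
    by (simp add: spow_def powr_mult abs_mult sgn_mult)
  moreover have "spow \<rho> y \<noteq> 0" using assms by (simp add: spow_def sgn_zero_iff)
  ultimately show ?thesis by simp
qed

section \<open>The local expansion of the distribution function\<close>

lemma expansion_ratio:
  fixes F :: "real \<Rightarrow> real"
  assumes "(\<lambda>h. F (tp + h) - F tp - C * \<bar>h\<bar> powr \<rho> * sgn h) \<in> o[at 0](\<lambda>h. \<bar>h\<bar> powr \<rho>)"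
  shows "((\<lambda>h. (F (tp + h) - F tp) / \<bar>h\<bar> powr \<rho> - C * sgn h) \<longlongrightarrow> 0) (at 0)"
proof -
  have "((\<lambda>h. (F (tp + h) - F tp - C * \<bar>h\<bar> powr \<rho> * sgn h) / \<bar>h\<bar> powr \<rho>) \<longlongrightarrow> 0) (at 0)"
    by (rule smalloD_tendsto[OF assms])
  then show ?thesis
  proof (rule Lim_transform_eventually)
    show "\<forall>\<^sub>F h in at 0. (F (tp + h) - F tp - C * \<bar>h\<bar> powr \<rho> * sgn h) / \<bar>h\<bar> powr \<rho> = (F (tp + h) - F tp) / \<bar>h\<bar> powr \<rho> - C * sgn h"
      unfolding eventually_at_filter by (rule always_eventually) (auto simp: diff_divide_distrib)
  qed
qed

text \<open>To the right of \<open>tp\<close> the difference quotients are nonnegative by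
  monotonicity, and they tend to \<open>C\<close>.\<close>

lemma expansion_pos:
  fixes F :: "real \<Rightarrow> real"
  assumes F: "mono F" and C: "C \<noteq> 0"
    and ex: "(\<lambda>h. F (tp + h) - F tp - C * \<bar>h\<bar> powr \<rho> * sgn h) \<in> o[at 0](\<lambda>h. \<bar>h\<bar> powr \<rho>)"
  shows "0 < C"
proof -
  have "((\<lambda>h. (F (tp + h) - F tp) / \<bar>h\<bar> powr \<rho> - C * sgn h) \<longlongrightarrow> 0) (at_right 0)"
    by (rule tendsto_within_subset[OF expansion_ratio[OF ex]]) auto
  then have "((\<lambda>h. ((F (tp + h) - F tp) / \<bar>h\<bar> powr \<rho> - C * sgn h) + C) \<longlongrightarrow> 0 + C) (at_right 0)"
    by (intro tendsto_add tendsto_const)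
  then have "0 \<le> 0 + C"
  proof (rule tendsto_lowerbound)
    show "\<forall>\<^sub>F h in at_right 0. 0 \<le> ((F (tp + h) - F tp) / \<bar>h\<bar> powr \<rho> - C * sgn h) + C"
      unfolding eventually_at_filter
    proof (rule always_eventually, intro allI impI)
      fix h :: real assume "h \<noteq> 0" "h \<in> {0<..}"
      moreover have "F tp \<le> F (tp + h)" if "0 < h" using that by (intro monoD[OF F]) simp
      ultimately show "0 \<le> ((F (tp + h) - F tp) / \<bar>h\<bar> powr \<rho> - C * sgn h) + C" by simp
    qed
  qed simp
  with C show ?thesis by simp
qed

text \<open>At a jump the value of \<open>F\<close> at its quantile may exceed \<open>p\<close>; the
  expansion excludes this.\<close>

lemma expansion_isCont:
  fixes F :: "real \<Rightarrow> real"
  assumes \<rho>: "0 < \<rho>" and ex: "(\<lambda>h. F (tp + h) - F tp - C * \<bar>h\<bar> powr \<rho> * sgn h) \<in> o[at 0](\<lambda>h. \<bar>h\<bar> powr \<rho>)"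
  shows "isCont F tp"
proof -
  have p0: "((\<lambda>h. \<bar>h\<bar> powr \<rho>) \<longlongrightarrow> 0) (at (0::real))"
    by (rule tendsto_eq_rhs[OF tendsto_powr'[where a="0::real" and b=\<rho>]])
      (use \<rho> in \<open>auto intro!: tendsto_intros tendsto_rabs_zero\<close>)
  have s0: "(spow \<rho> \<longlongrightarrow> 0) (at 0)" using isCont_spow[OF \<rho>, of 0] by (simp add: isCont_def spow_0)
  have "((\<lambda>h. ((F (tp + h) - F tp) / \<bar>h\<bar> powr \<rho> - C * sgn h) * \<bar>h\<bar> powr \<rho> + C * spow \<rho> h) \<longlongrightarrow> 0 * 0 + C * 0) (at 0)"
    by (intro tendsto_add tendsto_mult tendsto_const expansion_ratio[OF ex] p0 s0)
  then have "((\<lambda>h. ((F (tp + h) - F tp) / \<bar>h\<bar> powr \<rho> - C * sgn h) * \<bar>h\<bar> powr \<rho> + C * spow \<rho> h) \<longlongrightarrow> 0) (at 0)" by simp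
  then have "((\<lambda>h. F (tp + h) - F tp) \<longlongrightarrow> 0) (at 0)"
  proof (rule Lim_transform_eventually)
    show "\<forall>\<^sub>F h in at 0. ((F (tp + h) - F tp) / \<bar>h\<bar> powr \<rho> - C * sgn h) * \<bar>h\<bar> powr \<rho> + C * spow \<rho> h = F (tp + h) - F tp"
      unfolding eventually_at_filter
    proof (rule always_eventually, intro allI impI)
      fix h :: real assume "h \<noteq> 0"
      then have "\<bar>h\<bar> powr \<rho> \<noteq> 0" by simp
      moreover have "(A / P - C * s) * P + C * (P * s) = A" if "P \<noteq> 0" for A P s :: real
        using that by (simp add: field_simps)
      ultimately show "((F (tp + h) - F tp) / \<bar>h\<bar> powr \<rho> - C * sgn h) * \<bar>h\<bar> powr \<rho> + C * spow \<rho> h = F (tp + h) - F tp"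
        unfolding spow_def by blast
    qed
  qed
  then have "((\<lambda>h. F (tp + h)) \<longlongrightarrow> F tp) (at 0)" by (simp add: LIM_zero_iff)
  then show ?thesis by (simp add: isCont_iff)
qed

text \<open>\<open>F\<close> is at least \<open>p\<close> to the right of the infimum and below
  \<open>p\<close> to its left, so the one-sided limits give both inequalities. The limits at
  infinity make the set nonempty and bounded below, so that the infimum is meaningful.\<close>

lemma quantile_attained:
  fixes F :: "real \<Rightarrow> real"
  assumes F: "mono F" and cont: "isCont F (quantile F p)"
    and bot: "(F \<longlongrightarrow> 0) at_bot" and top: "(F \<longlongrightarrow> 1) at_top" and p: "0 < p" "p < 1"
  shows "F (quantile F p) = p"
proof (rule antisym)
  let ?S = "{t. p \<le> F t}" and ?q = "quantile F p"
  have "eventually (\<lambda>t. p < F t) at_top" by (rule order_tendstoD(1)[OF top p(2)])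
  then obtain t1 where t1: "p < F t1" by (auto dest: eventually_happens)
  then have ne: "?S \<noteq> {}" by (auto intro: less_imp_le)
  have "eventually (\<lambda>t. F t < p) at_bot" by (rule order_tendstoD(2)[OF bot p(1)])
  then obtain t0 where t0: "F t0 < p" by (auto dest: eventually_happens)
  have lb: "t0 \<le> t" if "t \<in> ?S" for t
  proof (rule ccontr)
    assume "\<not> t0 \<le> t"
    then have "F t \<le> F t0" by (intro monoD[OF F]) simp
    with t0 that show False by simp
  qed
  have bdd: "bdd_below ?S" using lb by (rule bdd_belowI)
  have right: "(F \<longlongrightarrow> F ?q) (at_right ?q)" and left: "(F \<longlongrightarrow> F ?q) (at_left ?q)"
    using cont by (auto simp: isCont_def filterlim_at_split)
  show "p \<le> F ?q"
  proof (rule tendsto_lowerbound[OF right])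
    show "\<forall>\<^sub>F t in at_right ?q. p \<le> F t"
      unfolding eventually_at_filter
    proof (rule always_eventually, intro allI impI)
      fix t assume "t \<in> {?q<..}"
      then obtain s where "s \<in> ?S" "s < t" using cInf_lessD[OF ne, of t] by (auto simp: quantile_def)
      then show "p \<le> F t" using monoD[OF F, of s t] by simp
    qed
  qed simp
  show "F ?q \<le> p"
  proof (rule tendsto_upperbound[OF left])
    show "\<forall>\<^sub>F t in at_left ?q. F t \<le> p"
      unfolding eventually_at_filter
    proof (rule always_eventually, intro allI impI)
      fix t assume "t \<in> {..<?q}"
      then have "t \<notin> ?S" using cInf_lower[OF _ bdd, of t] by (auto simp: quantile_def)
      then show "F t \<le> p" by simp
    qed
  qed simp
qed

text \<open>\<open>r n\<close> solves \<open>C * r n powr \<rho> = \<sigma> / sqrt n\<close>, so the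
  leading term of the expansion becomes exactly \<open>spow \<rho> y\<close>.\<close>

lemma expansion_scaled:
  fixes F :: "real \<Rightarrow> real"
  assumes \<rho>: "0 < \<rho>" and C: "0 < C" and \<sigma>: "0 < \<sigma>"
    and ex: "(\<lambda>h. F (tp + h) - F tp - C * \<bar>h\<bar> powr \<rho> * sgn h) \<in> o[at 0](\<lambda>h. \<bar>h\<bar> powr \<rho>)"
  defines "r \<equiv> \<lambda>n. (\<sigma> / (C * sqrt (real n))) powr (1 / \<rho>)"
  shows "(\<lambda>n. sqrt (real n) * (F (tp + r n * y) - F tp) / \<sigma>) \<longlonglongrightarrow> spow \<rho> y"
proof (cases "y = 0")
  case True then show ?thesis by (simp add: spow_0)
next
  case False
  have q: "(\<lambda>n. \<sigma> / (C * sqrt (real n))) \<longlonglongrightarrow> 0"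
    by (intro tendsto_divide_0[OF tendsto_const] filterlim_at_top_imp_at_infinity
        filterlim_tendsto_pos_mult_at_top[OF tendsto_const C]
        filterlim_compose[OF sqrt_at_top filterlim_real_sequentially])
  have "r \<longlonglongrightarrow> 0 powr (1 / \<rho>)"
    unfolding r_def using \<rho> C \<sigma>
    by (intro tendsto_powr' q tendsto_const) (auto intro!: always_eventually)
  then have r0: "(\<lambda>n. r n * y) \<longlonglongrightarrow> 0" by (intro tendsto_mult_left_zero) simp
  have rpos: "0 < r n" if "1 \<le> n" for n using that C \<sigma> by (simp add: r_def)
  have "filterlim (\<lambda>n. r n * y) (at 0) sequentially"
    unfolding filterlim_at
  proof
    show "\<forall>\<^sub>F n in sequentially. r n * y \<in> UNIV \<and> r n * y \<noteq> 0"
      using eventually_ge_at_top[of 1] by eventually_elim (use rpos False in force)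
  qed (rule r0)
  from filterlim_compose[OF expansion_ratio[OF ex] this]
  have "(\<lambda>n. (F (tp + r n * y) - F tp) / \<bar>r n * y\<bar> powr \<rho> - C * sgn (r n * y)) \<longlonglongrightarrow> 0" .
  then have "(\<lambda>n. \<bar>y\<bar> powr \<rho> / C * ((F (tp + r n * y) - F tp) / \<bar>r n * y\<bar> powr \<rho> - C * sgn (r n * y)) + spow \<rho> y) \<longlonglongrightarrow> \<bar>y\<bar> powr \<rho> / C * 0 + spow \<rho> y"
    by (intro tendsto_add tendsto_mult tendsto_const)
  then have "(\<lambda>n. \<bar>y\<bar> powr \<rho> / C * ((F (tp + r n * y) - F tp) / \<bar>r n * y\<bar> powr \<rho> - C * sgn (r n * y)) + spow \<rho> y) \<longlonglongrightarrow> spow \<rho> y" by simp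
  then show ?thesis
  proof (rule Lim_transform_eventually)
    show "\<forall>\<^sub>F n in sequentially. \<bar>y\<bar> powr \<rho> / C * ((F (tp + r n * y) - F tp) / \<bar>r n * y\<bar> powr \<rho> - C * sgn (r n * y)) + spow \<rho> y
        = sqrt (real n) * (F (tp + r n * y) - F tp) / \<sigma>"
      using eventually_ge_at_top[of 1]
    proof eventually_elim
      case (elim n)
      have r: "0 < r n" by (rule rpos[OF elim])
      have sg: "sgn (r n * y) = sgn y" using r by (simp add: sgn_mult)
      have "r n powr \<rho> = \<sigma> / (C * sqrt (real n))" using \<rho> C \<sigma> elim by (simp add: r_def powr_powr)
      then have eq: "\<bar>r n * y\<bar> powr \<rho> = \<sigma> / (C * sqrt (real n)) * \<bar>y\<bar> powr \<rho>" using r by (simp add: abs_mult powr_mult)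
      have gen: "a / C * (d / (\<sigma> / (C * u) * a) - C * s) + a * s = u * d / \<sigma>" if "0 < a" "0 < u" for a d u s
        using that C \<sigma> by (simp add: field_simps)
      show ?case unfolding sg spow_def eq using False elim by (intro gen) auto
    qed
  qed
qed

theorem corollary2:
  fixes \<rho> :: real
  assumes "\<rho> > 0" and "\<rho> \<noteq> 1"
  shows "\<exists>(N :: real measure) (Z :: real \<Rightarrow> real).
    prob_space N \<and> Z \<in> borel_measurable N \<and> \<not> (\<exists>c. AE z in N. Z z = c) \<and>
    (\<forall>(M :: 'a measure) (X :: int \<Rightarrow> 'a \<Rightarrow> real) (F :: real \<Rightarrow> real) (p :: real) (t\<^sub>p :: real)
        (C :: real) (l :: nat \<Rightarrow> nat).
      prob_space M \<longrightarrow> (\<forall>i. X i \<in> borel_measurable M) \<longrightarrow>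
      strictly_stationary M X \<longrightarrow> strongly_mixing M X \<longrightarrow>
      (\<forall>i. F = cdf (distr M borel (X i))) \<longrightarrow>
      0 < p \<longrightarrow> p < 1 \<longrightarrow> t\<^sub>p = quantile F p \<longrightarrow>
      C \<noteq> 0 \<longrightarrow>
      (\<lambda>h. F (t\<^sub>p + h) - F t\<^sub>p - C * \<bar>h\<bar> powr \<rho> * sgn h) \<in> o[at 0](\<lambda>h. \<bar>h\<bar> powr \<rho>) \<longrightarrow>
      summable (\<lambda>k. mixing_coeff M X (Suc k)) \<longrightarrow>
      (\<exists>v>0. (\<lambda>n. prob_space.variance M
                (\<lambda>\<omega>. sqrt (real n) * ecdf n (\<lambda>i. X (int i) \<omega>) t\<^sub>p)) \<longlonglongrightarrow> v) \<longrightarrow>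
      (\<forall>n\<ge>1. 1 \<le> l n \<and> l n \<le> n) \<longrightarrow>
      (\<lambda>n. 1 / real (l n) + real (l n) / real n) \<longlonglongrightarrow> 0 \<longrightarrow>
      weak_conv_m
        (\<lambda>n. distr M borel (\<lambda>\<omega>. SUP t::real.
            \<bar>cbb_prob p n (l n) (\<lambda>i. X (int i) \<omega>) t -
             measure M {\<omega>'\<in>space M. quantile (ecdf n (\<lambda>i. X (int i) \<omega>')) p - t\<^sub>p \<le> t}\<bar>))
        (distr N borel Z))"
proof -
  interpret scale "spow \<rho>" "spow (1 / \<rho>)" by (rule scale_spow[OF assms(1)])
  show ?thesis
  proof (intro exI[of _ std_normal_distribution] exI[of _ "\<lambda>z. gap (spow (1 / \<rho>) z)"] conjI allI impI)
    show "prob_space std_normal_distribution" by (rule std_normal.prob_space_axioms)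
    show "(\<lambda>z. gap (spow (1 / \<rho>) z)) \<in> borel_measurable std_normal_distribution" by simp
    show "\<not> (\<exists>c. AE z in std_normal_distribution. gap (spow (1 / \<rho>) z) = c)"
      by (rule gap_nondegenerate) (rule spow_double_ne[OF assms])
  next
    fix M :: "'a measure" and X :: "int \<Rightarrow> 'a \<Rightarrow> real" and F :: "real \<Rightarrow> real" and p tp C :: real and l :: "nat \<Rightarrow> nat"
    assume M: "prob_space M" and X [rule_format]: "\<forall>i. X i \<in> borel_measurable M"
      and stat: "strictly_stationary M X" and "strongly_mixing M X"
      and F: "\<forall>i. F = cdf (distr M borel (X i))" and p: "0 < p" "p < 1" and tp: "tp = quantile F p"
      and "C \<noteq> 0" and ex: "(\<lambda>h. F (tp + h) - F tp - C * \<bar>h\<bar> powr \<rho> * sgn h) \<in> o[at 0](\<lambda>h. \<bar>h\<bar> powr \<rho>)"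
      and sm: "summable (\<lambda>k. mixing_coeff M X (Suc k))"
      and "\<exists>v>0. (\<lambda>n. prob_space.variance M (\<lambda>\<omega>. sqrt (real n) * ecdf n (\<lambda>i. X (int i) \<omega>) tp)) \<longlonglongrightarrow> v"
      and l [rule_format]: "\<forall>n\<ge>1. 1 \<le> l n \<and> l n \<le> n" and l_lim: "(\<lambda>n. 1 / real (l n) + real (l n) / real n) \<longlonglongrightarrow> 0"
    then obtain v where v: "0 < v"
      and var: "(\<lambda>n. prob_space.variance M (\<lambda>\<omega>. sqrt (real n) * ecdf n (\<lambda>i. X (int i) \<omega>) tp)) \<longlonglongrightarrow> v" by auto
    interpret P: mixing_process M X
      using M X stat sm by (simp add: mixing_process_def mixing_process_axioms_def)
    have Fi: "F = cdf (distr M borel (X i))" for i using F by blast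
    interpret D: real_distribution "distr M borel (X 1)" by (rule P.real_distribution_distr) simp
    have F1: "F = cdf (distr M borel (X 1))" by (rule Fi)
    have mF: "mono F" unfolding F1 by (intro monoI D.cdf_nondecreasing)
    have prob_F: "P.prob {\<omega>\<in>space M. X i \<omega> \<le> t} = F t" for i t
    proof -
      have "X i -` {..t} \<inter> space M = {\<omega>\<in>space M. X i \<omega> \<le> t}" by auto
      then show ?thesis unfolding Fi[of i] by (simp add: cdf_def measure_distr)
    qed
    have F_tp: "F tp = p"
      unfolding tp
    proof (rule quantile_attained[OF mF _ _ _ p])
      show "isCont F (quantile F p)" using expansion_isCont[OF assms(1) ex] by (simp add: tp)
      show "(F \<longlongrightarrow> 0) at_bot" unfolding F1 by (rule D.cdf_lim_at_bot)
      show "(F \<longlongrightarrow> 1) at_top" unfolding F1 by (rule D.cdf_lim_at_top_prob)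
    qed
    have C: "0 < C" by (rule expansion_pos[OF mF \<open>C \<noteq> 0\<close> ex])
    have ind_int: "integrable M (\<lambda>\<omega>. indicator {..tp} (X i \<omega>) :: real)" for i
      by (rule P.integrable_bounded[where B=1]) (auto simp: indicator_def)
    have ind_E: "P.expectation (\<lambda>\<omega>. indicator {..tp} (X i \<omega>)) = p" for i
    proof -
      have "P.expectation (\<lambda>\<omega>. indicator {..tp} (X i \<omega>) :: real) = P.expectation (indicator {\<omega>\<in>space M. X i \<omega> \<le> tp})"
        by (rule Bochner_Integration.integral_cong) (auto simp: indicator_def)
      then show ?thesis by (simp add: prob_F F_tp)
    qed
    \<comment> \<open>Since the mean of the empirical distribution function at \<open>tp\<close> is
      \<open>p\<close>, the variance in the hypothesis is the normalised second moment of the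
      centred sum that \<open>cbb_setup\<close> uses.\<close>
    have v_lim: "(\<lambda>n. P.expectation (\<lambda>\<omega>. (\<Sum>r<n. (indicator {..tp} (X (int (1 + r)) \<omega>) - p))\<^sup>2) / real n) \<longlonglongrightarrow> v"
    proof (rule Lim_transform_eventually[OF var])
      show "\<forall>\<^sub>F n in sequentially. P.variance (\<lambda>\<omega>. sqrt (real n) * ecdf n (\<lambda>i. X (int i) \<omega>) tp)
          = P.expectation (\<lambda>\<omega>. (\<Sum>r<n. (indicator {..tp} (X (int (1 + r)) \<omega>) - p))\<^sup>2) / real n"
        using eventually_ge_at_top[of 1]
      proof eventually_elim
        case (elim n)
        let ?e = "\<lambda>\<omega>. ecdf n (\<lambda>i. X (int i) \<omega>) tp"
        have "P.expectation ?e = p"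
          unfolding ecdf_def using elim by (simp add: ind_int ind_E)
        then have mean: "P.expectation (\<lambda>\<omega>. sqrt (real n) * ?e \<omega>) = sqrt (real n) * p" by simp
        have "(sqrt (real n) * ?e \<omega> - sqrt (real n) * p)\<^sup>2 = (\<Sum>r<n. (indicator {..tp} (X (int (1 + r)) \<omega>) - p))\<^sup>2 / real n" for \<omega>
        proof -
          have "(\<Sum>i=1..n. indicator {..tp} (X (int i) \<omega>) :: real) = (\<Sum>r<n. indicator {..tp} (X (int (1 + r)) \<omega>))"
            by (rule sum.reindex_bij_witness[of _ "\<lambda>r. 1 + r" "\<lambda>i. i - 1"]) auto
          then have "(\<Sum>r<n. (indicator {..tp} (X (int (1 + r)) \<omega>) - p)) = real n * (?e \<omega> - p)"
            using elim by (simp add: ecdf_def sum_subtractf right_diff_distrib)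
          then have "(\<Sum>r<n. (indicator {..tp} (X (int (1 + r)) \<omega>) - p))\<^sup>2 / real n = real n * (?e \<omega> - p)\<^sup>2"
            using elim by (simp add: power_mult_distrib power2_eq_square)
          also have "\<dots> = (sqrt (real n) * ?e \<omega> - sqrt (real n) * p)\<^sup>2"
            by (simp add: right_diff_distrib[symmetric] power_mult_distrib)
          finally show ?thesis by simp
        qed
        then show ?case unfolding mean by simp
      qed
    qed
    define r where "r n = (sqrt v / (C * sqrt (real n))) powr (1 / \<rho>)" for n :: nat
    interpret cbb_scaled M X F p tp v l "spow \<rho>" "spow (1 / \<rho>)" r
    proof unfold_locales
      show "P.prob {\<omega>\<in>space M. X 1 \<omega> \<le> t} = F t" for t by (rule prob_F)
      show "0 < r n" if "1 \<le> n" for n using that v C by (simp add: r_def)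
      show "(\<lambda>n. sqrt (real n) * (F (tp + r n * y) - p) / sqrt v) \<longlonglongrightarrow> spow \<rho> y" for y
        using expansion_scaled[OF assms(1) C _ ex, of "sqrt v" y] v by (simp add: r_def[abs_def] F_tp)
    qed (use F_tp p v v_lim l l_lim in auto)
    show "weak_conv_m (\<lambda>n. distr M borel (\<lambda>\<omega>. SUP t::real. \<bar>cbb_prob p n (l n) (\<lambda>i. X (int i) \<omega>) t -
             measure M {\<omega>'\<in>space M. quantile (ecdf n (\<lambda>i. X (int i) \<omega>')) p - tp \<le> t}\<bar>))
        (distr std_normal_distribution borel (\<lambda>z. gap (spow (1 / \<rho>) z)))"
      using Tn_lim unfolding Tn_def[abs_def] .
  qed
qed

end
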